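(* There are absolute constants $b,\gamma>0$ with the following property. Let $d_0,n\ge1$ and let $S$ be a Hermitian operator in $M_{d_0}\otimes M_{2^n}$. For every integer $k\ge1$ there is a Hermitian operator $R\in M_{d_0}\otimes M_{2^n}$ of the form $$R=\sum_{|\alpha|\le k}\widehat R(\alpha)\otimes P_\alpha,\qquad\widehat R(\alpha)\in M_{d_0},$$ such that $$\|S-R\|_4\le2\,\big\|S-(\mathrm{id}_{M_{d_0}}\otimes\mathcal T_{bk^{-\gamma}})(S)\big\|_4 .$$ The constants $b$ and $\gamma$ are independent of $d_0$ and $n$.
   Context: $M_d$: $d\times d$ complex matrices. Norms are normalized Schatten norms: for $X\in M_d$, $\|X\|_4=\left(\frac1d\mathrm{Tr}\,|X|^4\right)^{1/4}$, $|X|=(X^\dagger X)^{1/2}$ (here $d=d_02^n$). Pauli strings: for $\alpha\in(\mathbb F_2^2)^n$, $P_\alpha=P_{\alpha_1}\otimes\cdots\otimes P_{\alpha_n}$ with $P_{(0,0)}=\mathbb 1,P_{(1,0)}=\mathsf X,P_{(0,1)}=\mathsf Z,P_{(1,1)}=\mathsf Y$, and $|\alpha|=|\{i:\alpha_i\ne0\}|$. $\mathcal T_u$ ($u\ge0$) is the $n$-qubit depolarizing map, the linear map on $M_{2^n}=M_2^{\otimes n}$ with $\mathcal T_u(P_\alpha)=e^{-u|\alpha|}P_\alpha$, i.e. $\mathcal T_u=\mathcal D_u^{\otimes n}$ with $\mathcal D_u(X)=e^{-u}X+(1-e^{-u})\frac{\mathrm{Tr}X}2\mathbb 1$. *)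

theory Defs
  imports
    Complex_Main
    "HOL-Library.Z2"
    "Jordan_Normal_Form.Matrix"
    "Jordan_Normal_Form.Schur_Decomposition"
begin

section \<open>Hermitian matrices, modulus and normalized Schatten norms\<close>

definition mat_trace :: "complex mat \<Rightarrow> complex" where
  "mat_trace A = (\<Sum>i<dim_row A. A $$ (i, i))"

definition hermitian_mat :: "complex mat \<Rightarrow> bool" where
  "hermitian_mat A \<longleftrightarrow> square_mat A \<and> mat_adjoint A = A"

definition psd_mat :: "complex mat \<Rightarrow> bool" where
  "psd_mat A \<longleftrightarrow> hermitian_mat A \<and>
     (\<forall>v \<in> carrier_vec (dim_row A). 0 \<le> Re ((A *\<^sub>v v) \<bullet>c v))"

text \<open>A positive semidefinite matrix has exactly one positive semidefinite square root,
  so the choice below selects that one. For other arguments the value is irrelevant.\<close>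

definition psd_sqrt :: "complex mat \<Rightarrow> complex mat" where
  "psd_sqrt A = (SOME B. psd_mat B \<and> B \<in> carrier_mat (dim_row A) (dim_row A) \<and> B * B = A)"

definition mat_abs :: "complex mat \<Rightarrow> complex mat" where
  "mat_abs A = psd_sqrt (mat_adjoint A * A)"

text \<open>For integer exponents \<open>p \<ge> 1\<close>. The trace of a power of the positive semidefinite
  matrix \<open>mat_abs A\<close> is a nonnegative real number, so \<open>Re\<close> only changes its type.\<close>

definition schatten_norm :: "nat \<Rightarrow> complex mat \<Rightarrow> real" where
  "schatten_norm p A = root p (Re (mat_trace (mat_abs A ^\<^sub>m p)) / real (dim_row A))"

section \<open>Tensor products\<close>

text \<open>\<open>M\<^sub>a \<otimes> M\<^sub>b\<close> is identified with the \<open>ab \<times> ab\<close> matrices, the left factor being the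
  more significant part \<open>i div b\<close> of an index \<open>i < a * b\<close>.\<close>

definition kron :: "complex mat \<Rightarrow> complex mat \<Rightarrow> complex mat" where
  "kron A B = mat (dim_row A * dim_row B) (dim_col A * dim_col B)
     (\<lambda>(i, j). A $$ (i div dim_row B, j div dim_col B) * B $$ (i mod dim_row B, j mod dim_col B))"

text \<open>The map \<open>id \<otimes> T\<close> on \<open>M\<^sub>a \<otimes> M\<^sub>b\<close> for a linear map \<open>T\<close> on \<open>M\<^sub>b\<close>: it applies \<open>T\<close> to each of
  the \<open>a\<^sup>2\<close> blocks \<open>S\<^sub>p\<^sub>q\<close> of \<open>S = (\<Sum>p q. E\<^sub>p\<^sub>q \<otimes> S\<^sub>p\<^sub>q)\<close>, where \<open>E\<^sub>p\<^sub>q\<close> are the matrix units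
  of \<open>M\<^sub>a\<close>. See \<open>id_tensor_kron\<close>.\<close>

definition tensor_block :: "nat \<Rightarrow> complex mat \<Rightarrow> nat \<Rightarrow> nat \<Rightarrow> complex mat" where
  "tensor_block b S p q = mat b b (\<lambda>(i, j). S $$ (p * b + i, q * b + j))"

definition id_tensor ::
  "nat \<Rightarrow> nat \<Rightarrow> (complex mat \<Rightarrow> complex mat) \<Rightarrow> complex mat \<Rightarrow> complex mat" where
  "id_tensor a b T S = mat (a * b) (a * b)
     (\<lambda>(i, j). T (tensor_block b S (i div b) (j div b)) $$ (i mod b, j mod b))"

text \<open>Sum of a family of \<open>d \<times> d\<close> matrices; matrices of unspecified size have no common zero,
  so \<open>sum\<close> is not available for them.\<close>

definition mat_sum :: "nat \<Rightarrow> ('i \<Rightarrow> complex mat) \<Rightarrow> 'i set \<Rightarrow> complex mat" where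
  "mat_sum d F I = mat d d (\<lambda>(i, j). \<Sum>\<alpha>\<in>I. F \<alpha> $$ (i, j))"

section \<open>Pauli strings and the depolarizing map\<close>

definition pauli :: "bit \<times> bit \<Rightarrow> complex mat" where
  "pauli a =
     (if a = (0, 0) then 1\<^sub>m 2
      else if a = (1, 0) then mat_of_rows_list 2 [[0, 1], [1, 0]]
      else if a = (0, 1) then mat_of_rows_list 2 [[1, 0], [0, -1]]
      else mat_of_rows_list 2 [[0, -\<i>], [\<i>, 0]])"

text \<open>Elements of \<open>(F\<^sub>2\<^sup>2)\<^sup>n\<close> are lists of length \<open>n\<close>.\<close>

definition pauli_indices :: "nat \<Rightarrow> (bit \<times> bit) list set" where
  "pauli_indices n = {\<alpha>. length \<alpha> = n}"

primrec pauli_string :: "(bit \<times> bit) list \<Rightarrow> complex mat" where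
  "pauli_string [] = 1\<^sub>m 1"
| "pauli_string (a # \<alpha>) = kron (pauli a) (pauli_string \<alpha>)"

definition pauli_weight :: "(bit \<times> bit) list \<Rightarrow> nat" where
  "pauli_weight \<alpha> = card {i. i < length \<alpha> \<and> \<alpha> ! i \<noteq> (0, 0)}"

text \<open>The linear map on \<open>2\<^sup>n \<times> 2\<^sup>n\<close> matrices that multiplies \<open>P\<^sub>\<alpha>\<close> by \<open>exp (- u |\<alpha>|)\<close>. The Pauli
  strings form a basis, orthogonal for the trace inner product, and the coefficient of \<open>X\<close> at
  \<open>P\<^sub>\<alpha>\<close> is \<open>Tr (P\<^sub>\<alpha> X) / 2\<^sup>n\<close>. See \<open>depolarizing_pauli_string\<close>, \<open>depolarizing_add\<close> and
  \<open>depolarizing_smult\<close>.\<close>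

definition depolarizing :: "nat \<Rightarrow> real \<Rightarrow> complex mat \<Rightarrow> complex mat" where
  "depolarizing n u X = mat_sum (2 ^ n)
     (\<lambda>\<alpha>. (complex_of_real (exp (- u * real (pauli_weight \<alpha>))) *
            (mat_trace (pauli_string \<alpha> * X) / 2 ^ n)) \<cdot>\<^sub>m pauli_string \<alpha>)
     (pauli_indices n)"

lemma finite_pauli_indices [simp]: "finite (pauli_indices n)"
proof -
  have two: "x = 0 \<or> x = 1" for x :: bit by (cases x) simp_all
  have "UNIV = {0, 1 :: bit}" using two by fast
  then have fin: "finite (UNIV :: bit set)" by (metis finite.emptyI finite.insertI)
  have "finite {\<alpha> :: (bit \<times> bit) list. set \<alpha> \<subseteq> UNIV \<times> UNIV \<and> length \<alpha> = n}"
    by (rule finite_lists_length_eq[OF finite_cartesian_product[OF fin fin]])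
  then show ?thesis by (simp add: pauli_indices_def)
qed

lemma kron_carrier [simp]:
  assumes "A \<in> carrier_mat a b" "B \<in> carrier_mat c d"
  shows "kron A B \<in> carrier_mat (a * c) (b * d)"
  using assms by (auto simp: kron_def)

lemma pauli_carrier [simp]: "pauli a \<in> carrier_mat 2 2"
  by (auto simp: pauli_def mat_of_rows_list_def)

lemma pauli_string_carrier: "pauli_string \<alpha> \<in> carrier_mat (2 ^ length \<alpha>) (2 ^ length \<alpha>)"
  by (induction \<alpha>) (auto intro: kron_carrier)

lemma tensor_index_less:
  fixes i p b :: nat
  assumes "p < a" "i < b"
  shows "p * b + i < a * b"
proof -
  have "p * b + i < Suc p * b" using assms by simp
  also have "\<dots> \<le> a * b" using assms by (intro mult_le_mono) auto
  finally show ?thesis .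
qed

lemma id_tensor_kron:
  assumes A: "A \<in> carrier_mat a a" and X: "X \<in> carrier_mat b b"
    and TX: "T X \<in> carrier_mat b b"
    and smult: "\<And>c. T (c \<cdot>\<^sub>m X) = c \<cdot>\<^sub>m T X"
  shows "id_tensor a b T (kron A X) = kron A (T X)"
proof (rule eq_matI)
  fix i j assume ij: "i < dim_row (kron A (T X))" "j < dim_col (kron A (T X))"
  then have ij': "i < a * b" "j < a * b" using A TX by (auto simp: kron_def)
  then have b: "b > 0" by (cases b) auto
  have d: "i div b < a" "j div b < a"
    using ij' by (auto simp: less_mult_imp_div_less)
  have "tensor_block b (kron A X) (i div b) (j div b) = A $$ (i div b, j div b) \<cdot>\<^sub>m X"
  proof (rule eq_matI)
    fix k l assume "k < dim_row (A $$ (i div b, j div b) \<cdot>\<^sub>m X)"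
      "l < dim_col (A $$ (i div b, j div b) \<cdot>\<^sub>m X)"
    then have kl: "k < b" "l < b" using X by auto
    show "tensor_block b (kron A X) (i div b) (j div b) $$ (k, l) =
        (A $$ (i div b, j div b) \<cdot>\<^sub>m X) $$ (k, l)"
      using kl A X b d tensor_index_less[OF d(1) kl(1)] tensor_index_less[OF d(2) kl(2)]
      by (simp add: tensor_block_def kron_def)
  qed (use X in \<open>auto simp: tensor_block_def\<close>)
  then show "id_tensor a b T (kron A X) $$ (i, j) = kron A (T X) $$ (i, j)"
    using ij' A TX b smult by (simp add: id_tensor_def kron_def)
qed (use A TX in \<open>auto simp: id_tensor_def kron_def\<close>)

lemma depolarizing_carrier [simp]: "depolarizing n u X \<in> carrier_mat (2 ^ n) (2 ^ n)"
  by (simp add: depolarizing_def mat_sum_def)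

lemma mat_trace_mult:
  assumes "A \<in> carrier_mat d d" "B \<in> carrier_mat d d"
  shows "mat_trace (A * B) = (\<Sum>i<d. \<Sum>j<d. A $$ (i, j) * B $$ (j, i))"
  using assms by (simp add: mat_trace_def scalar_prod_def lessThan_atLeast0)

lemma depolarizing_index:
  assumes "i < 2 ^ n" "j < 2 ^ n"
  shows "depolarizing n u X $$ (i, j) =
    (\<Sum>\<alpha>\<in>pauli_indices n. complex_of_real (exp (- u * real (pauli_weight \<alpha>))) *
      (mat_trace (pauli_string \<alpha> * X) / 2 ^ n) * pauli_string \<alpha> $$ (i, j))"
proof -
  have "(c \<cdot>\<^sub>m pauli_string \<alpha>) $$ (i, j) = c * pauli_string \<alpha> $$ (i, j)"
    if "\<alpha> \<in> pauli_indices n" for c \<alpha>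
    using that assms pauli_string_carrier[of \<alpha>] by (auto simp: pauli_indices_def)
  then show ?thesis
    unfolding depolarizing_def mat_sum_def using assms
    by (simp only: index_mat case_prod_conv) (rule sum.cong[OF refl], blast)
qed

lemma depolarizing_add:
  assumes X: "X \<in> carrier_mat (2 ^ n) (2 ^ n)" and Y: "Y \<in> carrier_mat (2 ^ n) (2 ^ n)"
  shows "depolarizing n u (X + Y) = depolarizing n u X + depolarizing n u Y"
proof -
  have tr: "mat_trace (pauli_string \<alpha> * (X + Y)) =
      mat_trace (pauli_string \<alpha> * X) + mat_trace (pauli_string \<alpha> * Y)"
    if "\<alpha> \<in> pauli_indices n" for \<alpha>
  proof -
    have P: "pauli_string \<alpha> \<in> carrier_mat (2 ^ n) (2 ^ n)"
      using that pauli_string_carrier[of \<alpha>] by (simp add: pauli_indices_def)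
    have XY: "X + Y \<in> carrier_mat (2 ^ n) (2 ^ n)" using X Y by simp
    have "(\<Sum>i<2 ^ n. \<Sum>j<2 ^ n. pauli_string \<alpha> $$ (i, j) * (X + Y) $$ (j, i)) =
        (\<Sum>i<2 ^ n. \<Sum>j<2 ^ n. pauli_string \<alpha> $$ (i, j) * X $$ (j, i)
          + pauli_string \<alpha> $$ (i, j) * Y $$ (j, i))"
      using X Y by (intro sum.cong refl) (simp add: distrib_left)
    then show ?thesis
      unfolding mat_trace_mult[OF P X] mat_trace_mult[OF P Y] mat_trace_mult[OF P XY]
      by (simp only: sum.distrib)
  qed
  show ?thesis
  proof (rule eq_matI)
    fix i j assume "i < dim_row (depolarizing n u X + depolarizing n u Y)"
      "j < dim_col (depolarizing n u X + depolarizing n u Y)"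
    then have ij: "i < 2 ^ n" "j < 2 ^ n" by (auto simp: depolarizing_def mat_sum_def)
    have "depolarizing n u (X + Y) $$ (i, j) =
        (\<Sum>\<alpha>\<in>pauli_indices n. complex_of_real (exp (- u * real (pauli_weight \<alpha>))) *
          (mat_trace (pauli_string \<alpha> * X) / 2 ^ n) * pauli_string \<alpha> $$ (i, j) +
          complex_of_real (exp (- u * real (pauli_weight \<alpha>))) *
          (mat_trace (pauli_string \<alpha> * Y) / 2 ^ n) * pauli_string \<alpha> $$ (i, j))"
      unfolding depolarizing_index[OF ij]
      by (intro sum.cong refl) (simp only: tr add_divide_distrib distrib_left distrib_right)
    then show "depolarizing n u (X + Y) $$ (i, j) =
        (depolarizing n u X + depolarizing n u Y) $$ (i, j)"
      using ij depolarizing_carrier[of n u Y]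
      by (simp only: index_add_mat carrier_matD depolarizing_index sum.distrib)
  qed (auto simp: depolarizing_def mat_sum_def)
qed

lemma depolarizing_smult:
  assumes X: "X \<in> carrier_mat (2 ^ n) (2 ^ n)"
  shows "depolarizing n u (c \<cdot>\<^sub>m X) = c \<cdot>\<^sub>m depolarizing n u X"
proof -
  have tr: "mat_trace (pauli_string \<alpha> * (c \<cdot>\<^sub>m X)) = c * mat_trace (pauli_string \<alpha> * X)"
    if "\<alpha> \<in> pauli_indices n" for \<alpha>
    using that X pauli_string_carrier[of \<alpha>]
    by (simp add: mat_trace_mult[where d = "2 ^ n"] pauli_indices_def
        sum_distrib_left mult_ac)
  show ?thesis
  proof (rule eq_matI)
    fix i j assume "i < dim_row (c \<cdot>\<^sub>m depolarizing n u X)"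
      "j < dim_col (c \<cdot>\<^sub>m depolarizing n u X)"
    then have ij: "i < 2 ^ n" "j < 2 ^ n" by (auto simp: depolarizing_def mat_sum_def)
    have "depolarizing n u (c \<cdot>\<^sub>m X) $$ (i, j) =
        (\<Sum>\<alpha>\<in>pauli_indices n. c * (complex_of_real (exp (- u * real (pauli_weight \<alpha>))) *
          (mat_trace (pauli_string \<alpha> * X) / 2 ^ n) * pauli_string \<alpha> $$ (i, j)))"
      unfolding depolarizing_index[OF ij]
      by (intro sum.cong refl) (simp only: tr times_divide_eq_right times_divide_eq_left mult_ac)
    then show "depolarizing n u (c \<cdot>\<^sub>m X) $$ (i, j) = (c \<cdot>\<^sub>m depolarizing n u X) $$ (i, j)"
      using ij depolarizing_carrier[of n u X]
      by (simp only: index_smult_mat carrier_matD depolarizing_index sum_distrib_left)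
  qed (auto simp: depolarizing_def mat_sum_def)
qed

lemma sum_tensor_index:
  fixes f :: "nat \<Rightarrow> nat \<Rightarrow> complex"
  shows "(\<Sum>r<a * b. f (r div b) (r mod b)) = (\<Sum>i<a. \<Sum>j<b. f i j)"
proof -
  have "(\<Sum>r<a * b. f (r div b) (r mod b)) =
      (\<Sum>i<a. \<Sum>r\<in>{i * b..<i * b + b}. f (r div b) (r mod b))"
    by (rule sum.nat_group[symmetric])
  also have "\<dots> = (\<Sum>i<a. \<Sum>j<b. f i j)"
  proof (rule sum.cong)
    fix i
    show "(\<Sum>r\<in>{i * b..<i * b + b}. f (r div b) (r mod b)) = (\<Sum>j<b. f i j)"
      by (rule sum.reindex_bij_witness[of _ "\<lambda>j. i * b + j" "\<lambda>r. r - i * b"])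
        (auto simp: div_nat_eqI modulo_nat_def algebra_simps)
  qed simp
  finally show ?thesis .
qed

lemma mat_trace_kron_mult:
  assumes A: "A \<in> carrier_mat a a" and C: "C \<in> carrier_mat a a"
    and B: "B \<in> carrier_mat b b" and D: "D \<in> carrier_mat b b"
  shows "mat_trace (kron A B * kron C D) = mat_trace (A * C) * mat_trace (B * D)"
proof -
  have "mat_trace (kron A B * kron C D) =
      (\<Sum>r<a * b. \<Sum>s<a * b. kron A B $$ (r, s) * kron C D $$ (s, r))"
    by (rule mat_trace_mult) (use assms in auto)
  also have "\<dots> = (\<Sum>r<a * b. \<Sum>s<a * b.
      (\<lambda>i k j l. A $$ (i, j) * B $$ (k, l) * (C $$ (j, i) * D $$ (l, k)))
        (r div b) (r mod b) (s div b) (s mod b))"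
    using assms by (intro sum.cong) (auto simp: kron_def)
  also have "\<dots> = (\<Sum>i<a. \<Sum>k<b. \<Sum>j<a. \<Sum>l<b.
      A $$ (i, j) * B $$ (k, l) * (C $$ (j, i) * D $$ (l, k)))"
    by (subst sum_tensor_index, subst sum_tensor_index) simp
  also have "\<dots> = (\<Sum>i<a. \<Sum>j<a. \<Sum>k<b. \<Sum>l<b.
      (A $$ (i, j) * C $$ (j, i)) * (B $$ (k, l) * D $$ (l, k)))"
    by (subst (2) sum.swap) (simp add: mult_ac)
  also have "\<dots> = mat_trace (A * C) * mat_trace (B * D)"
    by (simp only: mat_trace_mult[OF A C] mat_trace_mult[OF B D] sum_distrib_left[symmetric]
        sum_distrib_right[symmetric])
  finally show ?thesis .
qed

lemma sum_less_two: "(\<Sum>i<(2::nat). f i) = f 0 + f (Suc 0)" for f :: "nat \<Rightarrow> complex"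
  by (simp add: numeral_2_eq_2)

lemma pauli_index:
  "pauli a $$ (0, 0) = (if fst a = 1 then 0 else 1)"
  "pauli a $$ (0, Suc 0) = (if fst a = 0 then 0 else if snd a = 0 then 1 else -\<i>)"
  "pauli a $$ (Suc 0, 0) = (if fst a = 0 then 0 else if snd a = 0 then 1 else \<i>)"
  "pauli a $$ (Suc 0, Suc 0) = (if fst a = 1 then 0 else if snd a = 0 then 1 else -1)"
  by (auto simp: pauli_def mat_of_rows_list_def prod_eq_iff)

lemma mat_trace_pauli: "mat_trace (pauli a * pauli b) = (if a = b then 2 else 0)"
proof -
  have bit: "x = 0 \<or> x = 1" for x :: bit by (cases x) simp_all
  have val: "pauli a $$ (0, 0) * pauli b $$ (0, 0) +
      pauli a $$ (0, Suc 0) * pauli b $$ (Suc 0, 0) +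
      (pauli a $$ (Suc 0, 0) * pauli b $$ (0, Suc 0) +
      pauli a $$ (Suc 0, Suc 0) * pauli b $$ (Suc 0, Suc 0)) = (if a = b then 2 else 0)"
    using bit[of "fst a"] bit[of "snd a"] bit[of "fst b"] bit[of "snd b"]
    unfolding prod_eq_iff pauli_index
    by (elim disjE) simp_all
  then show ?thesis
    unfolding mat_trace_mult[OF pauli_carrier pauli_carrier] sum_less_two .
qed

lemma mat_trace_pauli_string:
  assumes "length \<alpha> = length \<beta>"
  shows "mat_trace (pauli_string \<alpha> * pauli_string \<beta>) = (if \<alpha> = \<beta> then 2 ^ length \<alpha> else 0)"
  using assms
proof (induction \<alpha> \<beta> rule: list_induct2)
  case Nil
  show ?case by (simp add: mat_trace_def)
next
  case (Cons a \<alpha> b \<beta>)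
  show ?case
    using Cons pauli_string_carrier[of \<alpha>] pauli_string_carrier[of \<beta>]
    by (simp add: mat_trace_kron_mult[where a = 2 and b = "2 ^ length \<beta>"] mat_trace_pauli)
qed

lemma depolarizing_pauli_string:
  assumes "\<beta> \<in> pauli_indices n"
  shows "depolarizing n u (pauli_string \<beta>) =
    complex_of_real (exp (- u * real (pauli_weight \<beta>))) \<cdot>\<^sub>m pauli_string \<beta>"
proof (rule eq_matI)
  let ?c = "complex_of_real (exp (- u * real (pauli_weight \<beta>)))"
  have dims: "dim_row (pauli_string \<alpha>) = 2 ^ n" "dim_col (pauli_string \<alpha>) = 2 ^ n"
    if "\<alpha> \<in> pauli_indices n" for \<alpha>
    using that pauli_string_carrier[of \<alpha>] by (auto simp: pauli_indices_def)
  fix i j assume "i < dim_row (?c \<cdot>\<^sub>m pauli_string \<beta>)" "j < dim_col (?c \<cdot>\<^sub>m pauli_string \<beta>)"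
  then have ij: "i < 2 ^ n" "j < 2 ^ n" using dims[OF assms] by auto
  have entry: "((complex_of_real (exp (- u * real (pauli_weight \<alpha>))) *
        (mat_trace (pauli_string \<alpha> * pauli_string \<beta>) / 2 ^ n)) \<cdot>\<^sub>m pauli_string \<alpha>) $$ (i, j) =
      (if \<alpha> = \<beta> then ?c * pauli_string \<beta> $$ (i, j) else 0)"
    if "\<alpha> \<in> pauli_indices n" for \<alpha>
  proof -
    have "mat_trace (pauli_string \<alpha> * pauli_string \<beta>) = (if \<alpha> = \<beta> then 2 ^ n else 0)"
      using that assms mat_trace_pauli_string[of \<alpha> \<beta>] by (simp add: pauli_indices_def)
    then show ?thesis using ij dims[OF that] by simp
  qed
  have "depolarizing n u (pauli_string \<beta>) $$ (i, j) =
      (\<Sum>\<alpha>\<in>pauli_indices n. if \<alpha> = \<beta> then ?c * pauli_string \<beta> $$ (i, j) else 0)"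
    unfolding depolarizing_def mat_sum_def
    using ij by (simp only: index_mat case_prod_conv) (intro sum.cong refl entry)
  also have "\<dots> = ?c * pauli_string \<beta> $$ (i, j)"
    using assms by simp
  finally show "depolarizing n u (pauli_string \<beta>) $$ (i, j) = (?c \<cdot>\<^sub>m pauli_string \<beta>) $$ (i, j)"
    using ij dims[OF assms] by simp
qed (use assms pauli_string_carrier[of \<beta>] in
    \<open>auto simp: pauli_indices_def depolarizing_def mat_sum_def\<close>)

end

theory Submission
  imports
    Defs
    "HOL-Library.Function_Algebras"
    "HOL-Analysis.L2_Norm"
    "Jordan_Normal_Form.Jordan_Normal_Form_Existence"
    "Jordan_Normal_Form.Jordan_Normal_Form_Uniqueness"
begin

text \<open>
  \<^bold>\<open>Reduction to a multiplier bound.\<close> Multipliers \<open>f\<close> act on the Pauli expansion of \<open>S\<close> by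
  \<open>f S = (\<Sum>\<alpha>. f \<alpha> S\<^sub>\<alpha> \<otimes> P\<^sub>\<alpha>)\<close>. Suppose \<open>exp (- u |\<alpha>|) = q + g\<close> with \<open>q\<close> supported on \<open>|\<alpha>| \<le> k\<close> and
  \<open>g\<close> of norm at most \<open>1/2\<close> as a multiplier. Then \<open>h = q / (1 - g)\<close> is supported on \<open>|\<alpha>| \<le> k\<close>, and
  \<open>1 - h = (1 - exp (- u |\<alpha>|)) / (1 - g)\<close>, so that \<open>R = h S\<close> satisfies the claim.

  \<^bold>\<open>Contractive multipliers.\<close> Since \<open>4 = 2 + 2\<close>, expanding \<open>Tr (X\<^sup>* X X\<^sup>* X)\<close> shows directly that
  damping the non-identity part at one site by a complex factor of modulus at most \<open>1/3\<close> is a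
  contraction. By convexity the same holds for all factors in the convex hull of that disc and \<open>1\<close>,
  and by taking products \<open>w\<^bsup>|\<alpha>|\<^esup>\<close> is a contractive multiplier for such \<open>w\<close>.

  \<^bold>\<open>Truncation.\<close> Let \<open>p\<close> be a real polynomial with \<open>p 0 = 0\<close> that maps the unit circle into this hull.
  The coefficients of \<open>z\<^sup>m\<close> in \<open>(p z)\<^bsup>|\<alpha>|\<^esup>\<close> are averages of contractive multipliers over roots of unity and
  vanish for \<open>|\<alpha>| > m\<close>. Hence \<open>(p r)\<^bsup>|\<alpha>|\<^esup>\<close> is approximated by a multiplier supported on \<open>|\<alpha>| \<le> k\<close> up to
  \<open>(\<Sum>m>k. r\<^sup>m)\<close>. The hull has a corner at \<open>1\<close>, and a superposition of averages at dyadic scales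
  with slowly decaying weights yields polynomials for which \<open>1 - p r\<close> is a power of \<open>1 - r\<close>.
\<close>

section \<open>Quartic forms of trace type\<close>

text \<open>The model is \<open>Q a b c d = Tr (A\<^sup>* B C\<^sup>* D)\<close> with \<open>A, B, C, D\<close> depending linearly on
  \<open>a, b, c, d\<close>.\<close>

locale quartic_form =
  fixes Q :: "('a \<Rightarrow> complex) \<Rightarrow> ('a \<Rightarrow> complex) \<Rightarrow> ('a \<Rightarrow> complex) \<Rightarrow> ('a \<Rightarrow> complex) \<Rightarrow> complex"
  assumes Q_add2: "Q a (b + b') c d = Q a b c d + Q a b' c d"
    and Q_scale2: "Q a ((\<lambda>_. z) * b) c d = z * Q a b c d"
    and Q_rot: "Q a b c d = Q c d a b"
    and Q_cnj: "cnj (Q a b c d) = Q d c b a"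
    and Q_pos1: "0 \<le> Re (Q a b b a)"
    and Q_pos2: "0 \<le> Re (Q a a b b)"
    and Q_cs1: "(cmod (Q a b c d))\<^sup>2 \<le> Re (Q a b b a) * Re (Q c d d c)"
    and Q_cs2: "(cmod (Q a b c d))\<^sup>2 \<le> Re (Q b b c c) * Re (Q d d a a)"
begin

section \<open>Multilinearity in the four slots\<close>

lemma Q_add4: "Q a b c (d + d') = Q a b c d + Q a b c d'"
  by (metis Q_add2 Q_rot)

lemma Q_add1: "Q (a + a') b c d = Q a b c d + Q a' b c d"
  by (metis Q_add4 Q_cnj complex_cnj_add complex_cnj_cnj)

lemma Q_add3: "Q a b (c + c') d = Q a b c d + Q a b c' d"
  by (metis Q_add1 Q_rot)

lemma Q_scale4: "Q a b c ((\<lambda>_. z) * d) = z * Q a b c d"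
  by (metis Q_scale2 Q_rot)

lemma Q_scale1: "Q ((\<lambda>_. z) * a) b c d = cnj z * Q a b c d"
proof -
  have "cnj (Q ((\<lambda>_. z) * a) b c d) = cnj (cnj z * Q a b c d)"
    unfolding Q_cnj Q_scale4 by (simp add: Q_cnj)
  then show ?thesis by (simp only: complex_cnj_cancel_iff)
qed

lemma Q_scale3: "Q a b ((\<lambda>_. z) * c) d = cnj z * Q a b c d"
  by (metis Q_scale1 Q_rot)

lemmas Q_add = Q_add1 Q_add2 Q_add3 Q_add4
lemmas Q_scale = Q_scale1 Q_scale2 Q_scale3 Q_scale4

lemma Q_zero2: "Q a 0 c d = 0"
  using Q_add2[of a 0 0 c d] by simp

lemma Q_zero4: "Q a b c 0 = 0"
  using Q_add4[of a b c 0 0] by simp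

lemma Q_zero1: "Q 0 b c d = 0"
  using Q_add1[of 0 0 b c d] by simp

lemma Q_zero3: "Q a b 0 d = 0"
  using Q_add3[of a b 0 0 d] by simp

lemma Q_sum1: "Q (sum f S) b c d = (\<Sum>s\<in>S. Q (f s) b c d)"
  by (induction S rule: infinite_finite_induct) (simp_all only: sum.infinite sum.empty sum.insert Q_add Q_zero1 not_False_eq_True)

lemma Q_sum2: "Q a (sum f S) c d = (\<Sum>s\<in>S. Q a (f s) c d)"
  by (induction S rule: infinite_finite_induct) (simp_all only: sum.infinite sum.empty sum.insert Q_add Q_zero2 not_False_eq_True)

lemma Q_sum3: "Q a b (sum f S) d = (\<Sum>s\<in>S. Q a b (f s) d)"
  by (induction S rule: infinite_finite_induct) (simp_all only: sum.infinite sum.empty sum.insert Q_add Q_zero3 not_False_eq_True)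

lemma Q_sum4: "Q a b c (sum f S) = (\<Sum>s\<in>S. Q a b c (f s))"
  by (induction S rule: infinite_finite_induct) (simp_all only: sum.infinite sum.empty sum.insert Q_add Q_zero4 not_False_eq_True)

text \<open>In the trace model this is Tr |A|^4, so that \<open>N\<close> is the Schatten 4-norm
  without its normalizing factor.\<close>

definition n4 :: "('a \<Rightarrow> complex) \<Rightarrow> real" where
  "n4 a = Re (Q a a a a)"

definition N :: "('a \<Rightarrow> complex) \<Rightarrow> real" where
  "N a = root 4 (n4 a)"

section \<open>Hoelder and triangle inequalities for the quartic norm\<close>

lemma n4_nonneg: "0 \<le> n4 a"
  by (simp add: n4_def Q_pos1)

lemma N_nonneg: "0 \<le> N a"
  by (simp add: N_def n4_nonneg)

lemma N_pow4: "N a ^ 4 = n4 a"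
  by (simp add: N_def n4_nonneg)

lemma N_mono: "n4 a \<le> n4 b \<Longrightarrow> N a \<le> N b"
  by (simp add: N_def)

text \<open>The second Cauchy-Schwarz inequality pairs neighbours cyclically, which separates the
  palindrome a b b a into b b b b and a a a a.\<close>

lemma Q_middle_le: "Re (Q a b b a) \<le> (N a)\<^sup>2 * (N b)\<^sup>2"
proof (rule power2_le_imp_le)
  have "(Re (Q a b b a))\<^sup>2 \<le> (cmod (Q a b b a))\<^sup>2"
    by (metis abs_Re_le_cmod abs_ge_zero power2_abs power_mono)
  also have "\<dots> \<le> n4 b * n4 a" unfolding n4_def by (rule Q_cs2)
  also have "\<dots> = ((N a)\<^sup>2 * (N b)\<^sup>2)\<^sup>2"
    by (simp add: N_pow4[symmetric] power_mult_distrib mult.commute)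
  finally show "(Re (Q a b b a))\<^sup>2 \<le> ((N a)\<^sup>2 * (N b)\<^sup>2)\<^sup>2" .
qed simp

text \<open>Two rounds of Cauchy-Schwarz take the place of singular values: the first leaves only
  palindromes, which \<open>Q_middle_le\<close> handles.\<close>

lemma Q_hoelder: "cmod (Q a b c d) \<le> N a * N b * N c * N d"
proof (rule power2_le_imp_le)
  have "(cmod (Q a b c d))\<^sup>2 \<le> Re (Q a b b a) * Re (Q c d d c)" by (rule Q_cs1)
  also have "\<dots> \<le> ((N a)\<^sup>2 * (N b)\<^sup>2) * ((N c)\<^sup>2 * (N d)\<^sup>2)"
    by (intro mult_mono Q_middle_le Q_pos1) simp
  also have "\<dots> = (N a * N b * N c * N d)\<^sup>2" by (simp add: power_mult_distrib)
  finally show "(cmod (Q a b c d))\<^sup>2 \<le> (N a * N b * N c * N d)\<^sup>2" .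
qed (simp add: N_nonneg)

lemma N_add: "N (a + b) \<le> N a + N b"
proof (cases "N (a + b) = 0")
  case True
  then show ?thesis by (simp add: N_nonneg)
next
  case False
  let ?s = "a + b"
  have pos: "0 < N ?s" using False N_nonneg[of ?s] by linarith
  \<comment> \<open>Only one of the four slots is expanded. Hoelder bounds both terms by a multiple
    of \<open>N ?s ^ 3\<close>, which cancels because \<open>N ?s\<close> is positive here.\<close>
  have "N ?s * N ?s ^ 3 = Re (Q a ?s ?s ?s) + Re (Q b ?s ?s ?s)"
    using N_pow4[of ?s] by (simp add: n4_def Q_add1[of a b] eval_nat_numeral)
  also have "\<dots> \<le> cmod (Q a ?s ?s ?s) + cmod (Q b ?s ?s ?s)"
    by (intro add_mono complex_Re_le_cmod)
  also have "\<dots> \<le> N a * N ?s * N ?s * N ?s + N b * N ?s * N ?s * N ?s"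
    by (intro add_mono Q_hoelder)
  also have "\<dots> = (N a + N b) * N ?s ^ 3" by (simp add: algebra_simps eval_nat_numeral)
  finally show ?thesis using pos by simp
qed

lemma N_scale: "N ((\<lambda>_. z) * a) = cmod z * N a"
proof -
  have "Q ((\<lambda>_. z) * a) ((\<lambda>_. z) * a) ((\<lambda>_. z) * a) ((\<lambda>_. z) * a) = (cnj z * z) * (cnj z * z) * Q a a a a"
    by (simp add: Q_scale)
  also have "(cnj z * z) * (cnj z * z) = of_real (cmod z ^ 4)"
    by (metis complex_norm_square mult.commute numeral_Bit0 of_real_mult power_add)
  finally have "n4 ((\<lambda>_. z) * a) = cmod z ^ 4 * n4 a"
    unfolding n4_def by (simp only: Re_complex_of_real times_complex.sel Im_complex_of_real mult_zero_left diff_0_right)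
  then show ?thesis by (simp add: N_def real_root_mult real_root_power_cancel)
qed

lemma N_zero: "N 0 = 0"
  by (simp add: N_def n4_def Q_zero1)

subsection \<open>Bounded multipliers\<close>

text \<open>Functions serve both as vectors and as multipliers. With the pointwise product,
  \<open>c\<close> bounds the operator norm of \<open>f\<close>, acting diagonally, with respect to
  \<open>N\<close>.\<close>

definition mult_bound :: "real \<Rightarrow> ('a \<Rightarrow> complex) \<Rightarrow> bool" where
  "mult_bound c f \<longleftrightarrow> (\<forall>g. N (f * g) \<le> c * N g)"

lemma mult_boundD: "mult_bound c f \<Longrightarrow> N (f * g) \<le> c * N g"
  by (simp add: mult_bound_def)

lemma mult_bound_one: "mult_bound 1 1"
  by (simp add: mult_bound_def)

lemma mult_bound_add:
  assumes "mult_bound c f" "mult_bound d g" shows "mult_bound (c + d) (f + g)"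
  unfolding mult_bound_def
proof
  fix h
  have "N ((f + g) * h) \<le> N (f * h) + N (g * h)"
    unfolding distrib_right by (rule N_add)
  also have "\<dots> \<le> c * N h + d * N h"
    using assms by (intro add_mono mult_boundD)
  finally show "N ((f + g) * h) \<le> (c + d) * N h" by (simp add: distrib_right)
qed

lemma mult_bound_scale:
  assumes "mult_bound c f" shows "mult_bound (cmod z * c) ((\<lambda>_. z) * f)"
  unfolding mult_bound_def mult.assoc N_scale
  using assms by (auto intro!: mult_left_mono mult_boundD)

lemma mult_bound_mult:
  assumes "mult_bound c f" "mult_bound d g" "0 \<le> c" shows "mult_bound (c * d) (f * g)"
  unfolding mult_bound_def
proof
  fix h
  have "N (f * (g * h)) \<le> c * N (g * h)" using assms(1) by (rule mult_boundD)
  also have "\<dots> \<le> c * (d * N h)" using assms by (intro mult_left_mono mult_boundD)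
  finally show "N (f * g * h) \<le> c * d * N h" by (simp add: mult.assoc)
qed

lemma mult_bound_prod:
  assumes "\<And>i. i \<in> I \<Longrightarrow> mult_bound 1 (f i)" shows "mult_bound 1 (prod f I)"
  using assms
proof (induction I rule: infinite_finite_induct)
  case (insert i I)
  then have "mult_bound (1 * 1) (f i * prod f I)" by (intro mult_bound_mult) auto
  then show ?case by (simp only: prod.insert[OF insert(1,2)] mult_1_right)
next
  case (infinite I)
  then show ?case by (metis mult_bound_one prod.infinite)
next
  case empty
  then show ?case by (metis mult_bound_one prod.empty)
qed

lemma mult_bound_sum:
  assumes "\<And>i. i \<in> I \<Longrightarrow> mult_bound (c i) (f i)" shows "mult_bound (sum c I) (sum f I)"
  using assms
proof (induction I rule: infinite_finite_induct)
  case (insert i I)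
  then have "mult_bound (c i + sum c I) (f i + sum f I)" by (intro mult_bound_add) auto
  then show ?case by (simp only: sum.insert[OF insert(1,2)])
next
  case (infinite I)
  have "mult_bound 0 0" by (simp add: mult_bound_def N_zero)
  with infinite show ?case by (metis sum.infinite)
next
  case empty
  have "mult_bound 0 0" by (simp add: mult_bound_def N_zero)
  then show ?case by (metis sum.empty)
qed

lemma mult_bound_convex:
  assumes f: "mult_bound 1 f" and g: "mult_bound 1 g" and s: "0 \<le> s" "s \<le> 1"
  shows "mult_bound 1 ((\<lambda>_. of_real (1 - s)) * f + (\<lambda>_. of_real s) * g)"
proof -
  have "cmod (of_real (1 - s)) * 1 + cmod (of_real s) * 1 = 1" using s by (simp flip: of_real_diff)
  then show ?thesis
    using mult_bound_add[OF mult_bound_scale[OF f] mult_bound_scale[OF g]] by metis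
qed

text \<open>The Neumann series, without summing it: \<open>y = (1 - g)\<^sup>-\<^sup>1 v\<close> satisfies \<open>y = v + g y\<close>.\<close>

lemma N_resolvent:
  assumes g: "mult_bound \<epsilon> g" and \<epsilon>: "\<epsilon> \<le> 1/2" and y: "y = v + g * y"
  shows "N y \<le> 2 * N v"
proof -
  have "N y \<le> N v + N (g * y)" by (subst y) (rule N_add)
  also have "N (g * y) \<le> \<epsilon> * N y" using g by (rule mult_boundD)
  also have "\<epsilon> * N y \<le> 1/2 * N y" using \<epsilon> N_nonneg by (intro mult_right_mono)
  finally show ?thesis by simp
qed

end

section \<open>Contractivity of one-site multipliers\<close>

text \<open>In the model the index set \<open>B\<close> labels the four Pauli matrices at a fixed
  site. Conjugation by one of them preserves \<open>Q\<close> and multiplies the coefficient at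
  \<alpha> by a sign. \<open>nz\<close> says that \<alpha> is not the identity at this site, and
  \<open>b0\<close> is the trivial conjugation.\<close>

locale sign_form = quartic_form Q
  for Q :: "('a \<Rightarrow> complex) \<Rightarrow> ('a \<Rightarrow> complex) \<Rightarrow> ('a \<Rightarrow> complex) \<Rightarrow> ('a \<Rightarrow> complex) \<Rightarrow> complex" +
  fixes B :: "'b set" and \<chi> :: "'b \<Rightarrow> 'a \<Rightarrow> complex" and nz :: "'a \<Rightarrow> bool" and b0 :: 'b
  assumes card_B: "card B = 4" and b0: "b0 \<in> B" "\<chi> b0 = 1"
    and \<chi>_sq: "b \<in> B \<Longrightarrow> \<chi> b * \<chi> b = 1"
    and \<chi>_fix: "b \<in> B \<Longrightarrow> \<not> nz \<alpha> \<Longrightarrow> \<chi> b \<alpha> = 1"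
    and \<chi>_sum: "nz \<alpha> \<Longrightarrow> (\<Sum>b\<in>B. \<chi> b \<alpha>) = 0"
    and Q_inv: "b \<in> B \<Longrightarrow> Q (\<chi> b * a1) (\<chi> b * a2) (\<chi> b * a3) (\<chi> b * a4) = Q a1 a2 a3 a4"
begin

lemma finite_B: "finite B"
  using card_B card.infinite by fastforce

text \<open>This support condition and that of \<open>mean_zero\<close> split a function into a part
  fixed by all signs and a part annihilated by averaging over them.\<close>

definition invariant :: "('a \<Rightarrow> complex) \<Rightarrow> bool" where
  "invariant g \<longleftrightarrow> (\<forall>\<alpha>. nz \<alpha> \<longrightarrow> g \<alpha> = 0)"

definition mean_zero :: "('a \<Rightarrow> complex) \<Rightarrow> bool" where
  "mean_zero h \<longleftrightarrow> (\<forall>\<alpha>. \<not> nz \<alpha> \<longrightarrow> h \<alpha> = 0)"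

lemma \<chi>_invariant: "invariant g \<Longrightarrow> b \<in> B \<Longrightarrow> \<chi> b * g = g"
  using \<chi>_fix[of b] by (auto simp: invariant_def fun_eq_iff)

lemma sum_fun_apply: "(\<Sum>b\<in>S. f b) x = (\<Sum>b\<in>S. f b x)" for f :: "'c \<Rightarrow> 'a \<Rightarrow> complex"
  by (induction S rule: infinite_finite_induct) simp_all

lemma \<chi>_mean_zero: "mean_zero h \<Longrightarrow> (\<Sum>b\<in>B. \<chi> b * h) = 0"
  using \<chi>_sum by (auto simp: mean_zero_def fun_eq_iff sum_fun_apply simp flip: sum_distrib_right)

lemma mean_zero_mult: "mean_zero h \<Longrightarrow> mean_zero (f * h)"
  by (simp add: mean_zero_def)

lemma sum_Q1: "mean_zero h \<Longrightarrow> (\<Sum>b\<in>B. Q (\<chi> b * h) x y z) = 0"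
  by (simp add: Q_sum1[symmetric] \<chi>_mean_zero Q_zero1)

lemma sum_Q2: "mean_zero h \<Longrightarrow> (\<Sum>b\<in>B. Q x (\<chi> b * h) y z) = 0"
  by (simp add: Q_sum2[symmetric] \<chi>_mean_zero Q_zero2)

lemma sum_Q3: "mean_zero h \<Longrightarrow> (\<Sum>b\<in>B. Q x y (\<chi> b * h) z) = 0"
  by (simp add: Q_sum3[symmetric] \<chi>_mean_zero Q_zero3)

lemma sum_Q4: "mean_zero h \<Longrightarrow> (\<Sum>b\<in>B. Q x y z (\<chi> b * h)) = 0"
  by (simp add: Q_sum4[symmetric] \<chi>_mean_zero Q_zero4)

lemmas sum_Q = sum_Q1 sum_Q2 sum_Q3 sum_Q4

lemma \<chi>_cancel: "b \<in> B \<Longrightarrow> \<chi> b * (\<chi> b * h) = h"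
  by (simp add: \<chi>_sq flip: mult.assoc)

text \<open>Applying a sign to all four slots changes only the slot of \<open>h\<close>, so the
  value equals its average over the signs, which vanishes.\<close>

lemma single_zero:
  assumes g: "invariant g" and h: "mean_zero h"
  shows "Q h g g g = 0" "Q g h g g = 0" "Q g g h g = 0" "Q g g g h = 0"
proof -
  have eq: "Q h g g g = Q (\<chi> b * h) g g g" "Q g h g g = Q g (\<chi> b * h) g g"
     "Q g g h g = Q g g (\<chi> b * h) g" "Q g g g h = Q g g g (\<chi> b * h)" if "b \<in> B" for b
    using Q_inv[OF that, of h g g g] Q_inv[OF that, of g h g g] Q_inv[OF that, of g g h g]
      Q_inv[OF that, of g g g h] by (simp_all add: \<chi>_invariant[OF g that])
  have c: "(of_nat (card B) :: complex) \<noteq> 0" by (simp add: card_B)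
  have "of_nat (card B) * Q h g g g = (\<Sum>b\<in>B. Q (\<chi> b * h) g g g)"
    by (simp add: eq(1)[symmetric])
  then show "Q h g g g = 0" using c by (simp add: sum_Q h)
  have "of_nat (card B) * Q g h g g = (\<Sum>b\<in>B. Q g (\<chi> b * h) g g)"
    by (simp add: eq(2)[symmetric])
  then show "Q g h g g = 0" using c by (simp add: sum_Q h)
  have "of_nat (card B) * Q g g h g = (\<Sum>b\<in>B. Q g g (\<chi> b * h) g)"
    by (simp add: eq(3)[symmetric])
  then show "Q g g h g = 0" using c by (simp add: sum_Q h)
  have "of_nat (card B) * Q g g g h = (\<Sum>b\<in>B. Q g g g (\<chi> b * h))"
    by (simp add: eq(4)[symmetric])
  then show "Q g g g h = 0" using c by (simp add: sum_Q h)
qed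

lemma n4_sign: "b \<in> B \<Longrightarrow> n4 (\<chi> b * f) = n4 f"
  by (simp add: n4_def Q_inv)

text \<open>In either arrangement the matching Cauchy-Schwarz inequality has the two factors
  \<open>n4 (\<chi> b * f)\<close> and \<open>n4 f\<close>, which agree by invariance.\<close>

lemma Re_Q_le_n4:
  assumes "b \<in> B"
  shows "Re (Q (\<chi> b * f) (\<chi> b * f) f f) \<le> n4 f" "Re (Q (\<chi> b * f) f f (\<chi> b * f)) \<le> n4 f"
proof -
  have "cmod (Q (\<chi> b * f) (\<chi> b * f) f f) \<le> n4 f"
    by (rule power2_le_imp_le[OF _ n4_nonneg], rule order_trans[OF Q_cs1])
      (simp add: n4_def[symmetric] n4_sign assms power2_eq_square)
  then show "Re (Q (\<chi> b * f) (\<chi> b * f) f f) \<le> n4 f"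
    by (rule order_trans[OF complex_Re_le_cmod])
  have "cmod (Q (\<chi> b * f) f f (\<chi> b * f)) \<le> n4 f"
    by (rule power2_le_imp_le[OF _ n4_nonneg], rule order_trans[OF Q_cs2])
      (simp add: n4_def[symmetric] n4_sign assms power2_eq_square)
  then show "Re (Q (\<chi> b * f) f f (\<chi> b * f)) \<le> n4 f"
    by (rule order_trans[OF complex_Re_le_cmod])
qed

text \<open>Cauchy--Schwarz bounds \<open>Q (\<chi> f) (\<chi> f) f f\<close> and \<open>Q (\<chi> f) f f (\<chi> f)\<close> by \<open>n4 f\<close>; averaging over the
  signs \<open>\<chi>\<close> removes every term with an unpaired sign.\<close>

lemma n4_lower:
  assumes g: "invariant g" and h: "mean_zero h"
  shows "n4 g + Re (Q g g h h) + Re (Q g h h g) + n4 h / 4 \<le> n4 (g + h)"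
proof -
  note z = single_zero[OF g h] single_zero[OF g mean_zero_mult[OF h]]
  have sg: "\<chi> b * (g + h) = g + \<chi> b * h" if "b \<in> B" for b
    using \<chi>_invariant[OF g that] by (simp add: distrib_left)
  have real4: "(\<Sum>b\<in>B. c) = 4 * c" for c :: complex by (simp add: card_B)
  \<comment> \<open>A sign applied to all four slots cancels where it is already present and is
    absorbed by \<open>g\<close>. Terms in which two signed slots meet a \<open>g\<close> thus keep
    no sign or a single one, and single signs average to zero.\<close>
  have inv: "Q (\<chi> b * h) (\<chi> b * h) g g = Q g g h h" "Q (\<chi> b * h) (\<chi> b * h) h g = Q h h (\<chi> b * h) g"
      "Q (\<chi> b * h) (\<chi> b * h) g h = Q h h g (\<chi> b * h)"
      "Q (\<chi> b * h) g g (\<chi> b * h) = Q g h h g" "Q (\<chi> b * h) h g (\<chi> b * h) = Q h (\<chi> b * h) g h"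
      "Q (\<chi> b * h) g h (\<chi> b * h) = Q h g (\<chi> b * h) h" if "b \<in> B" for b
    using Q_inv[OF that, of h h g g] Q_rot[of h h g g] Q_inv[OF that, of h h "\<chi> b * h" g]
      Q_inv[OF that, of h h g "\<chi> b * h"] Q_inv[OF that, of h g g h] Q_rot[of h g g h]
      Q_inv[OF that, of h "\<chi> b * h" g h] Q_inv[OF that, of h g "\<chi> b * h" h]
    by (simp_all add: \<chi>_cancel[OF that] \<chi>_invariant[OF g that])
  have e1: "(\<Sum>b\<in>B. Q (\<chi> b * (g + h)) (\<chi> b * (g + h)) (g + h) (g + h)) =
      (\<Sum>b\<in>B. Q g g g g + 2 * Q g g h h + Q (\<chi> b * h) (\<chi> b * h) h h
        + Q h h (\<chi> b * h) g + Q h h g (\<chi> b * h) + Q (\<chi> b * h) g h h + Q g (\<chi> b * h) h h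
        + Q (\<chi> b * h) g h g + Q (\<chi> b * h) g g h + Q g (\<chi> b * h) h g + Q g (\<chi> b * h) g h)"
    by (rule sum.cong[OF refl]) (simp add: sg Q_add inv z)
  also have "\<dots> = 4 * Q g g g g + 8 * Q g g h h + (\<Sum>b\<in>B. Q (\<chi> b * h) (\<chi> b * h) h h)"
    by (simp only: sum.distrib sum_Q[OF h] real4) simp
  finally have "(\<Sum>b\<in>B. Re (Q (\<chi> b * (g + h)) (\<chi> b * (g + h)) (g + h) (g + h))) =
      4 * n4 g + 8 * Re (Q g g h h) + (\<Sum>b\<in>B. Re (Q (\<chi> b * h) (\<chi> b * h) h h))"
    unfolding n4_def Re_sum[symmetric] by simp
  moreover have "(\<Sum>b\<in>B. Re (Q (\<chi> b * (g + h)) (\<chi> b * (g + h)) (g + h) (g + h))) \<le> 4 * n4 (g + h)"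
    using sum_bounded_above[of B, OF Re_Q_le_n4(1)] by (simp add: card_B)
  \<comment> \<open>All summands are nonnegative, and the trivial sign \<open>b0\<close> alone
    contributes \<open>n4 h\<close>.\<close>
  moreover have "n4 h \<le> (\<Sum>b\<in>B. Re (Q (\<chi> b * h) (\<chi> b * h) h h))"
    using member_le_sum[OF b0(1) _ finite_B, of "\<lambda>b. Re (Q (\<chi> b * h) (\<chi> b * h) h h)"]
    by (simp add: b0 n4_def Q_pos2)
  ultimately have l1: "4 * n4 g + 8 * Re (Q g g h h) + n4 h \<le> 4 * n4 (g + h)" by linarith
  have "(\<Sum>b\<in>B. Q (\<chi> b * (g + h)) (g + h) (g + h) (\<chi> b * (g + h))) =
      (\<Sum>b\<in>B. Q g g g g + 2 * Q g h h g + Q (\<chi> b * h) h h (\<chi> b * h)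
        + Q h (\<chi> b * h) g h + Q h g (\<chi> b * h) h + Q (\<chi> b * h) h h g + Q g h h (\<chi> b * h)
        + Q (\<chi> b * h) h g g + Q (\<chi> b * h) g h g + Q g h g (\<chi> b * h) + Q g g h (\<chi> b * h))"
    by (rule sum.cong[OF refl]) (simp add: sg Q_add inv z)
  also have "\<dots> = 4 * Q g g g g + 8 * Q g h h g + (\<Sum>b\<in>B. Q (\<chi> b * h) h h (\<chi> b * h))"
    by (simp only: sum.distrib sum_Q[OF h] real4) simp
  finally have "(\<Sum>b\<in>B. Re (Q (\<chi> b * (g + h)) (g + h) (g + h) (\<chi> b * (g + h)))) =
      4 * n4 g + 8 * Re (Q g h h g) + (\<Sum>b\<in>B. Re (Q (\<chi> b * h) h h (\<chi> b * h)))"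
    unfolding n4_def Re_sum[symmetric] by simp
  moreover have "(\<Sum>b\<in>B. Re (Q (\<chi> b * (g + h)) (g + h) (g + h) (\<chi> b * (g + h)))) \<le> 4 * n4 (g + h)"
    using sum_bounded_above[of B, OF Re_Q_le_n4(2)] by (simp add: card_B)
  moreover have "n4 h \<le> (\<Sum>b\<in>B. Re (Q (\<chi> b * h) h h (\<chi> b * h)))"
    using member_le_sum[OF b0(1) _ finite_B, of "\<lambda>b. Re (Q (\<chi> b * h) h h (\<chi> b * h))"]
    by (simp add: b0 n4_def Q_pos1)
  ultimately have l2: "4 * n4 g + 8 * Re (Q g h h g) + n4 h \<le> 4 * n4 (g + h)" by linarith
  \<comment> \<open>Each of the two arrangements controls one of the two mixed terms; adding both
    bounds and dividing by 8 gives the claim.\<close>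
  from l1 l2 show ?thesis by simp
qed

text \<open>Of the 16 terms those with a single \<open>h\<close> vanish. The mixed terms contribute
  2A + 2B, the crossed ones at most A + B, and those with three \<open>h\<close> at most 2B + 2H,
  where A, B, H abbreviate \<open>?A\<close>, \<open>?B\<close>, \<open>?H\<close>.\<close>

lemma n4_upper:
  assumes g: "invariant g" and h: "mean_zero h"
  shows "n4 (g + h) \<le> n4 g + 3 * Re (Q g g h h) + 5 * Re (Q g h h g) + 3 * n4 h"
proof -
  let ?A = "Re (Q g g h h)" and ?B = "Re (Q g h h g)" and ?H = "n4 h"
  note z = single_zero[OF g h]
  have rot: "Q h h g g = Q g g h h" "Q h g g h = Q g h h g" "Q g h h h = Q h h g h" "Q h g h h = Q h h h g"
    by (rule Q_rot)+
  have crot: "Re (Q h g h g) = Re (Q g h g h)"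
    by (metis Q_cnj cnj.sel(1))
  have "n4 (g + h) = Re (Q g g g g + 2 * Q g g h h + 2 * Q g h h g + Q g h g h
      + Q h g h g + 2 * Q h h g h + 2 * Q h h h g + Q h h h h)"
    unfolding n4_def by (simp add: Q_add z rot)
  then have eq: "n4 (g + h) = n4 g + 2 * ?A + 2 * ?B + 2 * Re (Q g h g h)
      + 2 * Re (Q h h g h) + 2 * Re (Q h h h g) + ?H"
    by (simp add: n4_def crot)
  \<comment> \<open>Both Cauchy-Schwarz pairings apply to the crossed term, so it is at most
    \<open>?B\<close> and also at most \<open>?A\<close>.\<close>
  have "(cmod (Q g h g h))\<^sup>2 \<le> ?B\<^sup>2"
    using Q_cs1[of g h g h] by (simp add: rot power2_eq_square)
  then have "cmod (Q g h g h) \<le> ?B" using Q_pos1 by (rule power2_le_imp_le)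
  moreover have "(cmod (Q g h g h))\<^sup>2 \<le> ?A\<^sup>2"
    using Q_cs2[of g h g h] by (simp add: rot power2_eq_square)
  then have "cmod (Q g h g h) \<le> ?A" using Q_pos2 by (rule power2_le_imp_le)
  ultimately have two: "2 * Re (Q g h g h) \<le> ?A + ?B"
    using complex_Re_le_cmod[of "Q g h g h"] by linarith
  have amgm: "2 * x \<le> ?B + ?H" if "x\<^sup>2 \<le> ?B * ?H" for x
  proof (rule power2_le_imp_le)
    have "4 * (?B * ?H) \<le> (?B + ?H)\<^sup>2"
      using zero_le_power2[of "?B - ?H"] by (simp add: power2_eq_square algebra_simps)
    then show "(2 * x)\<^sup>2 \<le> (?B + ?H)\<^sup>2" using that by (simp add: power_mult_distrib)
  qed (simp add: Q_pos1 n4_nonneg)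
  have "2 * cmod (Q h h g h) \<le> ?B + ?H"
    by (rule amgm) (use Q_cs1[of h h g h] in \<open>simp add: n4_def mult.commute\<close>)
  moreover have "2 * cmod (Q h h h g) \<le> ?B + ?H"
    by (rule amgm) (use Q_cs1[of h h h g] in \<open>simp add: n4_def rot mult.commute\<close>)
  ultimately have "2 * Re (Q h h g h) + 2 * Re (Q h h h g) \<le> 2 * ?B + 2 * ?H"
    using complex_Re_le_cmod[of "Q h h g h"] complex_Re_le_cmod[of "Q h h h g"] by linarith
  then show ?thesis using eq two by linarith
qed

section \<open>From the quartic estimates to contractive one-site multipliers\<close>

definition site :: "complex \<Rightarrow> 'a \<Rightarrow> complex" where
  "site w \<alpha> = (if nz \<alpha> then w else 1)"

text \<open>Damping by \<open>w\<close> scales the mixed terms by |w|^2 and the pure one by |w|^4.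
  The radius 1/3 pushes the coefficients 3, 5, 3 of \<open>n4_upper\<close> below the coefficients
  1, 1, 1/4 of \<open>n4_lower\<close>.\<close>

lemma mult_bound_site_disc:
  assumes "cmod w \<le> 1/3"
  shows "mult_bound 1 (site w)"
  unfolding mult_bound_def
proof
  fix f :: "'a \<Rightarrow> complex"
  define g where "g = (\<lambda>\<alpha>. if nz \<alpha> then 0 else f \<alpha>)"
  define h where "h = (\<lambda>\<alpha>. if nz \<alpha> then f \<alpha> else 0)"
  have g: "invariant g" and h: "mean_zero h"
    by (simp_all add: invariant_def mean_zero_def g_def h_def)
  let ?h = "(\<lambda>_. w) * h" and ?A = "Re (Q g g h h)" and ?B = "Re (Q g h h g)"
  have w2: "(cmod w)\<^sup>2 \<le> 1/9"
    using power_mono[OF assms, of 2] by (simp add: power_divide)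
  have ww: "cnj w * w = of_real ((cmod w)\<^sup>2)" "w * cnj w = of_real ((cmod w)\<^sup>2)"
    by (metis complex_norm_square mult.commute)+
  have A: "Re (Q g g ?h ?h) = (cmod w)\<^sup>2 * ?A"
    by (simp only: Q_scale mult.assoc[symmetric] ww times_complex.sel Re_complex_of_real Im_complex_of_real mult_zero_left diff_0_right)
  have B: "Re (Q g ?h ?h g) = (cmod w)\<^sup>2 * ?B"
    by (simp only: Q_scale mult.assoc[symmetric] ww
        times_complex.sel Re_complex_of_real Im_complex_of_real mult_zero_left diff_0_right)
  have H: "n4 ?h = ((cmod w)\<^sup>2)\<^sup>2 * n4 h"
    by (simp only: N_pow4[symmetric] N_scale power_mult_distrib) simp
  have "n4 (g + ?h) \<le> n4 g + 3 * ((cmod w)\<^sup>2 * ?A) + 5 * ((cmod w)\<^sup>2 * ?B) + 3 * (((cmod w)\<^sup>2)\<^sup>2 * n4 h)"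
    using n4_upper[OF g mean_zero_mult[OF h], of "\<lambda>_. w"] unfolding A B H .
  \<comment> \<open>The coefficients become 3/9, 5/9 and 3/81.\<close>
  also have "\<dots> \<le> n4 g + 3 * (1/9 * ?A) + 5 * (1/9 * ?B) + 3 * ((1/9)\<^sup>2 * n4 h)"
    by (intro add_mono mult_left_mono mult_right_mono power_mono w2 order_refl Q_pos1 Q_pos2 n4_nonneg) auto
  also have "\<dots> \<le> n4 g + ?A + ?B + n4 h / 4"
    using Q_pos1[of g h] Q_pos2[of g h] n4_nonneg[of h] by (simp add: power2_eq_square)
  also have "\<dots> \<le> n4 (g + h)" by (rule n4_lower[OF g h])
  also have "g + h = f" by (auto simp: g_def h_def)
  finally have "n4 (g + ?h) \<le> n4 f" .
  moreover have "g + ?h = site w * f" by (auto simp: g_def h_def site_def)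
  ultimately show "N (site w * f) \<le> 1 * N f" using N_mono by simp
qed

text \<open>A point of the hull is a convex combination of 1, the identity multiplier, and a point
  of the disc; the multiplier depends affinely on it.\<close>

lemma mult_bound_site:
  assumes s: "0 \<le> s" "s \<le> 1" and w: "cmod (w - of_real (1 - s)) \<le> s / 3"
  shows "mult_bound 1 (site w)"
proof (cases "s = 0")
  case True
  then have "site w = 1" using w by (auto simp: site_def)
  then show ?thesis by (simp add: mult_bound_one)
next
  case False
  define w' where "w' = (w - of_real (1 - s)) / of_real s"
  have "cmod w' \<le> 1/3" using w False s by (simp add: w'_def norm_divide field_simps)
  moreover have "site w = (\<lambda>_. of_real (1 - s)) * 1 + (\<lambda>_. of_real s) * site w'"
    using False by (auto simp: site_def w'_def fun_eq_iff)
  ultimately show ?thesis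
    using mult_bound_convex[OF mult_bound_one mult_bound_site_disc s] by simp
qed

end

section \<open>Coefficients as averages over roots of unity\<close>

lemma norm_root_of_unity:
  assumes "z ^ n = 1" "n > 0" shows "cmod z = 1"
proof -
  have "cmod z ^ n = 1 ^ n" using assms(1) by (metis norm_one norm_power power_one)
  then show ?thesis using assms(2) by (metis power_eq_imp_eq_base norm_ge_zero zero_le_one)
qed

text \<open>For l different from m, rotation by a primitive root \<omega> permutes the roots of
  unity but multiplies the sum by a factor other than 1.\<close>

lemma sum_roots_of_unity_orthogonal:
  assumes "l < n" "m < n"
  shows "(\<Sum>z | z ^ n = 1. z ^ l * cnj z ^ m) = (if l = m then of_nat n else (0 :: complex))"
proof -
  let ?Z = "{z :: complex. z ^ n = 1}"
  have n: "n > 0" using assms by simp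
  have norm: "cmod z = 1" if "z \<in> ?Z" for z
    using that n by (simp add: norm_root_of_unity)
  have inv: "z * cnj z = 1" if "z \<in> ?Z" for z
    using norm[OF that] by (simp add: complex_norm_square[symmetric])
  show ?thesis
  proof (cases "l = m")
    case True
    then have "(\<Sum>z\<in>?Z. z ^ l * cnj z ^ m) = (\<Sum>z\<in>?Z. 1)"
      using inv by (intro sum.cong) (auto simp: power_mult_distrib[symmetric])
    then show ?thesis using True card_roots_unity_eq[OF n] by simp
  next
    case False
    define \<omega> where "\<omega> = cis (2 * pi / real n)"
    have pow: "\<omega> ^ j = cis (2 * pi * real j / real n)" for j
      by (simp add: \<omega>_def DeMoivre mult_ac)
    have \<omega>: "\<omega> ^ n = 1" "\<omega> \<noteq> 0" using n by (simp_all add: pow) (simp add: \<omega>_def)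
    have ne: "\<omega> ^ l * cnj \<omega> ^ m \<noteq> 1"
    proof
      assume "\<omega> ^ l * cnj \<omega> ^ m = 1"
      then have "\<omega> ^ l * (cnj \<omega> * \<omega>) ^ m = \<omega> ^ m"
        by (metis mult.assoc mult_1 power_mult_distrib)
      then have "\<omega> ^ l = \<omega> ^ m" using inv[of \<omega>] \<omega> by (simp add: mult.commute)
      then have "l = m"
        using bij_betw_roots_unity[OF n] assms unfolding pow bij_betw_def inj_on_def by blast
      then show False using False by simp
    qed
    have "(\<Sum>z\<in>?Z. z ^ l * cnj z ^ m) = (\<Sum>z\<in>?Z. (\<omega> * z) ^ l * cnj (\<omega> * z) ^ m)"
      by (rule sum.reindex_bij_witness[of _ "\<lambda>z. \<omega> * z" "\<lambda>z. z / \<omega>"])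
        (use \<omega> in \<open>auto simp: power_mult_distrib power_divide\<close>)
    also have "\<dots> = (\<omega> ^ l * cnj \<omega> ^ m) * (\<Sum>z\<in>?Z. z ^ l * cnj z ^ m)"
      by (simp add: sum_distrib_left power_mult_distrib mult_ac)
    finally show ?thesis using ne False by simp
  qed
qed

text \<open>Only the evaluation points are complex. Real coefficients make the final multiplier
  real, and hence \<open>R\<close> Hermitian.\<close>

abbreviation cpoly :: "real poly \<Rightarrow> complex \<Rightarrow> complex" where
  "cpoly p \<equiv> poly (map_poly of_real p)"

lemma cpoly_add: "cpoly (p + q) z = cpoly p z + cpoly q z"
proof -
  have "map_poly of_real (p + q) = map_poly of_real p + (map_poly of_real q :: complex poly)"
    by (intro poly_eqI) (simp add: coeff_map_poly)
  then show ?thesis by simp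
qed

lemma cpoly_smult: "cpoly (smult c p) z = of_real c * cpoly p z"
proof -
  have "map_poly of_real (smult c p) = smult (of_real c) (map_poly of_real p :: complex poly)"
    by (intro poly_eqI) (simp add: coeff_map_poly)
  then show ?thesis by simp
qed

lemma cpoly_mult: "cpoly (p * q) z = cpoly p z * cpoly q z"
proof -
  have "map_poly of_real (p * q) = map_poly of_real p * (map_poly of_real q :: complex poly)"
    by (intro poly_eqI) (simp add: coeff_map_poly coeff_mult)
  then show ?thesis by simp
qed

lemma cpoly_power: "cpoly (p ^ j) z = cpoly p z ^ j"
  by (induction j) (simp_all add: cpoly_mult map_poly_1)

lemma cpoly_sum: "cpoly (sum f I) z = (\<Sum>i\<in>I. cpoly (f i) z)"
  by (induction I rule: infinite_finite_induct) (simp_all add: cpoly_add)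

lemma cpoly_monom: "cpoly (monom c m) z = of_real c * z ^ m"
  by (simp add: map_poly_monom poly_monom)

text \<open>Discrete Fourier inversion; the degree bound excludes aliasing. A finite average, unlike
  a contour integral, stays within finite sums of multipliers.\<close>

lemma coeff_root_average:
  assumes deg: "degree p < n" and m: "m < n"
  shows "(\<Sum>z | z ^ n = 1. (cnj z ^ m / of_nat n) * cpoly p z) = of_real (coeff p m)"
proof -
  have "(\<Sum>z | z ^ n = 1. (cnj z ^ m / of_nat n) * cpoly p z) =
      (\<Sum>z | z ^ n = 1. \<Sum>l\<le>degree p. of_real (coeff p l) / of_nat n * (z ^ l * cnj z ^ m))"
    by (simp add: poly_altdef sum_distrib_left coeff_map_poly degree_map_poly mult_ac)
  also have "\<dots> = (\<Sum>l\<le>degree p. of_real (coeff p l) / of_nat n * (\<Sum>z | z ^ n = 1. z ^ l * cnj z ^ m))"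
    by (subst sum.swap) (simp add: sum_distrib_left)
  also have "\<dots> = (\<Sum>l\<le>degree p. if l = m then of_real (coeff p m) else 0)"
    using deg m by (intro sum.cong) (auto simp: sum_roots_of_unity_orthogonal)
  also have "\<dots> = of_real (coeff p m)"
    by (simp add: coeff_eq_0)
  finally show ?thesis .
qed

text \<open>A polynomial without constant term is divisible by z, so its j-th power is divisible by
  z^j. This turns truncation in the degree into truncation in the weight.\<close>

lemma coeff_power_eq_0:
  fixes p :: "real poly"
  assumes "coeff p 0 = 0" "m < j"
  shows "coeff (p ^ j) m = 0"
proof -
  obtain p' where p': "p = pCons 0 p'" using assms(1) by (cases p) auto
  then have "p = [:0, 1:] * p'" by simp
  then have "p ^ j = monom 1 j * p' ^ j"
    by (simp only: power_mult_distrib monom_altdef smult_1_left)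
  then show ?thesis using assms(2) by (simp add: coeff_monom_mult)
qed

text \<open>Cauchy's estimate on the unit circle, in its discrete form.\<close>

lemma abs_coeff_le_1:
  assumes "\<And>z. cmod z = 1 \<Longrightarrow> cmod (cpoly p z) \<le> 1"
  shows "\<bar>coeff p m\<bar> \<le> 1"
proof -
  define n where "n = Suc (degree p + m)"
  have n: "degree p < n" "m < n" "n > 0" by (auto simp: n_def)
  have norm: "cmod z = 1" if "z ^ n = 1" for z
    using that n by (simp add: norm_root_of_unity)
  have "\<bar>coeff p m\<bar> = cmod (\<Sum>z | z ^ n = 1. (cnj z ^ m / of_nat n) * cpoly p z)"
    unfolding coeff_root_average[OF n(1,2)] by simp
  also have "\<dots> \<le> (\<Sum>z :: complex | z ^ n = 1. 1 / real n)"
    by (rule sum_norm_le) (use assms norm in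
      \<open>auto simp: norm_mult norm_divide norm_power intro!: divide_right_mono\<close>)
  also have "\<dots> = 1" using card_roots_unity_eq[OF n(3)] n by simp
  finally show ?thesis .
qed

text \<open>The convex hull of \<open>1\<close> and the disc of radius \<open>1/3\<close> about \<open>0\<close>: the points
  \<open>(1 - s) + s w\<close> with \<open>|w| \<le> 1/3\<close>.\<close>

definition admissible :: "complex \<Rightarrow> bool" where
  "admissible w \<longleftrightarrow> (\<exists>s. 0 \<le> s \<and> s \<le> 1 \<and> cmod (w - of_real (1 - s)) \<le> s / 3)"

lemma admissible_norm_le_1: "admissible w \<Longrightarrow> cmod w \<le> 1"
proof -
  assume "admissible w"
  then obtain s where s: "0 \<le> s" "s \<le> 1" "cmod (w - of_real (1 - s)) \<le> s / 3"
    by (auto simp: admissible_def)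
  have "cmod w \<le> cmod (w - of_real (1 - s)) + cmod (of_real (1 - s))"
    by (metis norm_triangle_sub add.commute)
  also have "cmod (of_real (1 - s)) = 1 - s" using s by (simp only: norm_of_real abs_of_nonneg diff_ge_0_iff_ge)
  finally show ?thesis using s by linarith
qed

lemma admissible_real: "0 \<le> x \<Longrightarrow> x \<le> 1 \<Longrightarrow> admissible (of_real x)"
  unfolding admissible_def by (intro exI[of _ "1 - x"]) simp

lemma geometric_tail_le:
  fixes r :: real
  assumes "0 \<le> r" "r < 1"
  shows "(\<Sum>m=a..b. r ^ m) \<le> r ^ a / (1 - r)"
proof (cases "a \<le> b")
  case True
  have "(1 - r) * (\<Sum>m=a..b. r ^ m) = r ^ a - r ^ Suc b" by (rule sum_gp_multiplied[OF True])
  also have "\<dots> \<le> r ^ a" using assms by simp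
  finally show ?thesis using assms by (simp add: pos_le_divide_eq mult.commute)
qed (use assms in simp)

section \<open>Multipliers depending on the weight\<close>

locale weight_form = quartic_form Q
  for Q :: "('a \<Rightarrow> complex) \<Rightarrow> ('a \<Rightarrow> complex) \<Rightarrow> ('a \<Rightarrow> complex) \<Rightarrow> ('a \<Rightarrow> complex) \<Rightarrow> complex" +
  fixes n :: nat and B :: "'b set" and \<chi> :: "nat \<Rightarrow> 'b \<Rightarrow> 'a \<Rightarrow> complex"
    and nz :: "nat \<Rightarrow> 'a \<Rightarrow> bool" and b0 :: 'b
  assumes sign_form: "i < n \<Longrightarrow> sign_form Q B (\<chi> i) (nz i) b0"
begin

definition wt :: "'a \<Rightarrow> nat" where
  "wt \<alpha> = card {i. i < n \<and> nz i \<alpha>}"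

lemma wt_le: "wt \<alpha> \<le> n"
proof -
  have "wt \<alpha> \<le> card {..<n}" unfolding wt_def by (intro card_mono) auto
  then show ?thesis by simp
qed

text \<open>The power factors over the sites. Each one-site bound is exactly 1, so nothing is lost
  as \<open>n\<close> grows.\<close>

lemma mult_bound_wt:
  assumes "admissible w"
  shows "mult_bound 1 (\<lambda>\<alpha>. w ^ wt \<alpha>)"
proof -
  obtain s where s: "0 \<le> s" "s \<le> 1" "cmod (w - of_real (1 - s)) \<le> s / 3"
    using assms by (auto simp: admissible_def)
  let ?f = "\<lambda>i \<alpha>. if nz i \<alpha> then w else 1"
  have "mult_bound 1 (?f i)" if "i \<in> {..<n}" for i
  proof -
    interpret sign_form Q B "\<chi> i" "nz i" b0 using sign_form that by simp
    show ?thesis using mult_bound_site[OF s] unfolding site_def .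
  qed
  then have "mult_bound 1 (\<Prod>i<n. ?f i)" by (rule mult_bound_prod)
  moreover have "(\<Prod>i\<in>I. ?f i) \<alpha> = (\<Prod>i\<in>I. ?f i \<alpha>)" for I \<alpha>
    by (induction I rule: infinite_finite_induct) simp_all
  moreover have "(\<Prod>i<n. ?f i \<alpha>) = w ^ wt \<alpha>" for \<alpha>
    by (simp add: prod.If_cases wt_def lessThan_def Int_def conj_commute)
  ultimately show ?thesis by (metis (no_types, lifting) ext)
qed

context
  fixes p :: "real poly"
  assumes p0: "coeff p 0 = 0"
    and adm: "\<And>z. cmod z = 1 \<Longrightarrow> admissible (cpoly p z)"
begin

text \<open>For fixed \<open>m\<close> the coefficient is an average, with weights of total modulus
  1, of the contractive multipliers \<open>cpoly p z ^ wt \<alpha>\<close> over roots of unity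
  z.\<close>

lemma mult_bound_coeff: "mult_bound 1 (\<lambda>\<alpha>. of_real (coeff (p ^ wt \<alpha>) m))"
proof -
  \<comment> \<open>Since weights are at most \<open>n\<close>, this one order of roots of unity
    exceeds the degrees for all \<alpha> simultaneously.\<close>
  define M where "M = Suc (degree p * n + m)"
  have M: "m < M" "M > 0" by (auto simp: M_def)
  have deg: "degree (p ^ wt \<alpha>) < M" for \<alpha>
  proof -
    have "degree (p ^ wt \<alpha>) \<le> degree p * n"
      using degree_power_le[of p "wt \<alpha>"] wt_le[of \<alpha>] by (meson mult_le_mono2 order_trans)
    then show ?thesis by (simp add: M_def)
  qed
  have norm: "cmod z = 1" if "z ^ M = 1" for z
    using that M by (simp add: norm_root_of_unity)
  let ?f = "\<lambda>z. (\<lambda>_. cnj z ^ m / of_nat M) * (\<lambda>\<alpha>. cpoly p z ^ wt \<alpha>)"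
  have "mult_bound (\<Sum>z :: complex | z ^ M = 1. 1 / real M) (\<Sum>z | z ^ M = 1. ?f z)"
  proof (rule mult_bound_sum)
    fix z :: complex assume "z \<in> {z. z ^ M = 1}"
    then have z: "cmod z = 1" using norm by simp
    have "mult_bound (cmod (cnj z ^ m / of_nat M) * 1) (?f z)"
      by (intro mult_bound_scale mult_bound_wt adm z)
    then show "mult_bound (1 / real M) (?f z)" by (simp add: norm_divide norm_power z)
  qed
  moreover have "(\<Sum>z :: complex | z ^ M = 1. 1 / real M) = 1"
    using card_roots_unity_eq[OF M(2)] M by simp
  moreover have "(\<Sum>z | z ^ M = 1. ?f z) = (\<lambda>\<alpha>. of_real (coeff (p ^ wt \<alpha>) m))"
  proof
    fix \<alpha>
    have "(\<Sum>z\<in>Z. ?f z) \<alpha> = (\<Sum>z\<in>Z. ?f z \<alpha>)" for Z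
      by (induction Z rule: infinite_finite_induct) simp_all
    then have "(\<Sum>z | z ^ M = 1. ?f z) \<alpha> = (\<Sum>z | z ^ M = 1. (cnj z ^ m / of_nat M) * cpoly (p ^ wt \<alpha>) z)"
      by (simp add: cpoly_power)
    also have "\<dots> = of_real (coeff (p ^ wt \<alpha>) m)"
      by (rule coeff_root_average[OF deg M(1)])
    finally show "(\<Sum>z | z ^ M = 1. ?f z) \<alpha> = of_real (coeff (p ^ wt \<alpha>) m)" .
  qed
  ultimately show ?thesis by metis
qed

text \<open>The factor 2 comes from inverting \<open>1 - g\<close> with \<open>g\<close> of
  multiplier norm at most 1/2. The extra damping \<sigma> lets a prescribed value be matched exactly
  by \<open>\<sigma> * poly p r\<close>.\<close>

lemma low_weight_approximation:
  assumes r: "0 \<le> r" "r < 1" "r ^ Suc k / (1 - r) \<le> 1/2"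
    and \<sigma>: "0 \<le> \<sigma>" "\<sigma> \<le> 1"
  obtains h :: "'a \<Rightarrow> real" where
    "\<And>\<alpha>. k < wt \<alpha> \<Longrightarrow> h \<alpha> = 0"
    "N (\<lambda>\<alpha>. 1 - of_real (h \<alpha>)) \<le> 2 * N (\<lambda>\<alpha>. 1 - of_real ((\<sigma> * poly p r) ^ wt \<alpha>))"
proof
  define D where "D = degree p * n + k"
  define low where "low \<alpha> = \<sigma> ^ wt \<alpha> * (\<Sum>m\<le>k. r ^ m * coeff (p ^ wt \<alpha>) m)" for \<alpha>
  define g where "g \<alpha> = \<sigma> ^ wt \<alpha> * (\<Sum>m=Suc k..D. r ^ m * coeff (p ^ wt \<alpha>) m)" for \<alpha>
  let ?h = "\<lambda>\<alpha>. low \<alpha> / (1 - g \<alpha>)"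
  have tail: "(\<Sum>m=Suc k..D. r ^ m) \<le> 1/2"
    using geometric_tail_le[OF r(1,2)] r(3) by (rule order_trans)
  have split: "low \<alpha> + g \<alpha> = (\<sigma> * poly p r) ^ wt \<alpha>" for \<alpha>
  proof -
    have "degree (p ^ wt \<alpha>) \<le> degree p * n"
      using degree_power_le[of p "wt \<alpha>"] wt_le[of \<alpha>] by (meson mult_le_mono2 order_trans)
    then have "degree (p ^ wt \<alpha>) \<le> D" by (simp add: D_def)
    then have "poly (p ^ wt \<alpha>) r = (\<Sum>m\<le>D. coeff (p ^ wt \<alpha>) m * r ^ m)"
      unfolding poly_altdef by (intro sum.mono_neutral_left) (auto simp: coeff_eq_0)
    also have "{..D} = {..k} \<union> {Suc k..D}" by (auto simp: D_def)
    also have "(\<Sum>m\<in>{..k} \<union> {Suc k..D}. coeff (p ^ wt \<alpha>) m * r ^ m) =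
        (\<Sum>m\<le>k. coeff (p ^ wt \<alpha>) m * r ^ m) + (\<Sum>m=Suc k..D. coeff (p ^ wt \<alpha>) m * r ^ m)"
      by (rule sum.union_disjoint) auto
    finally show ?thesis
      by (simp add: low_def g_def power_mult_distrib poly_power distrib_left mult.commute)
  qed
  \<comment> \<open>This pointwise bound, from Cauchy's estimate, keeps the denominator of
    \<open>?h\<close> away from zero; the bound as a multiplier is shown separately below.\<close>
  have abs_g: "\<bar>g \<alpha>\<bar> \<le> 1/2" for \<alpha>
  proof -
    have c: "\<bar>coeff (p ^ wt \<alpha>) m\<bar> \<le> 1" for m
      by (rule abs_coeff_le_1) (simp add: cpoly_power norm_power power_le_one admissible_norm_le_1 adm)
    have "\<bar>\<Sum>m=Suc k..D. r ^ m * coeff (p ^ wt \<alpha>) m\<bar> \<le> (\<Sum>m=Suc k..D. r ^ m * 1)"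
      by (rule order_trans[OF sum_abs], rule sum_mono)
        (use c r in \<open>simp add: abs_mult mult_left_le\<close>)
    then have "\<bar>\<Sum>m=Suc k..D. r ^ m * coeff (p ^ wt \<alpha>) m\<bar> \<le> 1/2" using tail by simp
    moreover have "\<bar>\<sigma> ^ wt \<alpha>\<bar> \<le> 1" using \<sigma> by (simp add: power_le_one)
    ultimately have "\<bar>\<sigma> ^ wt \<alpha>\<bar> * \<bar>\<Sum>m=Suc k..D. r ^ m * coeff (p ^ wt \<alpha>) m\<bar> \<le> 1 * (1/2)"
      by (intro mult_mono) auto
    then show ?thesis by (simp add: g_def abs_mult)
  qed
  \<comment> \<open>Every coefficient in \<open>low\<close> has index at most \<open>k\<close>,
    hence below the exponent \<open>wt \<alpha>\<close>.\<close>
  show "?h \<alpha> = 0" if "k < wt \<alpha>" for \<alpha>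
    using that coeff_power_eq_0[OF p0, of _ "wt \<alpha>"] by (simp add: low_def)
  have "mult_bound (\<Sum>m=Suc k..D. r ^ m)
      (\<Sum>m=Suc k..D. (\<lambda>_. of_real (r ^ m)) * (\<lambda>\<alpha>. of_real (coeff (p ^ wt \<alpha>) m)))"
  proof (rule mult_bound_sum)
    fix m
    have "mult_bound (cmod (of_real (r ^ m)) * 1)
        ((\<lambda>_. of_real (r ^ m)) * (\<lambda>\<alpha>. of_real (coeff (p ^ wt \<alpha>) m)))"
      by (intro mult_bound_scale mult_bound_coeff)
    then show "mult_bound (r ^ m) ((\<lambda>_. of_real (r ^ m)) * (\<lambda>\<alpha>. of_real (coeff (p ^ wt \<alpha>) m)))"
      using r by (simp add: norm_power)
  qed
  from mult_bound_mult[OF mult_bound_wt[OF admissible_real[OF \<sigma>]] this]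
  have "mult_bound (\<Sum>m=Suc k..D. r ^ m) ((\<lambda>\<alpha>. of_real \<sigma> ^ wt \<alpha>) *
      (\<Sum>m=Suc k..D. (\<lambda>_. of_real (r ^ m)) * (\<lambda>\<alpha>. of_real (coeff (p ^ wt \<alpha>) m))))"
    by simp
  moreover have "(\<lambda>\<alpha>. of_real \<sigma> ^ wt \<alpha>) *
      (\<Sum>m=Suc k..D. (\<lambda>_. of_real (r ^ m)) * (\<lambda>\<alpha>. of_real (coeff (p ^ wt \<alpha>) m))) =
      (\<lambda>\<alpha>. complex_of_real (g \<alpha>))"
  proof
    fix \<alpha>
    have "(\<Sum>m\<in>S. (\<lambda>_. of_real (r ^ m)) * (\<lambda>\<alpha>. of_real (coeff (p ^ wt \<alpha>) m))) \<alpha> =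
      (\<Sum>m\<in>S. complex_of_real (r ^ m * coeff (p ^ wt \<alpha>) m))" for S
      by (induction S rule: infinite_finite_induct) simp_all
    then show "((\<lambda>\<alpha>. of_real \<sigma> ^ wt \<alpha>) *
      (\<Sum>m=Suc k..D. (\<lambda>_. of_real (r ^ m)) * (\<lambda>\<alpha>. of_real (coeff (p ^ wt \<alpha>) m)))) \<alpha> =
      complex_of_real (g \<alpha>)"
      by (simp add: g_def)
  qed
  ultimately have "mult_bound (\<Sum>m=Suc k..D. r ^ m) (\<lambda>\<alpha>. of_real (g \<alpha>))" by metis
  then show "N (\<lambda>\<alpha>. 1 - of_real (?h \<alpha>)) \<le> 2 * N (\<lambda>\<alpha>. 1 - of_real ((\<sigma> * poly p r) ^ wt \<alpha>))"
  proof (rule N_resolvent[OF _ tail])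
    show "(\<lambda>\<alpha>. 1 - complex_of_real (?h \<alpha>)) = (\<lambda>\<alpha>. 1 - of_real ((\<sigma> * poly p r) ^ wt \<alpha>)) +
        (\<lambda>\<alpha>. of_real (g \<alpha>)) * (\<lambda>\<alpha>. 1 - of_real (?h \<alpha>))"
    proof
      fix \<alpha>
      have "1 - g \<alpha> \<noteq> 0" using abs_g[of \<alpha>] by auto
      then have "1 - ?h \<alpha> = 1 - (\<sigma> * poly p r) ^ wt \<alpha> + g \<alpha> * (1 - ?h \<alpha>)"
        unfolding split[symmetric] by (simp add: field_simps)
      from arg_cong[OF this, of complex_of_real]
      show "1 - complex_of_real (?h \<alpha>) = ((\<lambda>\<alpha>. 1 - of_real ((\<sigma> * poly p r) ^ wt \<alpha>)) +
        (\<lambda>\<alpha>. of_real (g \<alpha>)) * (\<lambda>\<alpha>. 1 - of_real (?h \<alpha>))) \<alpha>"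
        by (simp only: plus_fun_apply times_fun_apply of_real_diff of_real_1 of_real_add of_real_mult)
    qed
  qed
qed

end

end

section \<open>Polynomials mapping the unit circle into the admissible region\<close>

text \<open>The sum starts at exponent 1 so that there is no constant term. On the unit circle the
  value is near 1 while M |1 - z| is small and near 0 once it is large.\<close>

definition avg_poly :: "nat \<Rightarrow> real poly" where
  "avg_poly M = smult (1 / real M) (\<Sum>m=1..M. monom 1 m)"

text \<open>The weights are a geometric distribution cut off at \<open>L\<close>. The missing mass
  \<open>q ^ Suc L\<close> is the defect of the value at 1.\<close>

definition multiscale_poly :: "real \<Rightarrow> nat \<Rightarrow> real poly" where
  "multiscale_poly q L = (\<Sum>l\<le>L. smult ((1 - q) * q ^ l) (avg_poly (2 ^ l)))"

lemma coeff_multiscale_poly_0: "coeff (multiscale_poly q L) 0 = 0"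
  by (simp add: multiscale_poly_def avg_poly_def coeff_sum)

lemma cpoly_avg_poly: "cpoly (avg_poly M) z = (\<Sum>m=1..M. z ^ m) / of_nat M"
  by (simp add: avg_poly_def cpoly_smult cpoly_sum cpoly_monom poly_monom)

lemma poly_avg_poly: "poly (avg_poly M) r = (\<Sum>m=1..M. r ^ m) / real M"
  by (simp add: avg_poly_def poly_sum poly_monom)

text \<open>Each power satisfies |1 - z^m| \<le> m |1 - z| in the unit disc.\<close>

lemma one_minus_avg_poly_le:
  assumes "M > 0" "cmod z \<le> 1"
  shows "cmod (1 - cpoly (avg_poly M) z) \<le> real M * cmod (1 - z)"
proof -
  have "1 - cpoly (avg_poly M) z = (\<Sum>m=1..M. 1 - z ^ m) / of_nat M"
    using assms by (simp add: cpoly_avg_poly sum_subtractf diff_divide_distrib)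
  moreover have "cmod (\<Sum>m=1..M. 1 - z ^ m) \<le> (\<Sum>m=1..M. real M * cmod (1 - z))"
  proof (rule sum_norm_le)
    fix m assume "m \<in> {1..M}"
    then have "real m * cmod (1 - z) \<le> real M * cmod (1 - z)" by (intro mult_right_mono) auto
    moreover have "cmod (1 ^ m - z ^ m) \<le> real m * cmod (1 - z)"
      using assms by (intro norm_power_diff) auto
    ultimately show "cmod (1 - z ^ m) \<le> real M * cmod (1 - z)" by simp
  qed
  ultimately show ?thesis using assms by (simp add: norm_divide pos_divide_le_eq mult_ac)
qed

text \<open>Multiplication by 1 - z telescopes the sum. The product form also covers z = 1.\<close>

lemma avg_poly_le:
  assumes "M > 0" "cmod z \<le> 1"
  shows "cmod (cpoly (avg_poly M) z) * (real M * cmod (1 - z)) \<le> 2"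
proof -
  have "(1 - z) * (\<Sum>m=1..M. z ^ m) = z ^ 1 - z ^ Suc M"
    using assms by (intro sum_gp_multiplied) auto
  then have "cmod ((1 - z) * (\<Sum>m=1..M. z ^ m)) \<le> cmod (z ^ 1) + cmod (z ^ Suc M)"
    by (metis norm_triangle_ineq4)
  also have "\<dots> \<le> 1 + 1"
    using assms unfolding norm_power by (intro add_mono power_le_one) auto
  finally show ?thesis
    using assms by (simp add: cpoly_avg_poly norm_divide norm_mult mult_ac)
qed

text \<open>The value \<open>Suc L\<close> is the default when no scale up to \<open>L\<close>
  reaches the threshold.\<close>

lemma dyadic_threshold:
  fixes x :: real
  obtains j where "j \<le> Suc L" "\<And>l. l < j \<Longrightarrow> 2 ^ l * x < 1" "j \<le> L \<Longrightarrow> 1 \<le> 2 ^ j * x"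
proof (cases "\<exists>l\<le>L. 1 \<le> 2 ^ l * x")
  case True
  let ?j = "LEAST l. 1 \<le> 2 ^ l * x"
  from True obtain l where l: "l \<le> L" "1 \<le> 2 ^ l * x" by blast
  show ?thesis
  proof
    show "?j \<le> Suc L" using Least_le[of "\<lambda>l. 1 \<le> 2 ^ l * x", OF l(2)] l(1) by simp
    show "1 \<le> 2 ^ ?j * x" by (rule LeastI[of _ l]) (rule l)
    show "2 ^ l * x < 1" if "l < ?j" for l
      using not_less_Least[OF that] by simp
  qed
next
  case False
  then have "2 ^ l * x < 1" if "l < Suc L" for l
    using that by (meson less_Suc_eq_le not_le)
  then show ?thesis by (intro that[of "Suc L"]) auto
qed

text \<open>With \<open>j\<close> the first scale at which \<open>2\<^sup>j |1 - z| \<ge> 1\<close>, the averages of the scales below \<open>j\<close> are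
  close to \<open>1\<close> and the others close to \<open>0\<close>, so that the value is close to the total weight
  \<open>1 - q\<^sup>j\<close> of the former, with an error that is a small multiple of \<open>q\<^sup>j\<close>.\<close>

lemma admissible_multiscale_poly:
  assumes z: "cmod z = 1"
  shows "admissible (cpoly (multiscale_poly (19/20) L) z)"
proof -
  define \<delta> where "\<delta> = cmod (1 - z)"
  define q :: real where "q = 19/20"
  define c where "c l = (1 - q) * q ^ l" for l
  define \<kappa> where "\<kappa> l = cpoly (avg_poly (2 ^ l)) z" for l
  obtain j where j: "j \<le> Suc L" "\<And>l. l < j \<Longrightarrow> 2 ^ l * \<delta> < 1" "j \<le> L \<Longrightarrow> 1 \<le> 2 ^ j * \<delta>"
    using dyadic_threshold by metis
  have q: "0 < q" "q < 1" "0 \<le> c l" for l by (simp_all add: q_def c_def)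
  have \<delta>: "0 \<le> \<delta>" by (simp add: \<delta>_def)
  have "(\<Sum>l<j. c l) = (1 - q) * (\<Sum>l<j. q ^ l)" by (simp add: c_def sum_distrib_left)
  also have "\<dots> = 1 - q ^ j" by (rule one_diff_power_eq[symmetric])
  finally have csum: "(\<Sum>l<j. c l) = 1 - q ^ j" .
  have sets: "{..L} = {..<j} \<union> {j..L}" "{..<j} \<inter> {j..L} = {}" using j(1) by auto
  have "cpoly (multiscale_poly q L) z = (\<Sum>l\<le>L. of_real (c l) * \<kappa> l)"
    by (simp add: multiscale_poly_def cpoly_sum cpoly_smult c_def \<kappa>_def)
  also have "\<dots> = (\<Sum>l<j. of_real (c l) * \<kappa> l) + (\<Sum>l=j..L. of_real (c l) * \<kappa> l)"
    unfolding sets(1) by (rule sum.union_disjoint) (use sets(2) in auto)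
  finally have "cpoly (multiscale_poly q L) z - of_real (1 - q ^ j) =
      (\<Sum>l=j..L. of_real (c l) * \<kappa> l) - (\<Sum>l<j. of_real (c l) * (1 - \<kappa> l))"
    unfolding csum[symmetric] of_real_sum by (simp add: right_diff_distrib sum_subtractf)
  then have "cmod (cpoly (multiscale_poly q L) z - of_real (1 - q ^ j)) \<le>
      cmod (\<Sum>l=j..L. of_real (c l) * \<kappa> l) + cmod (\<Sum>l<j. of_real (c l) * (1 - \<kappa> l))"
    by (simp only: norm_triangle_ineq4)
  moreover have "cmod (\<Sum>l<j. of_real (c l) * (1 - \<kappa> l)) \<le> q ^ j / 9"
  proof (cases j)
    case 0
    then show ?thesis using q by simp
  next
    case (Suc i)
    have "cmod (\<Sum>l<j. of_real (c l) * (1 - \<kappa> l)) \<le> (\<Sum>l<j. c l * (2 ^ l * \<delta>))"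
    proof (rule sum_norm_le)
      fix l
      have "cmod (1 - \<kappa> l) \<le> 2 ^ l * \<delta>"
        using one_minus_avg_poly_le[of "2 ^ l" z] z by (simp add: \<kappa>_def \<delta>_def)
      then show "cmod (of_real (c l) * (1 - \<kappa> l)) \<le> c l * (2 ^ l * \<delta>)"
        using q(3)[of l] by (simp add: norm_mult mult_left_mono)
    qed
    also have "\<dots> = (1 - q) * \<delta> * (\<Sum>l<j. (2 * q) ^ l)"
      by (simp add: c_def sum_distrib_left power_mult_distrib mult_ac)
    also have "(\<Sum>l<j. (2 * q) ^ l) = ((2 * q) ^ j - 1) / (2 * q - 1)"
      by (rule geometric_sum) (simp add: q_def)
    also have "(1 - q) * \<delta> * (((2 * q) ^ j - 1) / (2 * q - 1)) \<le> (1 - q) * \<delta> * ((2 * q) ^ j / (2 * q - 1))"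
      using q \<delta> by (intro mult_left_mono divide_right_mono) (auto simp: q_def)
    \<comment> \<open>The geometric sum is dominated by its last scale. Here (1 - q) / (2q - 1) =
      1/18, and \<open>2 ^ j = 2 * 2 ^ i\<close> doubles this to 1/9.\<close>
    also have "\<dots> = (2 ^ i * \<delta>) * (q ^ j / 9)"
      by (simp add: Suc power_mult_distrib) (simp add: q_def field_simps)
    also have "\<dots> \<le> 1 * (q ^ j / 9)"
      using j(2)[of i] Suc q by (intro mult_right_mono) auto
    finally show ?thesis by simp
  qed
  moreover have "cmod (\<Sum>l=j..L. of_real (c l) * \<kappa> l) \<le> q ^ j * (4/21)"
  proof (cases "j \<le> L")
    case False
    then show ?thesis using q by simp
  next
    case True
    then have pos: "1 \<le> 2 ^ j * \<delta>" by (rule j(3))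
    then have \<delta>0: "0 < \<delta>" using \<delta> by (cases "\<delta> = 0") auto
    have "cmod (\<Sum>l=j..L. of_real (c l) * \<kappa> l) \<le> (\<Sum>l=j..L. c l * (2 / (2 ^ l * \<delta>)))"
    proof (rule sum_norm_le)
      fix l
      have "cmod (\<kappa> l) \<le> 2 / (2 ^ l * \<delta>)"
        using avg_poly_le[of "2 ^ l" z] z \<delta>0 by (simp add: \<kappa>_def \<delta>_def pos_le_divide_eq)
      then show "cmod (of_real (c l) * \<kappa> l) \<le> c l * (2 / (2 ^ l * \<delta>))"
        using q(3)[of l] by (simp only: norm_mult norm_of_real abs_of_nonneg mult_left_mono)
    qed
    also have "\<dots> = (1 - q) * (2 / \<delta>) * (\<Sum>l=j..L. (q / 2) ^ l)"
      unfolding sum_distrib_left c_def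
      by (intro sum.cong refl) (use \<delta>0 in \<open>simp add: power_divide field_simps\<close>)
    also have "\<dots> \<le> (1 - q) * (2 / \<delta>) * ((q / 2) ^ j / (1 - q / 2))"
      using q \<delta>0 by (intro mult_left_mono geometric_tail_le) auto
    \<comment> \<open>With q = 19/20 the constant 2 (1 - q) / (1 - q/2) is 4/21.\<close>
    also have "\<dots> = q ^ j * (4/21) * (1 / (2 ^ j * \<delta>))"
      by (simp add: power_divide) (simp add: q_def mult_ac)
    also have "\<dots> \<le> q ^ j * (4/21) * 1"
      using pos q by (intro mult_left_mono) auto
    finally show ?thesis by simp
  qed
  \<comment> \<open>The errors add up to 1/9 + 4/21 = 19/63 < 1/3. Both contain the factor 1 - q,
    which is why \<open>q\<close> is taken close to 1.\<close>
  ultimately have "cmod (cpoly (multiscale_poly q L) z - of_real (1 - q ^ j)) \<le> q ^ j / 3"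
    using zero_le_power[of q j] q by linarith
  then show ?thesis unfolding admissible_def q_def[symmetric]
    using q by (intro exI[of _ "q ^ j"]) (auto simp: power_le_one)
qed

text \<open>The lower bound keeps only the scale l = 0. The defect is the missing mass plus the
  weighted defects of the averages, a geometric sum of ratio 2q dominated by the scale
  \<open>L\<close>.\<close>

lemma multiscale_poly_ge:
  assumes r: "0 \<le> r" "r \<le> 1"
  shows "r / 20 \<le> poly (multiscale_poly (19/20) L) r"
    "1 - poly (multiscale_poly (19/20) L) r \<le> (19/20) ^ Suc L * (1 + 2 ^ L * (1 - r) / 9)"
proof -
  define q :: real where "q = 19/20"
  have q: "0 < q" "q < 1" by (simp_all add: q_def)
  define \<kappa> where "\<kappa> l = poly (avg_poly (2 ^ l)) r" for l
  have eq: "poly (multiscale_poly q L) r = (\<Sum>l\<le>L. (1 - q) * q ^ l * \<kappa> l)"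
    by (simp add: multiscale_poly_def poly_sum \<kappa>_def)
  have \<kappa>0: "0 \<le> \<kappa> l" for l using r by (simp add: \<kappa>_def poly_avg_poly sum_nonneg)
  have "(1 - q) * q ^ 0 * \<kappa> 0 \<le> (\<Sum>l\<le>L. (1 - q) * q ^ l * \<kappa> l)"
    using q \<kappa>0 by (intro member_le_sum[of 0 "{..L}" "\<lambda>l. (1 - q) * q ^ l * \<kappa> l"]) auto
  then show "r / 20 \<le> poly (multiscale_poly (19/20) L) r"
    unfolding eq[unfolded q_def] by (simp add: q_def \<kappa>_def poly_avg_poly)
  have \<kappa>1: "1 - \<kappa> l \<le> 2 ^ l * (1 - r)" for l
  proof -
    have "1 - \<kappa> l \<le> cmod (of_real (1 - \<kappa> l))" by (simp only: norm_of_real abs_ge_self)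
    also have "of_real (1 - \<kappa> l) = 1 - cpoly (avg_poly (2 ^ l)) (of_real r)"
      by (simp add: \<kappa>_def poly_avg_poly cpoly_avg_poly)
    also have "cmod \<dots> \<le> real (2 ^ l) * cmod (1 - of_real r)"
      using r by (intro one_minus_avg_poly_le) auto
    also have "cmod (1 - of_real r) = 1 - r"
      using r by (metis abs_of_nonneg diff_ge_0_iff_ge norm_of_real of_real_1 of_real_diff)
    finally show ?thesis by simp
  qed
  have "(1 - q) * (\<Sum>l<Suc L. q ^ l) = 1 - q ^ Suc L" by (rule one_diff_power_eq[symmetric])
  then have one: "1 = q ^ Suc L + (\<Sum>l\<le>L. (1 - q) * q ^ l)"
    by (simp add: sum_distrib_left lessThan_Suc_atMost)
  have "1 - poly (multiscale_poly q L) r = q ^ Suc L + (\<Sum>l\<le>L. (1 - q) * q ^ l * (1 - \<kappa> l))"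
    unfolding eq by (subst one) (simp add: right_diff_distrib sum_subtractf)
  also have "\<dots> \<le> q ^ Suc L + (\<Sum>l\<le>L. (1 - q) * q ^ l * (2 ^ l * (1 - r)))"
    using q \<kappa>1 by (intro add_left_mono sum_mono mult_left_mono) auto
  also have "(\<Sum>l\<le>L. (1 - q) * q ^ l * (2 ^ l * (1 - r))) = (1 - q) * (1 - r) * (\<Sum>l<Suc L. (2 * q) ^ l)"
    by (simp add: sum_distrib_left power_mult_distrib mult_ac lessThan_Suc_atMost)
  also have "(\<Sum>l<Suc L. (2 * q) ^ l) = ((2 * q) ^ Suc L - 1) / (2 * q - 1)"
    by (rule geometric_sum) (simp add: q_def)
  also have "(1 - q) * (1 - r) * (((2 * q) ^ Suc L - 1) / (2 * q - 1)) \<le>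
      (1 - q) * (1 - r) * ((2 * q) ^ Suc L / (2 * q - 1))"
    using q r by (intro mult_left_mono divide_right_mono) (auto simp: q_def)
  also have "\<dots> = q ^ Suc L * (2 ^ L * (1 - r) / 9)"
    by (simp add: power_mult_distrib) (simp add: q_def)
  finally show "1 - poly (multiscale_poly (19/20) L) r \<le> (19/20) ^ Suc L * (1 + 2 ^ L * (1 - r) / 9)"
    by (simp add: q_def distrib_left)
qed

section \<open>Choice of the radius, the scale and the exponent\<close>

lemma truncation_error:
  fixes y :: real
  assumes y: "y = 1 \<or> 2 \<le> y" and k: "y ^ 3 \<le> real k" "1 \<le> k"
  shows "(1 - 9 / (10 * y)) ^ Suc k / (1 - (1 - 9 / (10 * y))) \<le> 1/2"
proof -
  define a where "a = 9 / (10 * y)"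
  have y1: "1 \<le> y" using y by auto
  have a: "0 < a" "a < 1" using y1 by (auto simp: a_def)
  \<comment> \<open>Bernoulli's inequality for \<open>1 + a\<close> bounds
    \<open>(1 - a) ^ Suc k\<close> by the reciprocal of \<open>1 + real (Suc k) * a\<close>. It
    remains to bound a quadratic expression in \<open>a\<close> from below.\<close>
  have "(1 + real (Suc k) * a) * (1 - a) ^ Suc k \<le> (1 + a) ^ Suc k * (1 - a) ^ Suc k"
    using a by (intro mult_right_mono Bernoulli_inequality) auto
  also have "\<dots> = (1 - a\<^sup>2) ^ Suc k"
    by (simp only: power_mult_distrib[symmetric]) (simp add: algebra_simps power2_eq_square)
  also have "\<dots> \<le> 1" using a by (intro power_le_one) (auto simp: power_le_one)
  finally have b: "(1 + real (Suc k) * a) * (1 - a) ^ Suc k \<le> 1" .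
  have "2 \<le> a * (1 + real (Suc k) * a)"
    using y
  proof
    assume "y = 1"
    moreover have "2 \<le> real (Suc k)" using k by simp
    ultimately show ?thesis by (simp add: a_def)
  next
    assume y2: "2 \<le> y"
    have ya: "y * a = 9/10" using y1 by (simp add: a_def)
    have "y\<^sup>2 * 2 \<le> y * (9/10) + y ^ 3 * (81/100)"
    proof -
      \<comment> \<open>After division by y, the claim is 81 y^2 - 200 y + 90 \<ge> 0, and this
        polynomial equals (y - 2)(81 y - 38) + 14.\<close>
      have "0 \<le> (y - 2) * (81 * y - 38)" using y2 by (intro mult_nonneg_nonneg) auto
      then have "0 \<le> y * ((y - 2) * (81 * y - 38) + 14)" using y1 by (intro mult_nonneg_nonneg) auto
      then show ?thesis by (simp add: power2_eq_square power3_eq_cube algebra_simps)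
    qed
    also have "\<dots> \<le> y * (9/10) + real (Suc k) * (81/100)"
      using k by (intro add_left_mono mult_right_mono) auto
    also have "\<dots> = y\<^sup>2 * (a * (1 + real (Suc k) * a))"
    proof -
      have "y\<^sup>2 * (a * (1 + real (Suc k) * a)) = y * (y * a) + real (Suc k) * (y * a)\<^sup>2"
        by (simp only: power2_eq_square) (simp add: algebra_simps)
      then show ?thesis unfolding ya by (simp add: power2_eq_square)
    qed
    finally show ?thesis using y1 by simp
  qed
  then have "2 * (1 - a) ^ Suc k \<le> a * (1 + real (Suc k) * a) * (1 - a) ^ Suc k"
    using a by (intro mult_right_mono) auto
  also have "\<dots> = a * ((1 + real (Suc k) * a) * (1 - a) ^ Suc k)" by (simp only: mult.assoc)
  also have "\<dots> \<le> a * 1" using a b by (intro mult_left_mono) auto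
  finally have "(1 - a) ^ Suc k / a \<le> 1/2" using a by (simp add: pos_divide_le_eq)
  then show ?thesis by (simp add: a_def)
qed

text \<open>Base 8 = 2^3 makes \<open>y = 2 ^ L\<close> satisfy y^3 \<le> k, as
  \<open>truncation_error\<close> requires.\<close>

lemma exists_scale:
  fixes k :: nat
  assumes "1 \<le> k"
  shows "\<exists>L. 8 ^ L \<le> k \<and> k < 8 ^ Suc L"
proof -
  have "k < 2 ^ k" by (rule less_exp)
  also have "(2::nat) ^ k \<le> 8 ^ k" by (rule power_mono) simp_all
  also have "(8::nat) ^ k \<le> 8 ^ Suc k" by simp
  finally have ex: "\<exists>L. k < 8 ^ Suc L" by blast
  define L where "L = (LEAST L. k < 8 ^ Suc L)"
  have "k < 8 ^ Suc L" unfolding L_def by (rule LeastI_ex[OF ex])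
  moreover have "8 ^ L \<le> k"
  proof (cases L)
    case (Suc i)
    then have "\<not> k < 8 ^ Suc i" unfolding L_def by (intro not_less_Least) simp
    then show ?thesis using Suc by simp
  qed (use assms in simp)
  ultimately show ?thesis by blast
qed

text \<open>The exponent \<gamma> solves 8^(-\<gamma>) = 19/20: when \<open>k\<close> grows by a
  factor 8, \<open>L\<close> grows by one and the bound on the defect of the polynomial shrinks by
  19/20.\<close>

lemma scale_for_degree:
  fixes k :: nat
  defines "\<gamma> \<equiv> ln (20/19) / ln (8::real)"
  assumes "1 \<le> k"
  obtains L and r \<sigma> :: real where
    "0 \<le> r" "r < 1" "r ^ Suc k / (1 - r) \<le> 1/2" "0 \<le> \<sigma>" "\<sigma> \<le> 1"
    "\<sigma> * poly (multiscale_poly (19/20) L) r = exp (- (220 * real k powr (- \<gamma>)))"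
proof -
  obtain L where L: "8 ^ L \<le> k" "k < 8 ^ Suc L" using exists_scale[OF assms(2)] by blast
  define y :: real where "y = 2 ^ L"
  \<comment> \<open>The factor 9/10 keeps \<open>r\<close> at least 1/10 even for y = 1, so that the
    polynomial value is at least 1/200.\<close>
  define r where "r = 1 - 9 / (10 * y)"
  define u where "u = 220 * real k powr (- \<gamma>)"
  define P where "P = poly (multiscale_poly (19/20) L) r"
  have y1: "1 \<le> y" by (simp add: y_def)
  have yy: "y = 1 \<or> 2 \<le> y"
    using power_increasing[of 1 L "2::real"] by (cases L) (auto simp: y_def)
  have "y ^ 3 = (2 ^ 3) ^ L" unfolding y_def by (metis mult.commute power_mult)
  then have "y ^ 3 = real (8 ^ L)" by simp
  then have y3: "y ^ 3 \<le> real k" using L(1) by (simp only: of_nat_le_iff)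
  have r: "1/10 \<le> r" "r < 1" using y1 by (auto simp: r_def field_simps)
  have err: "r ^ Suc k / (1 - r) \<le> 1/2"
    unfolding r_def by (rule truncation_error[OF yy y3 assms(2)])
  have "y * (1 - r) = 9/10" using y1 by (simp add: r_def)
  then have "1 + 2 ^ L * (1 - r) / 9 = 11/10" by (simp add: y_def)
  moreover have "1 - P \<le> (19/20) ^ Suc L * (1 + 2 ^ L * (1 - r) / 9)"
    unfolding P_def using r by (intro multiscale_poly_ge(2)) auto
  ultimately have "1 - P \<le> (19/20) ^ Suc L * (11/10)" by (simp only:)
  moreover have "1/200 \<le> P" using multiscale_poly_ge(1)[of r L] r by (simp add: P_def)
  ultimately have P: "1/200 \<le> P" "1 - P \<le> (19/20) ^ Suc L * (11/10)" by blast+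
  have \<gamma>: "0 < \<gamma>" by (simp add: \<gamma>_def)
  have "(19/20) ^ Suc L = (8 ^ Suc L :: real) powr (- \<gamma>)"
  proof -
    have "ln (8 ^ Suc L :: real) = real (Suc L) * ln 8" by (rule ln_realpow)
    then have "(8 ^ Suc L :: real) powr (- \<gamma>) = exp (- \<gamma> * (real (Suc L) * ln 8))"
      by (simp only: powr_def) simp
    also have "- \<gamma> * (real (Suc L) * ln 8) = real (Suc L) * ln (19/20)"
      by (simp add: \<gamma>_def ln_div) (simp add: algebra_simps)
    also have "exp \<dots> = (19/20) ^ Suc L" by (subst exp_of_nat_mult) simp
    finally show ?thesis by simp
  qed
  also have "\<dots> \<le> real k powr (- \<gamma>)"
  proof -
    have "real k \<le> 8 ^ Suc L" using L(2) by (metis of_nat_le_iff of_nat_numeral of_nat_power order_less_imp_le)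
    then show ?thesis using \<gamma> assms(2) by (intro powr_mono2') auto
  qed
  finally have u: "220 * (19/20) ^ Suc L \<le> u" by (simp add: u_def)
  \<comment> \<open>Here 220 = 200 * 11/10: the defect is at most 11/10 times
    \<open>(19/20) ^ Suc L\<close>, and \<open>P\<close> is at least 1/200, so that 1 - P \<le> u
    P.\<close>
  have "exp (- u) \<le> P"
  proof -
    have u0: "0 \<le> u" by (simp add: u_def)
    have "1 - P \<le> u / 200" using P(2) u by linarith
    also have "\<dots> \<le> u * P" using P(1) u0 by (simp add: mult_left_mono[of "1/200" P u, simplified])
    finally have "1 \<le> (1 + u) * P" by (simp add: algebra_simps)
    also have "\<dots> \<le> exp u * P" using P(1) by (intro mult_right_mono exp_ge_add_one_self) auto
    finally show ?thesis by (simp add: exp_minus field_simps)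
  qed
  \<comment> \<open>This quotient is the witness for \<sigma>; it turns the inequality into an exact
    match.\<close>
  then have "exp (- u) / P \<le> 1" "0 \<le> exp (- u) / P" "exp (- u) / P * P = exp (- u)"
    using P(1) by (auto simp: divide_le_eq)
  then show ?thesis using r err by (intro that[of r "exp (- u) / P" L]) (auto simp: P_def u_def)
qed

section \<open>Square roots of positive semidefinite matrices\<close>

lemma mat_adjoint_dim [simp]:
  "dim_row (mat_adjoint A) = dim_col A" "dim_col (mat_adjoint A) = dim_row A"
  by (simp_all add: mat_adjoint_def)

lemma mat_adjoint_carrier [simp]: "A \<in> carrier_mat a b \<Longrightarrow> mat_adjoint A \<in> carrier_mat b a"
  by (intro carrier_matI) simp_all

lemma mat_adjoint_index [simp]:
  "i < dim_col A \<Longrightarrow> j < dim_row A \<Longrightarrow> mat_adjoint A $$ (i, j) = cnj (A $$ (j, i))"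
  for A :: "complex mat"
  by (simp add: mat_adjoint_def mat_of_rows_def cols_def)

lemma mat_adjoint_adjoint [simp]: "mat_adjoint (mat_adjoint A) = A" for A :: "complex mat"
  by (rule eq_matI) simp_all

lemma mult_mat_index_sum:
  assumes "A \<in> carrier_mat a b" "B \<in> carrier_mat b c" "i < a" "j < c"
  shows "(A * B) $$ (i, j) = (\<Sum>k<b. A $$ (i, k) * B $$ (k, j))"
  using assms by (simp add: scalar_prod_def lessThan_atLeast0)

lemma mat_adjoint_mult:
  fixes A :: "complex mat"
  assumes A: "A \<in> carrier_mat a b" and B: "B \<in> carrier_mat b c"
  shows "mat_adjoint (A * B) = mat_adjoint B * mat_adjoint A"
proof (rule eq_matI)
  fix i j assume "i < dim_row (mat_adjoint B * mat_adjoint A)" "j < dim_col (mat_adjoint B * mat_adjoint A)"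
  then have ij: "i < c" "j < a" using A B by auto
  have "mat_adjoint (A * B) $$ (i, j) = cnj ((A * B) $$ (j, i))"
    using A B ij by (intro mat_adjoint_index) auto
  also have "\<dots> = (\<Sum>k<b. cnj (A $$ (j, k)) * cnj (B $$ (k, i)))"
    using mult_mat_index_sum[OF A B ij(2,1)] by simp
  also have "\<dots> = (mat_adjoint B * mat_adjoint A) $$ (i, j)"
    using mult_mat_index_sum[OF mat_adjoint_carrier[OF B] mat_adjoint_carrier[OF A] ij] A B ij
    by (simp add: mult.commute)
  finally show "mat_adjoint (A * B) $$ (i, j) = (mat_adjoint B * mat_adjoint A) $$ (i, j)" .
qed (use A B in auto)

lemma cscalar_prod_adjoint:
  fixes A :: "complex mat"
  assumes A: "A \<in> carrier_mat a b" and v: "v \<in> carrier_vec b" and w: "w \<in> carrier_vec a"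
  shows "(A *\<^sub>v v) \<bullet>c w = v \<bullet>c (mat_adjoint A *\<^sub>v w)"
proof -
  have "(A *\<^sub>v v) \<bullet>c w = (\<Sum>i<a. \<Sum>j<b. A $$ (i, j) * v $ j * cnj (w $ i))"
    using assms by (simp add: scalar_prod_def lessThan_atLeast0 sum_distrib_right)
  also have "\<dots> = (\<Sum>j<b. \<Sum>i<a. v $ j * (A $$ (i, j) * cnj (w $ i)))"
    by (subst sum.swap) (simp add: mult_ac)
  also have "\<dots> = v \<bullet>c (mat_adjoint A *\<^sub>v w)"
    using assms by (simp add: scalar_prod_def lessThan_atLeast0 sum_distrib_left)
  finally show ?thesis .
qed

lemma hermitian_eigenvector_real:
  fixes A :: "complex mat"
  assumes A: "A \<in> carrier_mat n n" "mat_adjoint A = A"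
    and w: "w \<in> carrier_vec n" "A *\<^sub>v w = e \<cdot>\<^sub>v w" "w \<noteq> 0\<^sub>v n"
  shows "cnj e = e"
proof -
  have "e * (w \<bullet>c w) = (A *\<^sub>v w) \<bullet>c w" using w by simp
  also have "\<dots> = w \<bullet>c (A *\<^sub>v w)" using cscalar_prod_adjoint[OF A(1) w(1) w(1)] A(2) by simp
  also have "\<dots> = cnj e * (w \<bullet>c w)" using w by (simp add: conjugate_smult_vec)
  finally show ?thesis using conjugate_square_eq_0_vec[OF w(1)] w(3) by simp
qed

text \<open>If w = (A - e) v is killed by A - e, then moving A - e across the inner product gives
  that w is orthogonal to itself.\<close>

lemma hermitian_kernel_char_matrix:
  fixes A :: "complex mat"
  assumes A: "A \<in> carrier_mat n n" "mat_adjoint A = A"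
  shows "mat_kernel (char_matrix A e ^\<^sub>m 2) = mat_kernel (char_matrix A e ^\<^sub>m 1)"
proof -
  let ?C = "char_matrix A e"
  have C: "?C \<in> carrier_mat n n" using A by simp
  have C1: "?C ^\<^sub>m 1 = ?C" using C by simp
  have C2: "?C ^\<^sub>m 2 = ?C * ?C" using C by (simp add: numeral_2_eq_2)
  have dim: "dim_row A = n" "dim_col A = n" using A by auto
  have Cv: "?C *\<^sub>v v = A *\<^sub>v v + (- e) \<cdot>\<^sub>v v" if "v \<in> carrier_vec n" for v
    unfolding char_matrix_def
    by (rule eq_vecI) (use that A dim in \<open>auto simp: add_scalar_prod_distrib[of _ n]\<close>)
  show ?thesis
  proof (intro equalityI subsetI)
    fix v assume "v \<in> mat_kernel (?C ^\<^sub>m 2)"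
    then have v: "v \<in> carrier_vec n" "(?C * ?C) *\<^sub>v v = 0\<^sub>v n"
      using mat_kernelD[of "?C * ?C" n n] C unfolding C2 by auto
    define w where "w = ?C *\<^sub>v v"
    have w: "w \<in> carrier_vec n" using C v by (simp add: w_def)
    have "?C *\<^sub>v w = 0\<^sub>v n" using v C by (simp add: w_def)
    then have Aw: "w \<noteq> 0\<^sub>v n \<Longrightarrow> A *\<^sub>v w = e \<cdot>\<^sub>v w"
      using eigenvector_char_matrix[OF A(1), of w e] w by (simp add: eigenvector_def)
    have "w = 0\<^sub>v n"
    \<comment> \<open>A nonzero \<open>w\<close> is an eigenvector, and this is what makes
      \<open>e\<close> real.\<close>
    proof (rule ccontr)
      assume nz: "w \<noteq> 0\<^sub>v n"
      have "cnj e = e" by (rule hermitian_eigenvector_real[OF A w Aw[OF nz] nz])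
      have "w \<bullet>c w = (A *\<^sub>v v) \<bullet>c w - e * (v \<bullet>c w)"
        using A v w Cv[OF v(1)] add_scalar_prod_distrib[of "A *\<^sub>v v" n "(- e) \<cdot>\<^sub>v v" "conjugate w"]
        by (simp add: w_def[symmetric])
      also have "(A *\<^sub>v v) \<bullet>c w = v \<bullet>c (e \<cdot>\<^sub>v w)"
        using cscalar_prod_adjoint[OF A(1) v(1) w] A(2) Aw[OF nz] by simp
      also have "\<dots> = e * (v \<bullet>c w)" using v w \<open>cnj e = e\<close> by (simp add: conjugate_smult_vec)
      finally show False using conjugate_square_eq_0_vec[OF w] nz by simp
    qed
    then show "v \<in> mat_kernel (?C ^\<^sub>m 1)"
      unfolding C1 using v C by (intro mat_kernelI[of _ n n]) (auto simp: w_def)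
  next
    fix v assume "v \<in> mat_kernel (?C ^\<^sub>m 1)"
    then have v: "v \<in> carrier_vec n" "?C *\<^sub>v v = 0\<^sub>v n"
      using mat_kernelD[of ?C n n] C unfolding C1 by auto
    moreover have "?C *\<^sub>v 0\<^sub>v n = 0\<^sub>v n" by (rule eq_vecI) (use C in auto)
    ultimately have "(?C * ?C) *\<^sub>v v = 0\<^sub>v n" using C by simp
    then show "v \<in> mat_kernel (?C ^\<^sub>m 2)"
      unfolding C2 using v C by (intro mat_kernelI[of _ n n]) auto
  qed
qed

text \<open>Passes from equal dimensions of two generalized eigenspaces to equal contributions of
  each Jordan block.\<close>

lemma sum_list_eq_imp_eq:
  fixes f g :: "'a \<Rightarrow> nat"
  assumes "sum_list (map f xs) = sum_list (map g xs)" "\<And>x. g x \<le> f x" "x \<in> set xs"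
  shows "f x = g x"
  using assms(1,3)
proof (induction xs)
  case (Cons y ys)
  have "sum_list (map g ys) \<le> sum_list (map f ys)" by (rule sum_list_mono) (rule assms(2))
  with Cons.prems(1) assms(2)[of y] have "f y = g y" "sum_list (map f ys) = sum_list (map g ys)" by auto
  then show ?case using Cons by auto
qed simp

lemma diagonal_jordan_matrix:
  assumes "\<And>m a. (m, a) \<in> set n_as \<Longrightarrow> m \<le> 1"
  shows "diagonal_mat (jordan_matrix n_as)"
  using assms
proof (induction n_as)
  case Nil
  then show ?case by (simp add: diagonal_mat_def)
next
  case (Cons na n_as)
  obtain m a where na: "na = (m, a)" by (cases na)
  have m: "m \<le> 1" and IH: "diagonal_mat (jordan_matrix n_as)"
    using Cons na by (auto intro: Cons.IH)
  then show ?case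
    unfolding na jordan_matrix_Cons diagonal_mat_def by (auto simp: less_Suc_eq)
qed

text \<open>Jordan blocks have size at most \<open>1\<close>, since \<open>A - e\<close> and its square have the same kernel.\<close>

lemma hermitian_diagonalizable:
  fixes A :: "complex mat"
  assumes A: "A \<in> carrier_mat n n" "mat_adjoint A = A"
  obtains D P Q where "similar_mat_wit A D P Q" "diagonal_mat D"
proof -
  obtain as where "char_poly A = (\<Prod>a\<leftarrow>as. [:- a, 1:])"
    using char_poly_factorized[OF A(1)] by blast
  from jordan_nf_exists[OF A(1) this] obtain n_as where jnf: "jordan_nf A n_as" by blast
  have "m \<le> 1" if mem: "(m, e) \<in> set n_as" for m e
  proof -
    have C: "char_matrix A e \<in> carrier_mat n n" using A by simp
    \<comment> \<open>A block of size m for \<open>e\<close> contributes \<open>min k m\<close> to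
      the kernel dimension of the k-th power, and \<open>min 2 m = min 1 m\<close> forces m \<le>
      1.\<close>
    have "dim_gen_eigenspace A e 2 = dim_gen_eigenspace A e 1"
      unfolding dim_gen_eigenspace_def kernel_dim_def
      using hermitian_kernel_char_matrix[OF A, of e] C by (simp only: pow_mat_dim_square[OF C])
    then have "sum_list (map (min 2) (map fst [(n, e')\<leftarrow>n_as. e' = e])) =
        sum_list (map (min 1) (map fst [(n, e')\<leftarrow>n_as. e' = e]))"
      unfolding dim_gen_eigenspace[OF jnf] .
    then have "min 2 m = min 1 m"
      by (rule sum_list_eq_imp_eq) (use mem in force)+
    then show ?thesis by simp
  qed
  then have "diagonal_mat (jordan_matrix n_as)" by (rule diagonal_jordan_matrix)
  moreover obtain P Q where "similar_mat_wit A (jordan_matrix n_as) P Q"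
    using jnf unfolding jordan_nf_def similar_mat_def by blast
  ultimately show ?thesis using that by blast
qed

lemma mult_conj_similar:
  fixes P :: "complex mat"
  assumes "P \<in> carrier_mat n n" "Q \<in> carrier_mat n n" "F \<in> carrier_mat n n" "G \<in> carrier_mat n n" "Q * P = 1\<^sub>m n"
  shows "(P * F * Q) * (P * G * Q) = P * (F * G) * Q"
proof -
  have "(P * F * Q) * (P * G * Q) = P * F * (Q * P) * G * Q"
    using assms(1-4) by (simp add: assoc_mult_mat[of _ n n _ n _ n])
  also have "\<dots> = P * (F * G) * Q"
    using assms by (simp add: assoc_mult_mat[of _ n n _ n _ n])
  finally show ?thesis .
qed

lemma psd_mat_adjoint_mult_self:
  fixes X :: "complex mat"
  assumes X: "X \<in> carrier_mat m n"
  shows "psd_mat (mat_adjoint X * X)"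
proof -
  have XX: "mat_adjoint X * X \<in> carrier_mat n n" using X by (auto intro: mult_carrier_mat)
  have "mat_adjoint (mat_adjoint X * X) = mat_adjoint X * X"
    using mat_adjoint_mult[OF mat_adjoint_carrier[OF X] X] by simp
  moreover have "0 \<le> Re (((mat_adjoint X * X) *\<^sub>v v) \<bullet>c v)" if v: "v \<in> carrier_vec n" for v
  proof -
    have Xv: "X *\<^sub>v v \<in> carrier_vec m" using X v by simp
    have "((mat_adjoint X * X) *\<^sub>v v) \<bullet>c v = (mat_adjoint X *\<^sub>v (X *\<^sub>v v)) \<bullet>c v"
      using assoc_mult_mat_vec[OF mat_adjoint_carrier[OF X] X v] by simp
    also have "\<dots> = (X *\<^sub>v v) \<bullet>c (X *\<^sub>v v)"
      using cscalar_prod_adjoint[OF mat_adjoint_carrier[OF X] Xv v] by simp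
    finally show ?thesis using conjugate_square_ge_0_vec[of "X *\<^sub>v v"] by (simp add: less_eq_complex_def)
  qed
  ultimately show ?thesis using XX by (auto simp: psd_mat_def hermitian_mat_def)
qed

text \<open>The diagonalizing \<open>P\<close> comes from the Jordan form and is merely invertible.
  A fourth root \<open>C\<close> is formed instead of a square root: once \<open>C\<close> is shown
  Hermitian, \<open>C * C\<close> is positive semidefinite as the product of the adjoint of
  \<open>C\<close> with \<open>C\<close>.\<close>

lemma psd_sqrt_exists:
  assumes psd: "psd_mat A" and A: "A \<in> carrier_mat n n"
  shows "\<exists>B. psd_mat B \<and> B \<in> carrier_mat n n \<and> B * B = A"
proof -
  have A': "mat_adjoint A = A" using psd by (simp add: psd_mat_def hermitian_mat_def)
  obtain D P Q where w: "similar_mat_wit A D P Q" and D: "diagonal_mat D"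
    using hermitian_diagonalizable[OF A A'] .
  from similar_mat_witD2[OF A w]
  have PQ: "P * Q = 1\<^sub>m n" and QP: "Q * P = 1\<^sub>m n" and APDQ: "A = P * D * Q"
    and Dc: "D \<in> carrier_mat n n" and P: "P \<in> carrier_mat n n" and Q: "Q \<in> carrier_mat n n" by auto
  note asc = assoc_mult_mat[of _ n n _ n _ n]
  have Pa: "mat_adjoint P \<in> carrier_mat n n" and Qa: "mat_adjoint Q \<in> carrier_mat n n" using P Q by simp_all
  \<comment> \<open>The Gram matrix of the columns of \<open>P\<close> measures how far
    \<open>P\<close> is from unitary.\<close>
  define M where "M = mat_adjoint P * P"
  have M: "M \<in> carrier_mat n n" unfolding M_def by (rule mult_carrier_mat[OF Pa P])
  have AP: "A * P = P * D"
    unfolding APDQ using P Q Dc QP by (simp add: asc)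
  have "M * D = mat_adjoint P * (A * P)" using P Pa Dc by (simp add: M_def AP asc)
  also have "\<dots> = mat_adjoint (A * P) * P"
    using P Pa A A' by (simp add: mat_adjoint_mult[OF A P] asc)
  also have "\<dots> = mat_adjoint D * M"
    using P Pa Dc by (simp add: AP mat_adjoint_mult[OF P Dc] M_def asc)
  finally have MD: "M * D = mat_adjoint D * M" .
  have diag_r: "(X * E) $$ (i, j) = X $$ (i, j) * E $$ (j, j)"
    if "X \<in> carrier_mat n n" "E \<in> carrier_mat n n" "diagonal_mat E" "i < n" "j < n" for X E :: "complex mat" and i j
  proof -
    have "(X * E) $$ (i, j) = (\<Sum>k<n. if k = j then X $$ (i, j) * E $$ (j, j) else 0)"
      unfolding mult_mat_index_sum[OF that(1,2,4,5)]
      by (rule sum.cong) (use that in \<open>auto simp: diagonal_mat_def\<close>)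
    then show ?thesis using that by simp
  qed
  have diag_l: "(E * X) $$ (i, j) = E $$ (i, i) * X $$ (i, j)"
    if "X \<in> carrier_mat n n" "E \<in> carrier_mat n n" "diagonal_mat E" "i < n" "j < n" for X E :: "complex mat" and i j
  proof -
    have "(E * X) $$ (i, j) = (\<Sum>k<n. if k = i then E $$ (i, i) * X $$ (i, j) else 0)"
      unfolding mult_mat_index_sum[OF that(2,1,4,5)]
      by (rule sum.cong) (use that in \<open>auto simp: diagonal_mat_def\<close>)
    then show ?thesis using that by simp
  qed
  define ev where "ev i = D $$ (i, i)" for i
  have Da: "diagonal_mat (mat_adjoint D)" using D Dc by (auto simp: diagonal_mat_def)
  have Mev: "M $$ (i, j) * ev j = cnj (ev i) * M $$ (i, j)" if "i < n" "j < n" for i j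
    using arg_cong[OF MD, of "\<lambda>X. X $$ (i, j)"] diag_r[OF M Dc D that] diag_l[OF M _ Da that] Dc that
    by (simp add: ev_def)
  \<comment> \<open>Column i of \<open>P\<close> is an eigenvector for \<open>ev i\<close>, nonzero
    because \<open>Q * P\<close> is the identity.\<close>
  have ev: "cnj (ev i) = ev i \<and> 0 \<le> Re (ev i)" if i: "i < n" for i
  proof -
    define v where "v = col P i"
    have v: "v \<in> carrier_vec n" using P i by (simp add: v_def)
    have "v \<noteq> 0\<^sub>v n"
    proof
      assume v0: "v = 0\<^sub>v n"
      have "(Q * P) $$ (i, i) = row Q i \<bullet> v" using P Q i by (simp add: v_def)
      also have "\<dots> = 0" using Q i by (simp add: v0)
      finally show False using QP i by simp
    qed
    then have vv: "v \<bullet>c v > 0" using conjugate_square_greater_0_vec[OF v] by simp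
    have "A *\<^sub>v v = col (A * P) i" by (rule eq_vecI) (use A P i in \<open>auto simp: v_def\<close>)
    also have "\<dots> = ev i \<cdot>\<^sub>v v"
    proof (rule eq_vecI)
      fix k assume "k < dim_vec (ev i \<cdot>\<^sub>v v)"
      then have k: "k < n" using v by simp
      show "col (A * P) i $ k = (ev i \<cdot>\<^sub>v v) $ k"
        using diag_r[OF P Dc D k i] P Dc i k by (simp add: AP v_def ev_def)
    qed (use A P v in simp)
    finally have Av: "A *\<^sub>v v = ev i \<cdot>\<^sub>v v" .
    have "cnj (ev i) = ev i" by (rule hermitian_eigenvector_real[OF A A' v Av \<open>v \<noteq> 0\<^sub>v n\<close>])
    moreover have "0 \<le> Re ((A *\<^sub>v v) \<bullet>c v)" using psd v A by (auto simp: psd_mat_def)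
    then have "0 \<le> Re (ev i * (v \<bullet>c v))" using v by (simp add: Av)
    then have "0 \<le> Re (ev i)" using vv by (simp add: less_complex_def zero_le_mult_iff)
    ultimately show ?thesis by simp
  qed
  define F where "F = mat n n (\<lambda>(i, j). if i = j then complex_of_real (root 4 (Re (ev i))) else 0)"
  have F: "F \<in> carrier_mat n n" "diagonal_mat F" by (auto simp: F_def diagonal_mat_def)
  have Fi: "F $$ (i, i) = complex_of_real (root 4 (Re (ev i)))" if "i < n" for i using that by (simp add: F_def)
  have Fa: "mat_adjoint F = F" by (rule eq_matI) (auto simp: F_def)
  \<comment> \<open>An entry of \<open>M\<close> can be nonzero only where the two eigenvalues
    agree, and then their fourth roots agree too.\<close>
  have MF: "M * F = F * M"
  proof (rule eq_matI)
    fix i j assume "i < dim_row (F * M)" "j < dim_col (F * M)"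
    then have ij: "i < n" "j < n" using F M by auto
    show "(M * F) $$ (i, j) = (F * M) $$ (i, j)"
      using Mev[OF ij] ev[OF ij(1)] diag_r[OF M F ij] diag_l[OF M F ij] Fi[OF ij(1)] Fi[OF ij(2)]
      by (cases "M $$ (i, j) = 0") (auto simp: mult.commute)
  qed (use F M in auto)
  define C where "C = P * F * Q"
  have C: "C \<in> carrier_mat n n" using P F Q by (simp add: C_def)
  have QaPa: "mat_adjoint Q * mat_adjoint P = 1\<^sub>m n"
  proof -
    have "mat_adjoint (1\<^sub>m n) = (1\<^sub>m n :: complex mat)" by (rule eq_matI) auto
    then show ?thesis using mat_adjoint_mult[OF P Q] PQ by simp
  qed
  \<comment> \<open>With the adjoint of \<open>P\<close> written as \<open>M * Q\<close>, commuting
    \<open>F\<close> past \<open>M\<close> turns the adjoint of \<open>C\<close> back into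
    \<open>C\<close>.\<close>
  have "mat_adjoint C = mat_adjoint Q * (F * mat_adjoint P)"
    unfolding C_def using mat_adjoint_mult[OF _ Q, of "P * F" n] mat_adjoint_mult[OF P F(1)] P F(1) Fa by simp
  also have "mat_adjoint P = M * Q"
    using P Q Pa PQ by (simp add: M_def asc)
  also have "mat_adjoint Q * (F * (M * Q)) = mat_adjoint Q * (F * M) * Q"
    using Q Qa M F(1) mult_carrier_mat[OF F(1) M] by (simp add: asc)
  also have "\<dots> = mat_adjoint Q * (M * F) * Q" by (simp only: MF)
  also have "\<dots> = mat_adjoint Q * (M * F * Q)"
    using Q Qa mult_carrier_mat[OF M F(1)] by (simp add: asc)
  also have "M * F * Q = mat_adjoint P * (P * F * Q)"
    using P Q Pa F(1) by (simp add: M_def asc)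
  also have "mat_adjoint Q * (mat_adjoint P * (P * F * Q)) = (mat_adjoint Q * mat_adjoint P) * (P * F * Q)"
    using Pa Qa C by (simp add: C_def asc)
  also have "\<dots> = C" using C by (simp add: QaPa C_def[symmetric])
  finally have Ca: "mat_adjoint C = C" .
  have "C * C * (C * C) = A"
  proof -
    have FF: "F * F \<in> carrier_mat n n" using F by simp
    have "C * C = P * (F * F) * Q" unfolding C_def by (rule mult_conj_similar[OF P Q F(1) F(1) QP])
    then have "C * C * (C * C) = P * ((F * F) * (F * F)) * Q"
      by (simp only: mult_conj_similar[OF P Q FF FF QP])
    also have "(F * F) * (F * F) = D"
    proof (rule eq_matI)
      fix i j assume "i < dim_row D" "j < dim_col D"
      then have ij: "i < n" "j < n" using Dc by auto
      have "((F * F) * (F * F)) $$ (i, j) = (F * F * F) $$ (i, j) * F $$ (j, j)"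
        using diag_r[OF _ F ij, of "F * F * F"] F(1) by (simp add: asc)
      also have "\<dots> = F $$ (i, j) * F $$ (j, j) * F $$ (j, j) * F $$ (j, j)"
        using diag_r[OF FF F ij] diag_r[OF F(1) F ij] by simp
      also have "\<dots> = D $$ (i, j)"
      proof (cases "i = j")
        case True
        have "root 4 (Re (ev j)) * root 4 (Re (ev j)) * root 4 (Re (ev j)) * root 4 (Re (ev j)) = root 4 (Re (ev j)) ^ 4"
          by (simp add: eval_nat_numeral)
        also have "\<dots> = Re (ev j)" using ev[OF ij(2)] by simp
        finally have "F $$ (j, j) * F $$ (j, j) * F $$ (j, j) * F $$ (j, j) = of_real (Re (ev j))"
          unfolding Fi[OF ij(2)] by (simp flip: of_real_mult)
        also have "\<dots> = D $$ (j, j)" using ev[OF ij(2)] by (simp add: ev_def complex_eq_iff)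
        finally show ?thesis using True by simp
      next
        case False
        then show ?thesis using F D Dc ij by (auto simp: diagonal_mat_def)
      qed
      finally show "((F * F) * (F * F)) $$ (i, j) = D $$ (i, j)" .
    qed (use F Dc in auto)
    finally show ?thesis using APDQ by simp
  qed
  moreover have "psd_mat (C * C)" using psd_mat_adjoint_mult_self[OF C] by (simp add: Ca)
  ultimately show ?thesis using C by (intro exI[of _ "C * C"]) simp
qed

text \<open>Existence of a root makes the choice in \<open>psd_sqrt\<close> satisfy its defining
  equation.\<close>

lemma mat_abs_square:
  assumes X: "X \<in> carrier_mat m n"
  shows "mat_abs X \<in> carrier_mat n n" "mat_abs X * mat_abs X = mat_adjoint X * X"
proof -
  have XX: "mat_adjoint X * X \<in> carrier_mat n n" using X by (auto intro: mult_carrier_mat)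
  have "\<exists>B. psd_mat B \<and> B \<in> carrier_mat (dim_row (mat_adjoint X * X)) (dim_row (mat_adjoint X * X))
      \<and> B * B = mat_adjoint X * X"
    using psd_sqrt_exists[OF psd_mat_adjoint_mult_self[OF X] XX] X by simp
  from someI_ex[OF this] show "mat_abs X \<in> carrier_mat n n" "mat_abs X * mat_abs X = mat_adjoint X * X"
    unfolding mat_abs_def psd_sqrt_def using X by auto
qed

text \<open>The exponent is even, so the modulus enters only through its square.\<close>

lemma schatten_norm_4:
  assumes X: "X \<in> carrier_mat n n"
  shows "schatten_norm 4 X = root 4 (Re (mat_trace ((mat_adjoint X * X) * (mat_adjoint X * X))) / real n)"
proof -
  note B = mat_abs_square[OF X]
  have "mat_abs X ^\<^sub>m 4 = (mat_abs X * mat_abs X) * (mat_abs X * mat_abs X)"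
    using B(1) by (simp add: eval_nat_numeral assoc_mult_mat[of _ n n _ n _ n])
  then show ?thesis using X by (simp add: schatten_norm_def B(2))
qed

section \<open>The trace form of a matrix family\<close>

lemma mat_trace_mult_commute:
  assumes "A \<in> carrier_mat n n" "B \<in> carrier_mat n n"
  shows "mat_trace (A * B) = mat_trace (B * A)"
  unfolding mat_trace_mult[OF assms] mat_trace_mult[OF assms(2,1)]
  by (subst sum.swap) (simp add: mult.commute)

lemma mat_trace_adjoint:
  assumes "A \<in> carrier_mat n n"
  shows "mat_trace (mat_adjoint A) = cnj (mat_trace A)"
  using assms by (simp add: mat_trace_def)

lemma mat_trace_mult_adjoint:
  assumes A: "A \<in> carrier_mat n n"
  shows "mat_trace (A * mat_adjoint A) = of_real (\<Sum>i<n. \<Sum>j<n. (cmod (A $$ (i, j)))\<^sup>2)"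
  unfolding mat_trace_mult[OF A mat_adjoint_carrier[OF A]] of_real_sum
  by (intro sum.cong refl) (use A in \<open>simp add: complex_norm_square del: of_real_power\<close>)

text \<open>Cauchy-Schwarz over all index pairs, with \<open>Y\<close> read transposed;
  transposition does not change its Hilbert-Schmidt norm.\<close>

lemma mat_trace_cauchy_schwarz:
  assumes X: "X \<in> carrier_mat n n" and Y: "Y \<in> carrier_mat n n"
  shows "(cmod (mat_trace (X * Y)))\<^sup>2 \<le>
    Re (mat_trace (X * mat_adjoint X)) * Re (mat_trace (Y * mat_adjoint Y))"
proof -
  let ?I = "{..<n} \<times> {..<n}"
  let ?f = "\<lambda>(i, j). cmod (X $$ (i, j))" and ?g = "\<lambda>(i, j). cmod (Y $$ (j, i))"
  have "mat_trace (X * Y) = (\<Sum>(i, j)\<in>?I. X $$ (i, j) * Y $$ (j, i))"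
    unfolding mat_trace_mult[OF X Y] by (simp add: sum.cartesian_product)
  also have "cmod \<dots> \<le> (\<Sum>p\<in>?I. \<bar>?f p\<bar> * \<bar>?g p\<bar>)"
    by (rule sum_norm_le) (auto simp: norm_mult)
  also have "\<dots> \<le> L2_set ?f ?I * L2_set ?g ?I" by (rule L2_set_mult_ineq)
  finally have "(cmod (mat_trace (X * Y)))\<^sup>2 \<le> (L2_set ?f ?I)\<^sup>2 * (L2_set ?g ?I)\<^sup>2"
    unfolding power_mult_distrib[symmetric] by (intro power_mono) auto
  also have "(L2_set ?f ?I)\<^sup>2 = Re (mat_trace (X * mat_adjoint X))"
    by (simp add: mat_trace_mult_adjoint[OF X] L2_set_def sum_nonneg sum.cartesian_product case_prod_unfold
        del: of_real_sum of_real_power)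
  also have "(L2_set ?g ?I)\<^sup>2 = Re (mat_trace (Y * mat_adjoint Y))"
  proof -
    have "(L2_set ?g ?I)\<^sup>2 = (\<Sum>i<n. \<Sum>j<n. (cmod (Y $$ (j, i)))\<^sup>2)"
      by (simp add: L2_set_def sum_nonneg sum.cartesian_product case_prod_unfold)
    also have "\<dots> = (\<Sum>i<n. \<Sum>j<n. (cmod (Y $$ (i, j)))\<^sup>2)" by (rule sum.swap)
    finally show ?thesis by (simp add: mat_trace_mult_adjoint[OF Y] del: of_real_sum of_real_power)
  qed
  finally show ?thesis .
qed

definition trace_form :: "complex mat \<Rightarrow> complex mat \<Rightarrow> complex mat \<Rightarrow> complex mat \<Rightarrow> complex" where
  "trace_form A B C D = mat_trace ((mat_adjoint A * B) * (mat_adjoint C * D))"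

context
  fixes A B C D :: "complex mat" and n :: nat
  assumes A: "A \<in> carrier_mat n n" and B: "B \<in> carrier_mat n n"
    and C: "C \<in> carrier_mat n n" and D: "D \<in> carrier_mat n n"
begin

private lemmas adj = mat_adjoint_carrier[OF A] mat_adjoint_carrier[OF B]
  mat_adjoint_carrier[OF C] mat_adjoint_carrier[OF D]
private lemmas asc = assoc_mult_mat[of _ n n _ n _ n]

lemma trace_form_rot: "trace_form A B C D = trace_form C D A B"
  unfolding trace_form_def
  by (rule mat_trace_mult_commute[OF mult_carrier_mat[OF adj(1) B] mult_carrier_mat[OF adj(3) D]])

lemma trace_form_cnj: "cnj (trace_form A B C D) = trace_form D C B A"
proof -
  note 1 = mult_carrier_mat[OF adj(1) B] mult_carrier_mat[OF adj(3) D]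
  have "cnj (trace_form A B C D) = mat_trace (mat_adjoint ((mat_adjoint A * B) * (mat_adjoint C * D)))"
    unfolding trace_form_def by (rule mat_trace_adjoint[symmetric, OF mult_carrier_mat[OF 1]])
  also have "mat_adjoint ((mat_adjoint A * B) * (mat_adjoint C * D)) = (mat_adjoint D * C) * (mat_adjoint B * A)"
    by (simp add: mat_adjoint_mult[OF 1] mat_adjoint_mult[OF adj(1) B] mat_adjoint_mult[OF adj(3) D])
  finally show ?thesis by (simp add: trace_form_def)
qed

text \<open>Cyclicity regroups the four factors into the other neighbouring pairs; Cauchy-Schwarz
  then yields the second inequality of \<open>quartic_form\<close>.\<close>

lemma trace_form_shift: "trace_form A B C D = mat_trace ((B * mat_adjoint C) * (D * mat_adjoint A))"
proof -
  have "trace_form A B C D = mat_trace (mat_adjoint A * (B * (mat_adjoint C * D)))"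
    unfolding trace_form_def assoc_mult_mat[OF adj(1) B mult_carrier_mat[OF adj(3) D]] ..
  also have "\<dots> = mat_trace (B * (mat_adjoint C * D) * mat_adjoint A)"
    by (rule mat_trace_mult_commute[OF adj(1) mult_carrier_mat[OF B mult_carrier_mat[OF adj(3) D]]])
  also have "B * (mat_adjoint C * D) * mat_adjoint A = (B * mat_adjoint C) * (D * mat_adjoint A)"
    unfolding assoc_mult_mat[OF B adj(3) D, symmetric]
    by (rule assoc_mult_mat[OF mult_carrier_mat[OF B adj(3)] D adj(1)])
  finally show ?thesis .
qed

text \<open>A self-adjoint unitary cancels between neighbouring factors, and by cyclicity also at
  the two ends.\<close>

lemma trace_form_conj:
  assumes U: "U \<in> carrier_mat n n" "mat_adjoint U = U" "U * U = 1\<^sub>m n"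
  shows "trace_form (U * A * U) (U * B * U) (U * C * U) (U * D * U) = trace_form A B C D"
proof -
  have adjU: "mat_adjoint (U * X * U) = U * mat_adjoint X * U" if "X \<in> carrier_mat n n" for X
    using that U mat_adjoint_mult[of "U * X" n n U n] mat_adjoint_mult[of U n n X n]
    by (simp add: asc)
  let ?M = "(mat_adjoint A * B) * (mat_adjoint C * D)"
  note M = mult_carrier_mat[OF adj(1) B] mult_carrier_mat[OF adj(3) D]
    mult_carrier_mat[OF mult_carrier_mat[OF adj(1) B] mult_carrier_mat[OF adj(3) D]]
  have "(mat_adjoint (U * A * U) * (U * B * U)) * (mat_adjoint (U * C * U) * (U * D * U)) = U * ?M * U"
    unfolding adjU[OF A] adjU[OF C] mult_conj_similar[OF U(1) U(1) adj(1) B U(3)]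
      mult_conj_similar[OF U(1) U(1) adj(3) D U(3)] mult_conj_similar[OF U(1) U(1) M(1,2) U(3)] ..
  moreover have "mat_trace (U * ?M * U) = mat_trace (U * (U * ?M))"
    by (rule mat_trace_mult_commute[OF mult_carrier_mat[OF U(1) M(3)] U(1)])
  moreover have "U * (U * ?M) = ?M"
    unfolding assoc_mult_mat[OF U(1) U(1) M(3), symmetric] U(3) by (rule left_mult_one_mat[OF M(3)])
  ultimately show ?thesis by (simp add: trace_form_def)
qed

end

lemma trace_form_cs1:
  assumes "A \<in> carrier_mat n n" "B \<in> carrier_mat n n" "C \<in> carrier_mat n n" "D \<in> carrier_mat n n"
  shows "(cmod (trace_form A B C D))\<^sup>2 \<le> Re (trace_form A B B A) * Re (trace_form C D D C)"
proof -
  note adj = assms[THEN mat_adjoint_carrier]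
  show ?thesis
    using mat_trace_cauchy_schwarz[OF mult_carrier_mat[OF adj(1) assms(2)] mult_carrier_mat[OF adj(3) assms(4)]]
    by (simp only: trace_form_def mat_adjoint_mult[OF adj(1) assms(2)] mat_adjoint_mult[OF adj(3) assms(4)]
        mat_adjoint_adjoint)
qed

lemma trace_form_cs2:
  assumes "A \<in> carrier_mat n n" "B \<in> carrier_mat n n" "C \<in> carrier_mat n n" "D \<in> carrier_mat n n"
  shows "(cmod (trace_form A B C D))\<^sup>2 \<le> Re (trace_form B B C C) * Re (trace_form D D A A)"
proof -
  note adj = assms[THEN mat_adjoint_carrier]
  show ?thesis
    using mat_trace_cauchy_schwarz[OF mult_carrier_mat[OF assms(2) adj(3)] mult_carrier_mat[OF assms(4) adj(1)]]
    by (simp only: trace_form_shift[OF assms] trace_form_shift[OF assms(2,2,3,3)]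
        trace_form_shift[OF assms(4,4,1,1)] mat_adjoint_mult[OF assms(2) adj(3)]
        mat_adjoint_mult[OF assms(4) adj(1)] mat_adjoint_adjoint)
qed

lemma trace_form_pos:
  assumes "A \<in> carrier_mat n n" "B \<in> carrier_mat n n"
  shows "0 \<le> Re (trace_form A B B A)" "0 \<le> Re (trace_form A A B B)"
proof -
  note adj = assms[THEN mat_adjoint_carrier]
  have pos: "0 \<le> Re (mat_trace (X * mat_adjoint X))" if "X \<in> carrier_mat n n" for X
    unfolding mat_trace_mult_adjoint[OF that] by (simp add: sum_nonneg del: of_real_sum of_real_power)
  show "0 \<le> Re (trace_form A B B A)"
    using pos[OF mult_carrier_mat[OF adj(1) assms(2)]]
    by (simp only: trace_form_def mat_adjoint_mult[OF adj(1) assms(2)] mat_adjoint_adjoint)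
  show "0 \<le> Re (trace_form A A B B)"
    using pos[OF mult_carrier_mat[OF assms(1) adj(2)]]
    by (simp only: trace_form_shift[OF assms(1,1,2,2)] mat_adjoint_mult[OF assms(1) adj(2)] mat_adjoint_adjoint)
qed

text \<open>The fixed operators \<open>K\<close> absorb the matrix coefficients, so that the quartic
  form lives on scalar functions of the index.\<close>

definition multiplier :: "nat \<Rightarrow> 'i set \<Rightarrow> ('i \<Rightarrow> complex mat) \<Rightarrow> ('i \<Rightarrow> complex) \<Rightarrow> complex mat" where
  "multiplier d I K f = mat d d (\<lambda>(i, j). \<Sum>\<alpha>\<in>I. f \<alpha> * K \<alpha> $$ (i, j))"

lemma multiplier_carrier [simp]: "multiplier d I K f \<in> carrier_mat d d"
  by (simp add: multiplier_def)

lemma multiplier_add: "multiplier d I K (f + g) = multiplier d I K f + multiplier d I K g"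
  by (rule eq_matI) (simp_all add: multiplier_def distrib_right sum.distrib)

lemma multiplier_diff: "multiplier d I K (\<lambda>\<alpha>. f \<alpha> - g \<alpha>) = multiplier d I K f - multiplier d I K g"
  by (rule eq_matI) (simp_all add: multiplier_def left_diff_distrib sum_subtractf)

lemma multiplier_scale: "multiplier d I K ((\<lambda>_. z) * f) = z \<cdot>\<^sub>m multiplier d I K f"
  by (rule eq_matI) (simp_all add: multiplier_def sum_distrib_left mult.assoc)

lemma mat_trace_add: "A \<in> carrier_mat n n \<Longrightarrow> B \<in> carrier_mat n n \<Longrightarrow> mat_trace (A + B) = mat_trace A + mat_trace B"
  by (simp add: mat_trace_def sum.distrib)

lemma mat_trace_smult: "A \<in> carrier_mat n n \<Longrightarrow> mat_trace (z \<cdot>\<^sub>m A) = z * mat_trace A"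
  by (simp add: mat_trace_def sum_distrib_left)

lemma quartic_form_trace_form:
  "quartic_form (\<lambda>f1 f2 f3 f4. trace_form (multiplier d I K f1) (multiplier d I K f2)
    (multiplier d I K f3) (multiplier d I K f4))"
proof
  fix a b b' c e :: "'a \<Rightarrow> complex" and z
  let ?M = "multiplier d I K"
  have adj: "mat_adjoint (?M f) \<in> carrier_mat d d" for f by (rule mat_adjoint_carrier) simp
  have c: "mat_adjoint (?M f) * ?M g \<in> carrier_mat d d" for f g
    by (rule mult_carrier_mat[OF adj]) simp
  have cc: "mat_adjoint (?M f) * ?M g * (mat_adjoint (?M f') * ?M g') \<in> carrier_mat d d" for f g f' g'
    by (rule mult_carrier_mat[OF c c])
  show "trace_form (?M a) (?M (b + b')) (?M c) (?M e) =
      trace_form (?M a) (?M b) (?M c) (?M e) + trace_form (?M a) (?M b') (?M c) (?M e)"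
    unfolding trace_form_def multiplier_add mult_add_distrib_mat[OF adj multiplier_carrier multiplier_carrier]
      add_mult_distrib_mat[OF c c c] by (rule mat_trace_add[OF cc cc])
  show "trace_form (?M a) (?M ((\<lambda>_. z) * b)) (?M c) (?M e) = z * trace_form (?M a) (?M b) (?M c) (?M e)"
    unfolding trace_form_def multiplier_scale mult_smult_distrib[OF adj multiplier_carrier]
      mult_smult_assoc_mat[OF c c] by (rule mat_trace_smult[OF cc])
qed ((rule trace_form_rot trace_form_cnj trace_form_pos trace_form_cs1 trace_form_cs2; rule multiplier_carrier)+)

lemma multiplier_conj:
  assumes U: "U \<in> carrier_mat d d" and K: "\<And>\<alpha>. \<alpha> \<in> I \<Longrightarrow> K \<alpha> \<in> carrier_mat d d"
    and conj: "\<And>\<alpha>. \<alpha> \<in> I \<Longrightarrow> U * K \<alpha> * U = s \<alpha> \<cdot>\<^sub>m K \<alpha>"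
  shows "U * multiplier d I K f * U = multiplier d I K (s * f)"
proof (rule eq_matI)
  fix i j assume "i < dim_row (multiplier d I K (s * f))" "j < dim_col (multiplier d I K (s * f))"
  then have ij: "i < d" "j < d" by (simp_all add: multiplier_def)
  have entry: "(U * X * U) $$ (i, j) = (\<Sum>l<d. \<Sum>k<d. U $$ (i, k) * X $$ (k, l) * U $$ (l, j))"
    if X: "X \<in> carrier_mat d d" for X
    unfolding mult_mat_index_sum[OF mult_carrier_mat[OF U X] U ij] sum_distrib_right[symmetric]
    by (intro sum.cong refl) (use mult_mat_index_sum[OF U X ij(1)] in auto)
  have "(U * multiplier d I K f * U) $$ (i, j) =
      (\<Sum>l<d. \<Sum>k<d. \<Sum>\<alpha>\<in>I. f \<alpha> * (U $$ (i, k) * K \<alpha> $$ (k, l) * U $$ (l, j)))"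
    unfolding entry[OF multiplier_carrier]
    by (intro sum.cong refl) (simp add: multiplier_def sum_distrib_left sum_distrib_right mult_ac)
  also have "\<dots> = (\<Sum>\<alpha>\<in>I. \<Sum>l<d. \<Sum>k<d. f \<alpha> * (U $$ (i, k) * K \<alpha> $$ (k, l) * U $$ (l, j)))"
    by (subst (2) sum.swap, subst sum.swap) simp
  also have "\<dots> = (\<Sum>\<alpha>\<in>I. f \<alpha> * (U * K \<alpha> * U) $$ (i, j))"
    by (intro sum.cong refl) (simp add: entry[OF K] sum_distrib_left)
  also have "\<dots> = (\<Sum>\<alpha>\<in>I. (s * f) \<alpha> * K \<alpha> $$ (i, j))"
    by (intro sum.cong refl) (use ij conj K[THEN carrier_matD(1)] K[THEN carrier_matD(2)] in \<open>simp add: mult_ac\<close>)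
  also have "\<dots> = multiplier d I K (s * f) $$ (i, j)" using ij by (simp add: multiplier_def)
  finally show "(U * multiplier d I K f * U) $$ (i, j) = multiplier d I K (s * f) $$ (i, j)" .
qed (use U in \<open>simp_all add: multiplier_def\<close>)

section \<open>Pauli strings\<close>

lemma kron_dim [simp]:
  "dim_row (kron A B) = dim_row A * dim_row B" "dim_col (kron A B) = dim_col A * dim_col B"
  by (simp_all add: kron_def)

lemma tensor_div_less: "i < a * b \<Longrightarrow> i div b < a" for i a b :: nat
  by (rule less_mult_imp_div_less)

lemma tensor_mod_less: "i < a * b \<Longrightarrow> i mod b < b" for i a b :: nat
  by (cases "b = 0") auto

lemma kron_index:
  assumes "A \<in> carrier_mat a a" "B \<in> carrier_mat b b" "i < a * b" "j < a * b"
  shows "kron A B $$ (i, j) = A $$ (i div b, j div b) * B $$ (i mod b, j mod b)"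
  using assms by (simp add: kron_def)

lemma kron_mult:
  assumes A: "A \<in> carrier_mat a a" and C: "C \<in> carrier_mat a a"
    and B: "B \<in> carrier_mat b b" and D: "D \<in> carrier_mat b b"
  shows "kron A B * kron C D = kron (A * C) (B * D)"
proof (rule eq_matI)
  fix i j assume "i < dim_row (kron (A * C) (B * D))" "j < dim_col (kron (A * C) (B * D))"
  then have ij: "i < a * b" "j < a * b" using assms by auto
  note d = ij[THEN tensor_div_less] ij[THEN tensor_mod_less]
  have "(kron A B * kron C D) $$ (i, j) = (\<Sum>k<a * b. kron A B $$ (i, k) * kron C D $$ (k, j))"
    by (rule mult_mat_index_sum[OF kron_carrier[OF A B] kron_carrier[OF C D] ij])
  also have "\<dots> = (\<Sum>k<a * b. (\<lambda>p q. (A $$ (i div b, p) * C $$ (p, j div b)) *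
      (B $$ (i mod b, q) * D $$ (q, j mod b))) (k div b) (k mod b))"
    by (intro sum.cong refl) (use ij in \<open>simp add: kron_index[OF A B] kron_index[OF C D]\<close>)
  also have "\<dots> = (\<Sum>p<a. \<Sum>q<b. (A $$ (i div b, p) * C $$ (p, j div b)) *
      (B $$ (i mod b, q) * D $$ (q, j mod b)))"
    by (rule sum_tensor_index)
  also have "\<dots> = (A * C) $$ (i div b, j div b) * (B * D) $$ (i mod b, j mod b)"
    unfolding mult_mat_index_sum[OF A C d(1,2)] mult_mat_index_sum[OF B D d(3,4)]
    by (simp only: sum_distrib_left sum_distrib_right) (rule sum.swap)
  also have "\<dots> = kron (A * C) (B * D) $$ (i, j)"
    by (rule kron_index[symmetric, OF mult_carrier_mat[OF A C] mult_carrier_mat[OF B D] ij])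
  finally show "(kron A B * kron C D) $$ (i, j) = kron (A * C) (B * D) $$ (i, j)" .
qed (use assms in auto)

lemma kron_one: "kron (1\<^sub>m a) (1\<^sub>m b) = (1\<^sub>m (a * b) :: complex mat)"
proof (rule eq_matI)
  fix i j assume "i < dim_row (1\<^sub>m (a * b) :: complex mat)" "j < dim_col (1\<^sub>m (a * b) :: complex mat)"
  then have ij: "i < a * b" "j < a * b" by auto
  have "i = j \<longleftrightarrow> i div b = j div b \<and> i mod b = j mod b"
    by (metis mult_div_mod_eq)
  then show "kron (1\<^sub>m a) (1\<^sub>m b) $$ (i, j) = (1\<^sub>m (a * b) :: complex mat) $$ (i, j)"
    using ij ij[THEN tensor_div_less] ij[THEN tensor_mod_less]
    by (simp add: kron_index[of _ a _ b])
qed auto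

lemma mat_adjoint_kron:
  assumes A: "A \<in> carrier_mat a a" and B: "B \<in> carrier_mat b b"
  shows "mat_adjoint (kron A B) = kron (mat_adjoint A) (mat_adjoint B)"
proof (rule eq_matI)
  fix i j assume "i < dim_row (kron (mat_adjoint A) (mat_adjoint B))" "j < dim_col (kron (mat_adjoint A) (mat_adjoint B))"
  then have ij: "i < a * b" "j < a * b" using assms by auto
  show "mat_adjoint (kron A B) $$ (i, j) = kron (mat_adjoint A) (mat_adjoint B) $$ (i, j)"
    using ij ij[THEN tensor_div_less] ij[THEN tensor_mod_less] A B
    by (simp add: kron_index[OF A B] kron_index[OF mat_adjoint_carrier[OF A] mat_adjoint_carrier[OF B]])
qed (use assms in auto)

lemma kron_smult:
  assumes A: "A \<in> carrier_mat a a" and B: "B \<in> carrier_mat b b"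
  shows "kron (x \<cdot>\<^sub>m A) (y \<cdot>\<^sub>m B) = (x * y) \<cdot>\<^sub>m kron A B"
proof (rule eq_matI)
  fix i j assume "i < dim_row ((x * y) \<cdot>\<^sub>m kron A B)" "j < dim_col ((x * y) \<cdot>\<^sub>m kron A B)"
  then have ij: "i < a * b" "j < a * b" using assms by auto
  have "x \<cdot>\<^sub>m A \<in> carrier_mat a a" "y \<cdot>\<^sub>m B \<in> carrier_mat b b" using A B by auto
  then show "kron (x \<cdot>\<^sub>m A) (y \<cdot>\<^sub>m B) $$ (i, j) = ((x * y) \<cdot>\<^sub>m kron A B) $$ (i, j)"
    using ij ij[THEN tensor_div_less] ij[THEN tensor_mod_less] A B
    by (simp add: kron_index[of _ a _ b] mult_ac)
qed (use assms in auto)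

section \<open>Commutation and completeness relations of Pauli matrices and strings\<close>

lemma UNIV_bit_pair: "(UNIV :: (bit \<times> bit) set) = {(0, 0), (1, 0), (0, 1), (1, 1)}"
proof -
  have "x = 0 \<or> x = 1" for x :: bit by (cases x) simp_all
  then show ?thesis by auto
qed

text \<open>The commutation sign: two distinct non-identity Pauli matrices anticommute, all other
  pairs commute.\<close>

definition pauli_sign :: "bit \<times> bit \<Rightarrow> bit \<times> bit \<Rightarrow> complex" where
  "pauli_sign b a = (if a = (0, 0) \<or> b = (0, 0) \<or> a = b then 1 else -1)"

lemma eq_mat_2I:
  fixes A B :: "complex mat"
  assumes "A \<in> carrier_mat 2 2" "B \<in> carrier_mat 2 2"
    "A $$ (0, 0) = B $$ (0, 0)" "A $$ (0, Suc 0) = B $$ (0, Suc 0)"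
    "A $$ (Suc 0, 0) = B $$ (Suc 0, 0)" "A $$ (Suc 0, Suc 0) = B $$ (Suc 0, Suc 0)"
  shows "A = B"
  by (rule eq_matI) (use assms in \<open>auto simp: numeral_2_eq_2 less_Suc_eq\<close>)

lemma mult_mat_2_index:
  fixes A B :: "complex mat"
  assumes "A \<in> carrier_mat 2 2" "B \<in> carrier_mat 2 2" "i < 2" "j < 2"
  shows "(A * B) $$ (i, j) = A $$ (i, 0) * B $$ (0, j) + A $$ (i, Suc 0) * B $$ (Suc 0, j)"
  unfolding mult_mat_index_sum[OF assms] by (rule sum_less_two)

lemma pauli_conj: "pauli b * pauli a * pauli b = pauli_sign b a \<cdot>\<^sub>m pauli a"
proof -
  have c: "pauli b * pauli a \<in> carrier_mat 2 2" by (rule mult_carrier_mat[of _ 2 2]) simp_all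
  have bit: "x = 0 \<or> x = 1" for x :: bit by (cases x) simp_all
  have d: "dim_row (pauli a) = 2" "dim_col (pauli a) = 2" for a
    using pauli_carrier[of a] by (auto simp del: pauli_carrier)
  show ?thesis
    using bit[of "fst a"] bit[of "snd a"] bit[of "fst b"] bit[of "snd b"]
    by (intro eq_mat_2I mult_carrier_mat[OF c] smult_carrier_mat pauli_carrier)
      (elim disjE; simp add: mult_mat_2_index[OF c] mult_mat_2_index pauli_index d pauli_sign_def prod_eq_iff
        del: index_mult_mat)+
qed

lemma pauli_square: "pauli a * pauli a = 1\<^sub>m 2"
proof -
  have bit: "x = 0 \<or> x = 1" for x :: bit by (cases x) simp_all
  show ?thesis
    using bit[of "fst a"] bit[of "snd a"]
    by (intro eq_mat_2I mult_carrier_mat[of _ 2 2] one_carrier_mat pauli_carrier)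
      (elim disjE; simp add: mult_mat_2_index pauli_index del: index_mult_mat)+
qed

lemma mat_adjoint_pauli: "mat_adjoint (pauli a) = pauli a"
proof -
  have bit: "x = 0 \<or> x = 1" for x :: bit by (cases x) simp_all
  have d: "dim_row (pauli a) = 2" "dim_col (pauli a) = 2" for a
    using pauli_carrier[of a] by (auto simp del: pauli_carrier)
  show ?thesis
    using bit[of "fst a"] bit[of "snd a"]
    by (intro eq_mat_2I mat_adjoint_carrier pauli_carrier)
      (elim disjE; simp add: pauli_index d)+
qed

lemma pauli_string_conj:
  assumes "length \<beta> = length \<alpha>"
  shows "pauli_string \<beta> * pauli_string \<alpha> * pauli_string \<beta> =
    prod_list (map2 pauli_sign \<beta> \<alpha>) \<cdot>\<^sub>m pauli_string \<alpha>"
  using assms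
proof (induction \<beta> \<alpha> rule: list_induct2)
  case (Cons b \<beta> a \<alpha>)
  let ?k = "2 ^ length \<alpha>"
  have c: "pauli_string \<beta> \<in> carrier_mat ?k ?k" "pauli_string \<alpha> \<in> carrier_mat ?k ?k"
    using pauli_string_carrier[of \<beta>] pauli_string_carrier[of \<alpha>] Cons by auto
  have pp: "pauli b * pauli a \<in> carrier_mat 2 2" by (rule mult_carrier_mat[OF pauli_carrier pauli_carrier])
  show ?case
    unfolding pauli_string.simps kron_mult[OF pauli_carrier pauli_carrier c]
      kron_mult[OF pp pauli_carrier mult_carrier_mat[OF c] c(1)] Cons.IH pauli_conj
      kron_smult[OF pauli_carrier c(2)] by simp
next
  case Nil
  show ?case by (rule eq_matI) auto
qed

lemma pauli_string_square: "pauli_string \<beta> * pauli_string \<beta> = 1\<^sub>m (2 ^ length \<beta>)"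
proof (induction \<beta>)
  case (Cons b \<beta>)
  show ?case
    unfolding pauli_string.simps
      kron_mult[OF pauli_carrier pauli_carrier pauli_string_carrier pauli_string_carrier] Cons.IH pauli_square kron_one
    by simp
qed simp

lemma mat_adjoint_pauli_string: "mat_adjoint (pauli_string \<alpha>) = pauli_string \<alpha>"
proof (induction \<alpha>)
  case Nil
  show ?case by (rule eq_matI) auto
next
  case (Cons a \<alpha>)
  then show ?case
    by (simp add: mat_adjoint_kron[OF pauli_carrier pauli_string_carrier] mat_adjoint_pauli)
qed

lemma single_site_sign:
  assumes "length \<alpha> = n" "i < n"
  shows "prod_list (map2 pauli_sign ((replicate n (0, 0))[i := c]) \<alpha>) = pauli_sign c (\<alpha> ! i)"
proof -
  have "prod_list (map2 pauli_sign ((replicate n (0, 0))[i := c]) \<alpha>) =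
      (\<Prod>j\<in>{0..<n}. if j = i then pauli_sign c (\<alpha> ! i) else 1)"
    unfolding prod.list_conv_set_nth using assms
    by (intro prod.cong) (auto simp: nth_list_update pauli_sign_def)
  then show ?thesis using assms by simp
qed

text \<open>In entries, the sum of \<open>pauli a\<close> tensored with itself is twice the swap
  operator.\<close>

lemma pauli_completeness:
  assumes "i < 2" "j < 2" "k < 2" "l < 2"
  shows "(\<Sum>a\<in>UNIV. pauli a $$ (i, j) * pauli a $$ (k, l)) = (if i = l \<and> j = k then 2 else 0)"
proof -
  have two: "x = 0 \<or> x = Suc 0" if "x < 2" for x using that by auto
  show ?thesis
    using two[OF assms(1)] two[OF assms(2)] two[OF assms(3)] two[OF assms(4)]
    unfolding UNIV_bit_pair by (elim disjE) (simp_all add: pauli_index)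
qed

lemma pauli_indices_Suc: "pauli_indices (Suc n) = (\<lambda>(a, \<alpha>). a # \<alpha>) ` (UNIV \<times> pauli_indices n)"
  by (auto simp: pauli_indices_def length_Suc_conv image_iff)

text \<open>The swap operator of \<open>n\<close> qubits is the tensor product of the one-qubit
  swaps.\<close>

lemma pauli_string_completeness:
  assumes "i < 2 ^ n" "j < 2 ^ n" "k < 2 ^ n" "l < 2 ^ n"
  shows "(\<Sum>\<alpha>\<in>pauli_indices n. pauli_string \<alpha> $$ (i, j) * pauli_string \<alpha> $$ (k, l)) =
    (if i = l \<and> j = k then 2 ^ n else 0)"
  using assms
proof (induction n arbitrary: i j k l)
  case 0
  then show ?case by (simp add: pauli_indices_def)
next
  case (Suc n)
  let ?b = "2 ^ n :: nat"
  have lt: "i < 2 * ?b" "j < 2 * ?b" "k < 2 * ?b" "l < 2 * ?b" using Suc.prems by auto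
  note d = lt[THEN tensor_div_less] and m = lt[THEN tensor_mod_less]
  have inj: "inj_on (\<lambda>(a, \<alpha>). a # \<alpha>) (UNIV \<times> pauli_indices n)" by (auto simp: inj_on_def)
  have eq: "x = y \<longleftrightarrow> x div ?b = y div ?b \<and> x mod ?b = y mod ?b" for x y
    by (metis mult_div_mod_eq)
  have "(\<Sum>\<alpha>\<in>pauli_indices (Suc n). pauli_string \<alpha> $$ (i, j) * pauli_string \<alpha> $$ (k, l)) =
      (\<Sum>(a, \<alpha>)\<in>UNIV \<times> pauli_indices n. (pauli a $$ (i div ?b, j div ?b) * pauli a $$ (k div ?b, l div ?b)) *
        (pauli_string \<alpha> $$ (i mod ?b, j mod ?b) * pauli_string \<alpha> $$ (k mod ?b, l mod ?b)))"
    unfolding pauli_indices_Suc sum.reindex[OF inj]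
  proof (rule sum.cong[OF refl], clarify)
    fix a b \<alpha> assume "\<alpha> \<in> pauli_indices n"
    then have P: "pauli_string \<alpha> \<in> carrier_mat ?b ?b"
      using pauli_string_carrier[of \<alpha>] by (simp add: pauli_indices_def)
    show "((\<lambda>\<alpha>. pauli_string \<alpha> $$ (i, j) * pauli_string \<alpha> $$ (k, l)) \<circ> (\<lambda>(a, \<alpha>). a # \<alpha>)) ((a, b), \<alpha>) =
      pauli (a, b) $$ (i div ?b, j div ?b) * pauli (a, b) $$ (k div ?b, l div ?b) *
      (pauli_string \<alpha> $$ (i mod ?b, j mod ?b) * pauli_string \<alpha> $$ (k mod ?b, l mod ?b))"
      using lt by (simp add: kron_index[OF pauli_carrier P])
  qed
  also have "\<dots> = (\<Sum>a\<in>UNIV. pauli a $$ (i div ?b, j div ?b) * pauli a $$ (k div ?b, l div ?b)) *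
      (\<Sum>\<alpha>\<in>pauli_indices n. pauli_string \<alpha> $$ (i mod ?b, j mod ?b) * pauli_string \<alpha> $$ (k mod ?b, l mod ?b))"
    by (simp add: sum_product sum.cartesian_product)
  also have "\<dots> = (if i = l \<and> j = k then 2 ^ Suc n else 0)"
    unfolding pauli_completeness[OF d] Suc.IH[OF m] eq[of i l] eq[of j k] by simp
  finally show ?case .
qed

section \<open>Pauli expansion with matrix coefficients\<close>

text \<open>The normalized partial trace over the qubits of the string times \<open>S\<close>, taken
  block by block.\<close>

definition pauli_coeff :: "nat \<Rightarrow> nat \<Rightarrow> complex mat \<Rightarrow> (bit \<times> bit) list \<Rightarrow> complex mat" where
  "pauli_coeff a n S \<alpha> = mat a a (\<lambda>(p, q). mat_trace (pauli_string \<alpha> * tensor_block (2 ^ n) S p q) / 2 ^ n)"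

lemma pauli_coeff_carrier [simp]: "pauli_coeff a n S \<alpha> \<in> carrier_mat a a"
  by (simp add: pauli_coeff_def)

definition pauli_multiplier :: "nat \<Rightarrow> nat \<Rightarrow> complex mat \<Rightarrow> ((bit \<times> bit) list \<Rightarrow> complex) \<Rightarrow> complex mat" where
  "pauli_multiplier a n S =
    multiplier (a * 2 ^ n) (pauli_indices n) (\<lambda>\<alpha>. kron (pauli_coeff a n S \<alpha>) (pauli_string \<alpha>))"

lemma pauli_multiplier_carrier [simp]: "pauli_multiplier a n S f \<in> carrier_mat (a * 2 ^ n) (a * 2 ^ n)"
  by (simp add: pauli_multiplier_def)

lemma pauli_string_carrier':
  "\<alpha> \<in> pauli_indices n \<Longrightarrow> pauli_string \<alpha> \<in> carrier_mat (2 ^ n) (2 ^ n)"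
  using pauli_string_carrier[of \<alpha>] by (simp add: pauli_indices_def)

lemma pauli_multiplier_index:
  assumes "i < a * 2 ^ n" "j < a * 2 ^ n"
  shows "pauli_multiplier a n S f $$ (i, j) = (\<Sum>\<alpha>\<in>pauli_indices n. f \<alpha> *
    (mat_trace (pauli_string \<alpha> * tensor_block (2 ^ n) S (i div 2 ^ n) (j div 2 ^ n)) / 2 ^ n) *
    pauli_string \<alpha> $$ (i mod 2 ^ n, j mod 2 ^ n))"
proof -
  have "kron (pauli_coeff a n S \<alpha>) (pauli_string \<alpha>) $$ (i, j) =
      mat_trace (pauli_string \<alpha> * tensor_block (2 ^ n) S (i div 2 ^ n) (j div 2 ^ n)) / 2 ^ n *
      pauli_string \<alpha> $$ (i mod 2 ^ n, j mod 2 ^ n)" if "\<alpha> \<in> pauli_indices n" for \<alpha>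
    unfolding kron_index[OF pauli_coeff_carrier pauli_string_carrier'[OF that] assms]
    using assms[THEN tensor_div_less] by (simp add: pauli_coeff_def)
  then show ?thesis
    unfolding pauli_multiplier_def multiplier_def using assms
    by (simp add: mult.assoc)
qed

lemma id_tensor_depolarizing:
  "id_tensor a (2 ^ n) (depolarizing n u) S =
    pauli_multiplier a n S (\<lambda>\<alpha>. of_real (exp (- u * real (pauli_weight \<alpha>))))"
proof (rule eq_matI)
  fix i j assume "i < dim_row (pauli_multiplier a n S (\<lambda>\<alpha>. of_real (exp (- u * real (pauli_weight \<alpha>)))))"
    "j < dim_col (pauli_multiplier a n S (\<lambda>\<alpha>. of_real (exp (- u * real (pauli_weight \<alpha>)))))"
  then have ij: "i < a * 2 ^ n" "j < a * 2 ^ n" by (simp_all add: pauli_multiplier_def multiplier_def)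
  then show "id_tensor a (2 ^ n) (depolarizing n u) S $$ (i, j) =
      pauli_multiplier a n S (\<lambda>\<alpha>. of_real (exp (- u * real (pauli_weight \<alpha>)))) $$ (i, j)"
    unfolding pauli_multiplier_index[OF ij]
    by (simp add: id_tensor_def depolarizing_index tensor_mod_less)
qed (simp_all add: id_tensor_def pauli_multiplier_def multiplier_def)

text \<open>This is the Pauli expansion of \<open>S\<close>; it follows from completeness, applied
  within each block.\<close>

lemma pauli_multiplier_one:
  assumes S: "S \<in> carrier_mat (a * 2 ^ n) (a * 2 ^ n)"
  shows "pauli_multiplier a n S (\<lambda>_. 1) = S"
proof (rule eq_matI)
  fix i j assume "i < dim_row S" "j < dim_col S"
  then have ij: "i < a * 2 ^ n" "j < a * 2 ^ n" using S by auto
  let ?b = "2 ^ n :: nat" and ?X = "tensor_block (2 ^ n) S (i div 2 ^ n) (j div 2 ^ n)"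
  let ?i = "i mod ?b" and ?j = "j mod ?b"
  have m: "?i < ?b" "?j < ?b" by simp_all
  have X: "?X \<in> carrier_mat ?b ?b" by (simp add: tensor_block_def)
  have "pauli_multiplier a n S (\<lambda>_. 1) $$ (i, j) =
      (\<Sum>\<alpha>\<in>pauli_indices n. \<Sum>k<?b. \<Sum>l<?b. ?X $$ (l, k) / 2 ^ n *
        (pauli_string \<alpha> $$ (k, l) * pauli_string \<alpha> $$ (?i, ?j)))"
    unfolding pauli_multiplier_index[OF ij]
    by (intro sum.cong refl) (simp add: mat_trace_mult[OF pauli_string_carrier' X] sum_divide_distrib
        sum_distrib_left sum_distrib_right mult_ac)
  also have "\<dots> = (\<Sum>k<?b. \<Sum>l<?b. ?X $$ (l, k) / 2 ^ n *
      (\<Sum>\<alpha>\<in>pauli_indices n. pauli_string \<alpha> $$ (k, l) * pauli_string \<alpha> $$ (?i, ?j)))"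
    by (simp only: sum_distrib_left sum.swap[of _ _ "pauli_indices n"])
  also have "\<dots> = (\<Sum>k<?b. \<Sum>l<?b. if l = ?i then (if k = ?j then ?X $$ (?i, ?j) else 0) else 0)"
    by (intro sum.cong refl) (auto simp: pauli_string_completeness m)
  also have "\<dots> = ?X $$ (?i, ?j)" using m by simp
  also have "\<dots> = S $$ (i, j)" by (simp only: tensor_block_def index_mat(1)[OF m] case_prod_conv div_mult_mod_eq)
  finally show "pauli_multiplier a n S (\<lambda>_. 1) $$ (i, j) = S $$ (i, j)" .
qed (use S in \<open>auto simp: pauli_multiplier_def multiplier_def\<close>)

text \<open>For Hermitian \<open>S\<close>, taking the adjoint exchanges the blocks (p, q) and (q,
  p), while strings are self-adjoint and the trace is cyclic.\<close>

lemma mat_adjoint_pauli_coeff: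
  assumes S: "S \<in> carrier_mat (a * 2 ^ n) (a * 2 ^ n)" "hermitian_mat S" and \<alpha>: "\<alpha> \<in> pauli_indices n"
  shows "mat_adjoint (pauli_coeff a n S \<alpha>) = pauli_coeff a n S \<alpha>"
proof (rule eq_matI)
  let ?b = "2 ^ n :: nat" and ?P = "pauli_string \<alpha>"
  fix p q assume "p < dim_row (pauli_coeff a n S \<alpha>)" "q < dim_col (pauli_coeff a n S \<alpha>)"
  then have pq: "p < a" "q < a" by (simp_all add: pauli_coeff_def)
  have P: "?P \<in> carrier_mat ?b ?b" using \<alpha> by (rule pauli_string_carrier')
  have X: "tensor_block ?b S p q \<in> carrier_mat ?b ?b" for p q by (simp add: tensor_block_def)
  have adj: "mat_adjoint (tensor_block ?b S q p) = tensor_block ?b S p q"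
  proof (rule eq_matI)
    fix i j assume "i < dim_row (tensor_block ?b S p q)" "j < dim_col (tensor_block ?b S p q)"
    then have ij: "i < ?b" "j < ?b" by (simp_all add: tensor_block_def)
    note lt = tensor_index_less[OF pq(1) ij(1)] tensor_index_less[OF pq(2) ij(2)]
    have "S $$ (p * ?b + i, q * ?b + j) = mat_adjoint S $$ (p * ?b + i, q * ?b + j)"
      using S(2) by (simp add: hermitian_mat_def)
    also have "\<dots> = cnj (S $$ (q * ?b + j, p * ?b + i))"
      using lt S(1) by simp
    finally show "mat_adjoint (tensor_block ?b S q p) $$ (i, j) = tensor_block ?b S p q $$ (i, j)"
      using ij by (simp add: tensor_block_def)
  qed (simp_all add: tensor_block_def)
  have "cnj (mat_trace (?P * tensor_block ?b S q p)) = mat_trace (mat_adjoint (?P * tensor_block ?b S q p))"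
    by (rule mat_trace_adjoint[symmetric, OF mult_carrier_mat[OF P X]])
  also have "\<dots> = mat_trace (tensor_block ?b S p q * ?P)"
    by (simp only: mat_adjoint_mult[OF P X] adj mat_adjoint_pauli_string)
  also have "\<dots> = mat_trace (?P * tensor_block ?b S p q)"
    by (rule mat_trace_mult_commute[OF X P])
  finally show "mat_adjoint (pauli_coeff a n S \<alpha>) $$ (p, q) = pauli_coeff a n S \<alpha> $$ (p, q)"
    using pq by (simp add: pauli_coeff_def)
qed (simp_all add: pauli_coeff_def)

lemma hermitian_pauli_multiplier:
  assumes S: "S \<in> carrier_mat (a * 2 ^ n) (a * 2 ^ n)" "hermitian_mat S"
  shows "hermitian_mat (pauli_multiplier a n S (\<lambda>\<alpha>. of_real (h \<alpha>)))"
proof -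
  let ?R = "pauli_multiplier a n S (\<lambda>\<alpha>. of_real (h \<alpha>))" and ?d = "a * 2 ^ n"
  have "mat_adjoint ?R = ?R"
  proof (rule eq_matI)
    fix i j assume "i < dim_row ?R" "j < dim_col ?R"
    then have ij: "i < ?d" "j < ?d" by (simp_all add: pauli_multiplier_def multiplier_def)
    let ?K = "\<lambda>\<alpha>. kron (pauli_coeff a n S \<alpha>) (pauli_string \<alpha>)"
    have "cnj (?K \<alpha> $$ (j, i)) = ?K \<alpha> $$ (i, j)" if \<alpha>: "\<alpha> \<in> pauli_indices n" for \<alpha>
    proof -
      note P = pauli_string_carrier'[OF \<alpha>]
      have K: "?K \<alpha> \<in> carrier_mat ?d ?d" by (rule kron_carrier[OF pauli_coeff_carrier P])
      have "mat_adjoint (?K \<alpha>) = ?K \<alpha>"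
        by (simp only: mat_adjoint_kron[OF pauli_coeff_carrier P] mat_adjoint_pauli_coeff[OF S \<alpha>] mat_adjoint_pauli_string)
      moreover have "mat_adjoint (?K \<alpha>) $$ (i, j) = cnj (?K \<alpha> $$ (j, i))"
        using ij carrier_matD[OF K] by (intro mat_adjoint_index) simp_all
      ultimately show ?thesis by simp
    qed
    then show "mat_adjoint ?R $$ (i, j) = ?R $$ (i, j)"
      using ij by (simp add: pauli_multiplier_def multiplier_def)
  qed (simp_all add: pauli_multiplier_def multiplier_def)
  then show ?thesis by (simp add: hermitian_mat_def pauli_multiplier_def multiplier_def)
qed

section \<open>The Pauli model of the abstract forms, and assembly of the result\<close>

abbreviation pauli_form :: "nat \<Rightarrow> nat \<Rightarrow> complex mat \<Rightarrow> _" where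
  "pauli_form a n S \<equiv> \<lambda>f1 f2 f3 f4. trace_form (pauli_multiplier a n S f1) (pauli_multiplier a n S f2)
    (pauli_multiplier a n S f3) (pauli_multiplier a n S f4)"

text \<open>The signs at a site arise from conjugation with a string supported on that site, which
  preserves the trace form.\<close>

lemma weight_form_pauli:
  "weight_form (pauli_form a n S) n UNIV (\<lambda>i c \<alpha>. pauli_sign c (\<alpha> ! i)) (\<lambda>i \<alpha>. \<alpha> ! i \<noteq> (0, 0)) (0, 0)"
proof -
  interpret quartic_form "pauli_form a n S"
    unfolding pauli_multiplier_def by (rule quartic_form_trace_form)
  show ?thesis
  proof unfold_locales
    fix i \<alpha> and b :: "bit \<times> bit" and f1 f2 f3 f4 :: "(bit \<times> bit) list \<Rightarrow> complex"
    assume i: "i < n"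
    show "card (UNIV :: (bit \<times> bit) set) = 4" by (simp add: UNIV_bit_pair)
    show "(\<lambda>\<alpha>. pauli_sign (0, 0) (\<alpha> ! i)) = 1" by (simp add: pauli_sign_def fun_eq_iff)
    show "(\<lambda>\<alpha>. pauli_sign b (\<alpha> ! i)) * (\<lambda>\<alpha>. pauli_sign b (\<alpha> ! i)) = 1"
      by (simp add: pauli_sign_def fun_eq_iff)
    show "pauli_sign b (\<alpha> ! i) = 1" if "\<not> \<alpha> ! i \<noteq> (0, 0)"
      using that by (simp add: pauli_sign_def)
    show "(\<Sum>b\<in>UNIV. pauli_sign b (\<alpha> ! i)) = 0" if "\<alpha> ! i \<noteq> (0, 0)"
    proof -
      \<comment> \<open>A non-identity Pauli matrix commutes with the identity and itself and
        anticommutes with the other two, so the four signs cancel.\<close>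
      have "\<alpha> ! i \<in> {(1, 0), (0, 1), (1, 1)}" using that UNIV_I[of "\<alpha> ! i"] unfolding UNIV_bit_pair by auto
      then show ?thesis unfolding UNIV_bit_pair by (auto simp: pauli_sign_def)
    qed
    let ?\<beta> = "(replicate n (0, 0))[i := b]" and ?\<chi> = "\<lambda>\<alpha>. pauli_sign b (\<alpha> ! i)" and ?d = "a * 2 ^ n"
    \<comment> \<open>This self-adjoint unitary has \<open>b\<close> at site \<open>i\<close> and
      the identity on all other sites and on the coefficient algebra.\<close>
    define U where "U = kron (1\<^sub>m a) (pauli_string ?\<beta>)"
    have P: "pauli_string ?\<beta> \<in> carrier_mat (2 ^ n) (2 ^ n)" using pauli_string_carrier[of ?\<beta>] by simp
    have U: "U \<in> carrier_mat ?d ?d" unfolding U_def by (rule kron_carrier[OF one_carrier_mat P])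
    have "mat_adjoint (1\<^sub>m a) = (1\<^sub>m a :: complex mat)" by (rule eq_matI) auto
    then have Ua: "mat_adjoint U = U"
      unfolding U_def mat_adjoint_kron[OF one_carrier_mat P] mat_adjoint_pauli_string by simp
    have UU: "U * U = 1\<^sub>m ?d"
      unfolding U_def kron_mult[OF one_carrier_mat one_carrier_mat P P] pauli_string_square by (simp add: kron_one)
    have conj: "U * pauli_multiplier a n S f * U = pauli_multiplier a n S (?\<chi> * f)" for f
      unfolding pauli_multiplier_def
    proof (rule multiplier_conj[OF U])
      fix \<alpha> assume \<alpha>: "\<alpha> \<in> pauli_indices n"
      let ?A = "pauli_coeff a n S \<alpha>"
      note Q = pauli_string_carrier'[OF \<alpha>]
      have len: "length \<alpha> = n" using \<alpha> by (simp add: pauli_indices_def)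
      show "kron ?A (pauli_string \<alpha>) \<in> carrier_mat ?d ?d"
        by (rule kron_carrier[OF pauli_coeff_carrier Q])
      have "U * kron ?A (pauli_string \<alpha>) * U =
          kron (1\<^sub>m a * ?A * 1\<^sub>m a) (pauli_string ?\<beta> * pauli_string \<alpha> * pauli_string ?\<beta>)"
        unfolding U_def kron_mult[OF one_carrier_mat pauli_coeff_carrier P Q]
        by (rule kron_mult[OF mult_carrier_mat[OF one_carrier_mat pauli_coeff_carrier] one_carrier_mat
              mult_carrier_mat[OF P Q] P])
      also have "1\<^sub>m a * ?A * 1\<^sub>m a = 1 \<cdot>\<^sub>m ?A"
        unfolding left_mult_one_mat[OF pauli_coeff_carrier] right_mult_one_mat[OF pauli_coeff_carrier]
        by (rule eq_matI) auto
      also have "pauli_string ?\<beta> * pauli_string \<alpha> * pauli_string ?\<beta> = ?\<chi> \<alpha> \<cdot>\<^sub>m pauli_string \<alpha>"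
        using len i by (simp add: pauli_string_conj single_site_sign)
      also have "kron (1 \<cdot>\<^sub>m ?A) (?\<chi> \<alpha> \<cdot>\<^sub>m pauli_string \<alpha>) = ?\<chi> \<alpha> \<cdot>\<^sub>m kron ?A (pauli_string \<alpha>)"
        unfolding kron_smult[OF pauli_coeff_carrier Q] by simp
      finally show "U * kron ?A (pauli_string \<alpha>) * U = ?\<chi> \<alpha> \<cdot>\<^sub>m kron ?A (pauli_string \<alpha>)" .
    qed
    show "pauli_form a n S (?\<chi> * f1) (?\<chi> * f2) (?\<chi> * f3) (?\<chi> * f4) = pauli_form a n S f1 f2 f3 f4"
      unfolding conj[symmetric]
      by (rule trace_form_conj[OF _ _ _ _ U Ua UU]) simp_all
  qed simp_all
qed

text \<open>The normalizing factor is the same for all multipliers, so inequalities for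
  \<open>N\<close> transfer directly.\<close>

lemma schatten_norm_4_pauli_multiplier:
  "schatten_norm 4 (pauli_multiplier a n S f) =
    quartic_form.N (pauli_form a n S) f / root 4 (real (a * 2 ^ n))"
proof -
  interpret quartic_form "pauli_form a n S"
    unfolding pauli_multiplier_def by (rule quartic_form_trace_form)
  show ?thesis
    unfolding N_def n4_def schatten_norm_4[OF pauli_multiplier_carrier] real_root_divide
    by (simp only: trace_form_def)
qed

theorem theorem4p11:
  shows "\<exists>b \<gamma> :: real. b > 0 \<and> \<gamma> > 0 \<and>
    (\<forall>(d\<^sub>0::nat) (n::nat) (S::complex mat) (k::nat).
       d\<^sub>0 \<ge> 1 \<longrightarrow> n \<ge> 1 \<longrightarrow>
       S \<in> carrier_mat (d\<^sub>0 * 2 ^ n) (d\<^sub>0 * 2 ^ n) \<longrightarrow> hermitian_mat S \<longrightarrow> k \<ge> 1 \<longrightarrow>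
       (\<exists>(R::complex mat) (Rhat :: (bit \<times> bit) list \<Rightarrow> complex mat).
          R \<in> carrier_mat (d\<^sub>0 * 2 ^ n) (d\<^sub>0 * 2 ^ n) \<and> hermitian_mat R \<and>
          (\<forall>\<alpha>. Rhat \<alpha> \<in> carrier_mat d\<^sub>0 d\<^sub>0) \<and>
          R = mat_sum (d\<^sub>0 * 2 ^ n) (\<lambda>\<alpha>. kron (Rhat \<alpha>) (pauli_string \<alpha>))
                {\<alpha> \<in> pauli_indices n. pauli_weight \<alpha> \<le> k} \<and>
          schatten_norm 4 (S - R) \<le>
            2 * schatten_norm 4
                  (S - id_tensor d\<^sub>0 (2 ^ n) (depolarizing n (b * real k powr (- \<gamma>))) S)))"
proof -
  define \<gamma> :: real where "\<gamma> = ln (20/19) / ln 8"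
  have main: "\<exists>(R::complex mat) (Rhat :: (bit \<times> bit) list \<Rightarrow> complex mat).
      R \<in> carrier_mat (a * 2 ^ n) (a * 2 ^ n) \<and> hermitian_mat R \<and>
      (\<forall>\<alpha>. Rhat \<alpha> \<in> carrier_mat a a) \<and>
      R = mat_sum (a * 2 ^ n) (\<lambda>\<alpha>. kron (Rhat \<alpha>) (pauli_string \<alpha>))
            {\<alpha> \<in> pauli_indices n. pauli_weight \<alpha> \<le> k} \<and>
      schatten_norm 4 (S - R) \<le>
        2 * schatten_norm 4 (S - id_tensor a (2 ^ n) (depolarizing n (220 * real k powr (- \<gamma>))) S)"
    if S: "S \<in> carrier_mat (a * 2 ^ n) (a * 2 ^ n)" "hermitian_mat S" and k: "1 \<le> k" for a n k S
  proof -
    define u where "u = 220 * real k powr (- \<gamma>)"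
    obtain L and r \<sigma> :: real where r: "0 \<le> r" "r < 1" "r ^ Suc k / (1 - r) \<le> 1/2"
      and \<sigma>: "0 \<le> \<sigma>" "\<sigma> \<le> 1" and u: "\<sigma> * poly (multiscale_poly (19/20) L) r = exp (- u)"
      using scale_for_degree[OF k] unfolding u_def \<gamma>_def by blast
    interpret weight_form "pauli_form a n S" n UNIV "\<lambda>i c \<alpha>. pauli_sign c (\<alpha> ! i)" "\<lambda>i \<alpha>. \<alpha> ! i \<noteq> (0, 0)" "(0, 0)"
      by (rule weight_form_pauli)
    obtain h :: "(bit \<times> bit) list \<Rightarrow> real" where h: "\<And>\<alpha>. k < wt \<alpha> \<Longrightarrow> h \<alpha> = 0"
      and le: "N (\<lambda>\<alpha>. 1 - of_real (h \<alpha>)) \<le> 2 * N (\<lambda>\<alpha>. 1 - of_real (exp (- u) ^ wt \<alpha>))"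
      using low_weight_approximation[OF coeff_multiscale_poly_0 admissible_multiscale_poly r \<sigma>, of L]
      unfolding u by blast
    \<comment> \<open>\<open>wt\<close> counts positions below \<open>n\<close> and
      \<open>pauli_weight\<close> positions below the length, so they agree on lists of length
      \<open>n\<close>.\<close>
    have wt: "wt \<alpha> = pauli_weight \<alpha>" if "\<alpha> \<in> pauli_indices n" for \<alpha>
      using that by (simp add: wt_def pauli_weight_def pauli_indices_def)
    let ?M = "pauli_multiplier a n S"
    define R where "R = ?M (\<lambda>\<alpha>. of_real (h \<alpha>))"
    define Rhat where "Rhat \<alpha> = of_real (h \<alpha>) \<cdot>\<^sub>m pauli_coeff a n S \<alpha>" for \<alpha>
    let ?I = "{\<alpha> \<in> pauli_indices n. pauli_weight \<alpha> \<le> k}"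
    have "R = mat_sum (a * 2 ^ n) (\<lambda>\<alpha>. kron (Rhat \<alpha>) (pauli_string \<alpha>)) ?I"
    proof (rule eq_matI)
      fix i j assume "i < dim_row (mat_sum (a * 2 ^ n) (\<lambda>\<alpha>. kron (Rhat \<alpha>) (pauli_string \<alpha>)) ?I)"
        "j < dim_col (mat_sum (a * 2 ^ n) (\<lambda>\<alpha>. kron (Rhat \<alpha>) (pauli_string \<alpha>)) ?I)"
      then have ij: "i < a * 2 ^ n" "j < a * 2 ^ n" by (simp_all add: mat_sum_def)
      have K: "kron (Rhat \<alpha>) (pauli_string \<alpha>) $$ (i, j) =
          of_real (h \<alpha>) * kron (pauli_coeff a n S \<alpha>) (pauli_string \<alpha>) $$ (i, j)"
        if \<alpha>: "\<alpha> \<in> pauli_indices n" for \<alpha>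
        using ij[THEN tensor_div_less] carrier_matD[OF pauli_coeff_carrier[of a n S \<alpha>]]
        by (simp add: kron_index[OF _ pauli_string_carrier'[OF \<alpha>] ij, of _] Rhat_def mult.assoc)
      have "R $$ (i, j) = (\<Sum>\<alpha>\<in>pauli_indices n.
          of_real (h \<alpha>) * kron (pauli_coeff a n S \<alpha>) (pauli_string \<alpha>) $$ (i, j))"
        using ij by (simp add: R_def pauli_multiplier_def multiplier_def)
      \<comment> \<open>The multiplier \<open>h\<close> vanishes on weights above \<open>k\<close>,
        which gives \<open>R\<close> the required form.\<close>
      also have "\<dots> = (\<Sum>\<alpha>\<in>?I. of_real (h \<alpha>) * kron (pauli_coeff a n S \<alpha>) (pauli_string \<alpha>) $$ (i, j))"
        by (rule sum.mono_neutral_right) (use h wt in \<open>auto simp: not_le\<close>)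
      also have "\<dots> = (\<Sum>\<alpha>\<in>?I. kron (Rhat \<alpha>) (pauli_string \<alpha>) $$ (i, j))"
        by (rule sum.cong) (simp_all add: K)
      also have "\<dots> = mat_sum (a * 2 ^ n) (\<lambda>\<alpha>. kron (Rhat \<alpha>) (pauli_string \<alpha>)) ?I $$ (i, j)"
        using ij by (simp add: mat_sum_def)
      finally show "R $$ (i, j) = mat_sum (a * 2 ^ n) (\<lambda>\<alpha>. kron (Rhat \<alpha>) (pauli_string \<alpha>)) ?I $$ (i, j)" .
    qed (simp_all add: R_def pauli_multiplier_def multiplier_def mat_sum_def)
    moreover have "schatten_norm 4 (S - R) \<le>
        2 * schatten_norm 4 (S - id_tensor a (2 ^ n) (depolarizing n u) S)"
    proof -
      \<comment> \<open>\<open>S\<close> itself corresponds to the constant multiplier 1, so both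
        sides of the claim are norms of multipliers.\<close>
      have diff: "S - ?M f = ?M (\<lambda>\<alpha>. 1 - f \<alpha>)" for f
      proof -
        have "?M (\<lambda>\<alpha>. 1 - f \<alpha>) = ?M (\<lambda>_. 1) - ?M f"
          unfolding pauli_multiplier_def by (rule multiplier_diff)
        then show ?thesis unfolding pauli_multiplier_one[OF S(1)] by simp
      qed
      have "id_tensor a (2 ^ n) (depolarizing n u) S = ?M (\<lambda>\<alpha>. of_real (exp (- u) ^ wt \<alpha>))"
        unfolding id_tensor_depolarizing
      proof (rule eq_matI)
        fix i j assume "i < dim_row (?M (\<lambda>\<alpha>. of_real (exp (- u) ^ wt \<alpha>)))"
          "j < dim_col (?M (\<lambda>\<alpha>. of_real (exp (- u) ^ wt \<alpha>)))"
        then have ij: "i < a * 2 ^ n" "j < a * 2 ^ n" by (simp_all add: pauli_multiplier_def multiplier_def)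
        have e: "exp (- u * real (pauli_weight \<alpha>)) = exp (- u) ^ wt \<alpha>" if "\<alpha> \<in> pauli_indices n" for \<alpha>
          unfolding wt[OF that] by (metis exp_of_nat_mult mult.commute)
        show "?M (\<lambda>\<alpha>. of_real (exp (- u * real (pauli_weight \<alpha>)))) $$ (i, j) =
            ?M (\<lambda>\<alpha>. of_real (exp (- u) ^ wt \<alpha>)) $$ (i, j)"
          unfolding pauli_multiplier_index[OF ij] by (rule sum.cong[OF refl]) (simp only: e)
      qed (simp_all add: pauli_multiplier_def multiplier_def)
      then show ?thesis
        unfolding R_def diff schatten_norm_4_pauli_multiplier times_divide_eq_right
        by (simp only: diff schatten_norm_4_pauli_multiplier times_divide_eq_right)
          (intro divide_right_mono le, simp)
    qed
    moreover have "hermitian_mat R" unfolding R_def by (rule hermitian_pauli_multiplier[OF S])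
    moreover have "R \<in> carrier_mat (a * 2 ^ n) (a * 2 ^ n)" by (simp add: R_def)
    moreover have "\<forall>\<alpha>. Rhat \<alpha> \<in> carrier_mat a a" by (simp add: Rhat_def)
    ultimately show ?thesis unfolding u_def by blast
  qed
  show ?thesis
    by (rule exI[of _ 220], rule exI[of _ \<gamma>]) (use main in \<open>auto simp: \<gamma>_def\<close>)
qed

end
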